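(* Let $(K,K_0,L_0)$ be a weak indifferent set, $T(K)$ a maximal split torus of $\mathrm{PSp}_4(K)$, and $T$ a subgroup of $T(K)$ normalizing $\mathrm{PSp}_4(L_0,K_0)$ and containing $T(K)\cap\mathrm{PSp}_4(L_0,K_0)$. Let $\alpha,\beta$ be the simple roots, with $\alpha$ short and $\beta$ long. Let $\mathcal{M}$ be the structure $(K_0;L_0,T,+,\mu)$ consisting of the additive group $K_0$ with the subset $L_0$, the abstract group $T$ with its multiplication, the map $\mu:K_0\times K_0\to K_0$, $\mu(a,b)=a^2b$, and the actions of $T$ on $K_0$ and on $L_0$ corresponding (via $x_\alpha$ and $x_\beta$) to the conjugation actions of $T$ on the root subgroups $U_\alpha=x_\alpha(K_0)$ and $U_\beta=x_\beta(L_0)$. Then the group $G=T\,\mathrm{PSp}_4(L_0,K_0)$ is interdefinable with $\mathcal{M}$. In particular, $G$ is stable if and only if $\mathcal{M}$ is stable.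
   Context: A weak indifferent set is a triple $(K,K_0,L_0)$ where $K$ is a field of characteristic $2$ and $K_0,L_0$ are additive subgroups with $K^2\le L_0\le K_0\le K$, such that $L_0$ is a vector space over $K_0^2$ and $K_0$ is a vector space over the subfield of $K$ generated by $L_0$. $\mathrm{PSp}_4(L_0,K_0)$ is the subgroup of $\mathrm{PSp}_4(K)$ generated by the root subgroups $x_\gamma(K_0)$ for $\gamma$ short and $x_\gamma(L_0)$ for $\gamma$ long, where $x_\gamma$ is the standard parametrization of the root group for $\gamma$. Interdefinable means each structure is definable (interpretable) in the other. *)

theory Defs
  imports "HOL-Analysis.Cartesian_Space" "HOL-Library.Numeral_Type"
    "HOL-Algebra.Coset" "HOL-Algebra.Generated_Groups"
begin

section \<open>Many-sorted first-order structures\<close>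

text \<open>
  Languages are relational: an \<open>n\<close>-ary function is represented by its graph, an
  \<open>(n+1)\<close>-ary relation, which gives the same definable sets.  All sorts live in one
  type \<open>'a\<close>; they are meant to be disjoint.
\<close>

record ('s, 'r, 'a) struct =
  Sort :: "'s \<Rightarrow> 'a set"
  Profile :: "'r \<Rightarrow> 's list"
  Interp :: "'r \<Rightarrow> 'a list set"

datatype ('s, 'r) fm =
    Eq nat nat
  | Atom 'r "nat list"
  | Neg "('s, 'r) fm"
  | Conj "('s, 'r) fm" "('s, 'r) fm"
  | Ex 's nat "('s, 'r) fm"

primrec fv :: "('s, 'r) fm \<Rightarrow> nat set" where
  "fv (Eq i j) = {i, j}"
| "fv (Atom r is) = set is"
| "fv (Neg \<phi>) = fv \<phi>"
| "fv (Conj \<phi> \<psi>) = fv \<phi> \<union> fv \<psi>"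
| "fv (Ex s i \<phi>) = fv \<phi> - {i}"

primrec sat :: "('s, 'r, 'a) struct \<Rightarrow> (nat \<Rightarrow> 'a) \<Rightarrow> ('s, 'r) fm \<Rightarrow> bool" where
  "sat M v (Eq i j) \<longleftrightarrow> v i = v j"
| "sat M v (Atom r is) \<longleftrightarrow> map v is \<in> Interp M r"
| "sat M v (Neg \<phi>) \<longleftrightarrow> \<not> sat M v \<phi>"
| "sat M v (Conj \<phi> \<psi>) \<longleftrightarrow> sat M v \<phi> \<and> sat M v \<psi>"
| "sat M v (Ex s i \<phi>) \<longleftrightarrow> (\<exists>x \<in> Sort M s. sat M (v(i := x)) \<phi>)"

definition tuples :: "('s, 'r, 'a) struct \<Rightarrow> 's list \<Rightarrow> 'a list set" where
  "tuples M \<sigma> = listset (map (Sort M) \<sigma>)"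

text \<open>
  Definability is with parameters: the variables \<open>0, \<dots>, length \<sigma> - 1\<close> range over the
  tuple, the next ones are bound to the parameters \<open>ps\<close>.
\<close>

definition definable :: "('s, 'r, 'a) struct \<Rightarrow> 's list \<Rightarrow> 'a list set \<Rightarrow> bool" where
  "definable M \<sigma> X \<longleftrightarrow>
     (\<exists>\<phi> ps. set ps \<subseteq> (\<Union>s. Sort M s) \<and> fv \<phi> \<subseteq> {..<length \<sigma> + length ps} \<and>
        X = {xs \<in> tuples M \<sigma>. sat M (\<lambda>i. (xs @ ps) ! i) \<phi>})"

text \<open>
  Each sort \<open>s\<close> of \<open>A\<close> is the image, under a map \<open>f s\<close>, of a definable set \<open>D s\<close> of
  tuples of \<open>B\<close>, and the pullbacks of equality and of all the relations of \<open>A\<close> are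
  definable in \<open>B\<close>.
\<close>

definition interpretable_in ::
    "('s, 'r, 'a) struct \<Rightarrow> ('t, 'q, 'b) struct \<Rightarrow> bool" where
  "interpretable_in A B \<longleftrightarrow>
     (\<exists>(\<sigma> :: 's \<Rightarrow> 't list) (D :: 's \<Rightarrow> 'b list set) (f :: 's \<Rightarrow> 'b list \<Rightarrow> 'a).
        (\<forall>s. definable B (\<sigma> s) (D s) \<and> f s ` D s = Sort A s \<and>
             definable B (\<sigma> s @ \<sigma> s)
               {x @ y | x y. x \<in> D s \<and> y \<in> D s \<and> f s x = f s y}) \<and>
        (\<forall>r. definable B (concat (map \<sigma> (Profile A r)))
               {concat xs | xs. xs \<in> listset (map D (Profile A r)) \<and>
                  map2 f (Profile A r) xs \<in> Interp A r}))"

definition interdefinable ::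
    "('s, 'r, 'a) struct \<Rightarrow> ('t, 'q, 'b) struct \<Rightarrow> bool" where
  "interdefinable A B \<longleftrightarrow> interpretable_in A B \<and> interpretable_in B A"

text \<open>
  No formula \<open>\<phi>(x; y)\<close> has the order property in the theory of \<open>M\<close>.  By compactness
  this means that the lengths of the finite ladders for \<open>\<phi>\<close> in \<open>M\<close> itself are bounded.
\<close>

definition has_ladder ::
    "('s, 'r, 'a) struct \<Rightarrow> ('s, 'r) fm \<Rightarrow> 's list \<Rightarrow> 's list \<Rightarrow> nat \<Rightarrow> bool" where
  "has_ladder M \<phi> \<sigma> \<tau> n \<longleftrightarrow>
     (\<exists>a b. (\<forall>i<n. a i \<in> tuples M \<sigma> \<and> b i \<in> tuples M \<tau>) \<and>
            (\<forall>i<n. \<forall>j<n. sat M (\<lambda>k. (a i @ b j) ! k) \<phi> \<longleftrightarrow> i < j))"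

definition stable :: "('s, 'r, 'a) struct \<Rightarrow> bool" where
  "stable M \<longleftrightarrow>
     (\<forall>\<phi> \<sigma> \<tau>. fv \<phi> \<subseteq> {..<length \<sigma> + length \<tau>} \<longrightarrow> (\<exists>n. \<not> has_ladder M \<phi> \<sigma> \<tau> n))"

definition group_struct :: "('a, 'm) monoid_scheme \<Rightarrow> (unit, unit, 'a) struct" where
  "group_struct G =
     \<lparr>Sort = (\<lambda>_. carrier G),
      Profile = (\<lambda>_. [(), (), ()]),
      Interp = (\<lambda>_. {[x, y, x \<otimes>\<^bsub>G\<^esub> y] | x y. x \<in> carrier G \<and> y \<in> carrier G})\<rparr>"


section \<open>Weak indifferent sets\<close>

definition add_subgroup :: "'k::field set \<Rightarrow> bool" where
  "add_subgroup A \<longleftrightarrow> 0 \<in> A \<and> (\<forall>x\<in>A. \<forall>y\<in>A. x + y \<in> A) \<and> (\<forall>x\<in>A. - x \<in> A)"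

definition is_subfield :: "'k::field set \<Rightarrow> bool" where
  "is_subfield F \<longleftrightarrow> add_subgroup F \<and> 1 \<in> F \<and>
     (\<forall>x\<in>F. \<forall>y\<in>F. x * y \<in> F) \<and> (\<forall>x\<in>F. inverse x \<in> F)"

definition subfield_generated :: "'k::field set \<Rightarrow> 'k set" where
  "subfield_generated A = \<Inter>{F. is_subfield F \<and> A \<subseteq> F}"

definition subspace_over :: "'k::field set \<Rightarrow> 'k set \<Rightarrow> bool" where
  "subspace_over F V \<longleftrightarrow> add_subgroup V \<and> (\<forall>c\<in>F. \<forall>x\<in>V. c * x \<in> V)"

text \<open>
  The set of squares of \<open>K0\<close> need not be a field.  Since \<open>L0\<close> contains all squares of the
  field, being closed under multiplication by these squares is the same as being a vector
  space over the subfield they generate.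
\<close>

definition weak_indifferent_set :: "'k::field set \<Rightarrow> 'k set \<Rightarrow> bool" where
  "weak_indifferent_set K0 L0 \<longleftrightarrow>
     CHAR('k) = 2 \<and> add_subgroup K0 \<and> add_subgroup L0 \<and>
     range (\<lambda>x. x\<^sup>2) \<subseteq> L0 \<and> L0 \<subseteq> K0 \<and>
     subspace_over ((\<lambda>x. x\<^sup>2) ` K0) L0 \<and>
     subspace_over (subfield_generated L0) K0"


section \<open>The group \<open>PSp\<^sub>4\<close>, its tori and root subgroups\<close>

text \<open>The elements of the index type \<open>4\<close> are \<open>1, 2, 3, 4\<close> (with \<open>4 = 0\<close>).\<close>

definition unit_mat :: "4 \<Rightarrow> 4 \<Rightarrow> 'k::field^4^4" where
  "unit_mat i j = (\<chi> k l. if k = i \<and> l = j then 1 else 0)"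

definition symp_form :: "'k::field^4^4" where
  "symp_form = unit_mat 1 4 + unit_mat 2 3 - unit_mat 3 2 - unit_mat 4 1"

definition Sp4 :: "('k::field^4^4) monoid" where
  "Sp4 = \<lparr>carrier = {A. transpose A ** symp_form ** A = symp_form},
          monoid.mult = (**), one = mat 1\<rparr>"

definition center :: "('a, 'm) monoid_scheme \<Rightarrow> 'a set" where
  "center G = {z \<in> carrier G. \<forall>x \<in> carrier G. z \<otimes>\<^bsub>G\<^esub> x = x \<otimes>\<^bsub>G\<^esub> z}"

definition PSp4 :: "('k::field^4^4) set monoid" where
  "PSp4 = Sp4 Mod center Sp4"

definition proj_Sp4 :: "'k::field^4^4 \<Rightarrow> ('k^4^4) set" where
  "proj_Sp4 A = center Sp4 #>\<^bsub>Sp4\<^esub> A"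

definition torus_mat :: "'k::field \<Rightarrow> 'k \<Rightarrow> 'k^4^4" where
  "torus_mat s t =
     (\<chi> i j. if i \<noteq> j then 0 else if i = 1 then s else if i = 2 then t
             else if i = 3 then inverse t else inverse s)"

text \<open>The pair \<open>(i, j)\<close> stands for the character of the torus that maps
  \<open>torus_mat s t\<close> to \<open>s powi i * t powi j\<close>.\<close>

definition short_roots :: "(int \<times> int) set" where
  "short_roots = {(1, -1), (-1, 1), (1, 1), (-1, -1)}"

definition long_roots :: "(int \<times> int) set" where
  "long_roots = {(2, 0), (-2, 0), (0, 2), (0, -2)}"

definition root_alpha :: "int \<times> int" where "root_alpha = (1, -1)"

definition root_beta :: "int \<times> int" where "root_beta = (0, 2)"

definition root_vector :: "int \<times> int \<Rightarrow> 'k::field^4^4" where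
  "root_vector \<gamma> =
    (if \<gamma> = (1, -1) then unit_mat 1 2 - unit_mat 3 4
     else if \<gamma> = (-1, 1) then unit_mat 2 1 - unit_mat 4 3
     else if \<gamma> = (1, 1) then unit_mat 1 3 + unit_mat 2 4
     else if \<gamma> = (-1, -1) then unit_mat 3 1 + unit_mat 4 2
     else if \<gamma> = (2, 0) then unit_mat 1 4
     else if \<gamma> = (-2, 0) then unit_mat 4 1
     else if \<gamma> = (0, 2) then unit_mat 2 3
     else if \<gamma> = (0, -2) then unit_mat 3 2
     else 0)"

text \<open>The root vectors square to zero, so this is their exponential.\<close>

definition root_mat :: "int \<times> int \<Rightarrow> 'k::field \<Rightarrow> 'k^4^4" where
  "root_mat \<gamma> a = mat 1 + (\<chi> i j. a * root_vector \<gamma> $ i $ j)"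

text \<open>
  The maximal split tori are the conjugates of the diagonal one.  In the following, \<open>g\<close>
  selects the torus; the root subgroups with respect to it are conjugated accordingly.
\<close>

definition conj_by :: "('a, 'm) monoid_scheme \<Rightarrow> 'a \<Rightarrow> 'a \<Rightarrow> 'a" where
  "conj_by G g x = g \<otimes>\<^bsub>G\<^esub> x \<otimes>\<^bsub>G\<^esub> inv\<^bsub>G\<^esub> g"

definition split_torus :: "('k::field^4^4) set \<Rightarrow> ('k^4^4) set set" where
  "split_torus g = {conj_by PSp4 g (proj_Sp4 (torus_mat s t)) | s t. s \<noteq> 0 \<and> t \<noteq> 0}"

definition root_elt ::
    "('k::field^4^4) set \<Rightarrow> int \<times> int \<Rightarrow> 'k \<Rightarrow> ('k^4^4) set" where
  "root_elt g \<gamma> a = conj_by PSp4 g (proj_Sp4 (root_mat \<gamma> a))"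

definition PSp4_mixed ::
    "('k::field^4^4) set \<Rightarrow> 'k set \<Rightarrow> 'k set \<Rightarrow> ('k^4^4) set set" where
  "PSp4_mixed g L0 K0 =
     generate PSp4 ((\<Union>\<gamma>\<in>short_roots. root_elt g \<gamma> ` K0) \<union>
                    (\<Union>\<gamma>\<in>long_roots. root_elt g \<gamma> ` L0))"


section \<open>The structure \<open>(K0; L0, T, +, \<mu>)\<close>\<close>

datatype m_sort = Field_Sort | Torus_Sort

datatype m_rel = In_L0 | Add | Mu | Torus_Mult | Act_K0 | Act_L0

text \<open>Two sorts, \<open>K0\<close> and \<open>T\<close>; the actions of \<open>t \<in> T\<close> are given by
  \<open>t x(a) t\<^sup>-\<^sup>1 = x(b)\<close> for \<open>x = x\<^sub>\<alpha>\<close> and \<open>x = x\<^sub>\<beta>\<close>.\<close>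

definition M_struct ::
    "('k::field^4^4) set \<Rightarrow> 'k set \<Rightarrow> 'k set \<Rightarrow> ('k^4^4) set set \<Rightarrow>
     (m_sort, m_rel, 'k + ('k^4^4) set) struct" where
  "M_struct g K0 L0 T =
     \<lparr>Sort = (\<lambda>s. case s of Field_Sort \<Rightarrow> Inl ` K0 | Torus_Sort \<Rightarrow> Inr ` T),
      Profile = (\<lambda>r. case r of
          In_L0 \<Rightarrow> [Field_Sort]
        | Add \<Rightarrow> [Field_Sort, Field_Sort, Field_Sort]
        | Mu \<Rightarrow> [Field_Sort, Field_Sort, Field_Sort]
        | Torus_Mult \<Rightarrow> [Torus_Sort, Torus_Sort, Torus_Sort]
        | Act_K0 \<Rightarrow> [Torus_Sort, Field_Sort, Field_Sort]
        | Act_L0 \<Rightarrow> [Torus_Sort, Field_Sort, Field_Sort]),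
      Interp = (\<lambda>r. case r of
          In_L0 \<Rightarrow> {[Inl a] | a. a \<in> L0}
        | Add \<Rightarrow> {[Inl a, Inl b, Inl (a + b)] | a b. a \<in> K0 \<and> b \<in> K0}
        | Mu \<Rightarrow> {[Inl a, Inl b, Inl (a\<^sup>2 * b)] | a b. a \<in> K0 \<and> b \<in> K0}
        | Torus_Mult \<Rightarrow> {[Inr t, Inr u, Inr (t \<otimes>\<^bsub>PSp4\<^esub> u)] | t u. t \<in> T \<and> u \<in> T}
        | Act_K0 \<Rightarrow> {[Inr t, Inl a, Inl b] | t a b. t \<in> T \<and> a \<in> K0 \<and> b \<in> K0 \<and>
            conj_by PSp4 t (root_elt g root_alpha a) = root_elt g root_alpha b}
        | Act_L0 \<Rightarrow> {[Inr t, Inl a, Inl b] | t a b. t \<in> T \<and> a \<in> L0 \<and> b \<in> L0 \<and>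
            conj_by PSp4 t (root_elt g root_beta a) = root_elt g root_beta b})\<rparr>"

end

theory Submission
  imports Defs "HOL-Library.Nat_Bijection"
begin

text \<open>
  In characteristic 2 the centre of \<open>Sp\<^sub>4\<close> is trivial and the Weyl group embeds as a group of
  permutation matrices, so \<open>G\<close> can be treated as a group of matrices. The Bruhat decomposition
  \<open>G = U T W U\<close>, proved by closing the right-hand side under right multiplication by generators,
  shows that every element of \<open>G\<close> is \<open>t\<close> times a word of bounded length in root elements, and
  that \<open>G\<close> meets the full root groups and the full torus in \<open>x\<^sub>\<gamma>(K\<^sub>0)\<close> or \<open>x\<^sub>\<gamma>(L\<^sub>0)\<close>, and \<open>T\<close>.

  The structure is interpreted in \<open>G\<close> as follows. Each root group is the centralizer of three
  elements, and \<open>T\<close> consists of the elements that normalize the long root groups. Encode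
  \<open>a \<in> K\<^sub>0\<close> by \<open>x\<^sub>\<alpha>(a)\<close>. The commutator of \<open>x\<^sub>\<alpha>(1)\<close> and \<open>x\<^sub>\<beta>(b)\<close> links \<open>x\<^sub>\<beta>(b)\<close> with \<open>x\<^sub>\<alpha>(b)\<close>, and \<open>\<mu>\<close>
  is the action on \<open>U\<^sub>\<alpha>\<close> of \<open>h\<^sub>\<alpha>(a)\<close>, which is definable from \<open>x\<^sub>\<alpha>(a)\<close>.

  Conversely \<open>G\<close> is interpreted by the parameters of the words. The entries of the resulting
  matrices lie in \<open>K\<close> and not in \<open>K\<^sub>0\<close>, but their squares are in \<open>K\<^sup>2 \<subseteq> K\<^sub>0\<close> and are definable from the
  parameters by addition, \<open>\<mu>\<close> and the actions of \<open>T\<close>; as squaring is injective, equality and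
  multiplication of matrices can be tested on the squares.
\<close>

subsection \<open>Definable predicates\<close>

text \<open>The closure argument cannot be run with \<open>T\<close> from the start. Moving torus
  factors past unipotent ones requires that \<open>T\<close> acts on the parameter sets
  \<open>K0\<close> and \<open>L0\<close>, whereas the hypothesis only says that \<open>T\<close>
  normalizes the mixed group; that a conjugate of a root element again has its parameter in
  \<open>K0\<close> or \<open>L0\<close> is known only once the mixed group is bounded from above.
  Hence \<open>cells\<close> takes the torus as an argument \<open>H\<close> and is used twice: with
  all diagonal matrices that preserve \<open>K0\<close> and \<open>L0\<close>, which gives this
  bound and then \<open>T_mat \<subseteq> torus\<close>, and again with \<open>T_mat\<close>, which
  gives the decomposition of G. The bound on the word length is what makes an interpretation
  possible: one fixed finite tuple of sorts codes every element of G. On the logical side, formulas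
  are hidden behind predicates on infinite valuations that are closed under connectives, quantifiers
  and substitution of definable terms, so that definability is proved in both directions by
  introduction rules.\<close>

lemma finite_fv: "finite (fv \<phi>)"
  by (induction \<phi>) auto

lemma sat_cong:
  "(\<And>i. i \<in> fv \<phi> \<Longrightarrow> v i = w i) \<Longrightarrow> sat M v \<phi> = sat M w \<phi>"
proof (induction \<phi> arbitrary: v w)
  case (Atom r js)
  then have "map v js = map w js" by auto
  then show ?case by (simp only: sat.simps)
next
  case (Neg \<phi>)
  have "sat M v \<phi> = sat M w \<phi>" using Neg.prems by (intro Neg.IH) auto
  then show ?case by simp
next
  case (Conj \<phi> \<psi>)
  have "sat M v \<phi> = sat M w \<phi>" using Conj.prems by (intro Conj.IH) auto
  moreover have "sat M v \<psi> = sat M w \<psi>" using Conj.prems by (intro Conj.IH) auto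
  ultimately show ?case by simp
next
  case (Ex s i \<phi>)
  have "sat M (v(i := x)) \<phi> = sat M (w(i := x)) \<phi>" for x
    using Ex.prems by (intro Ex.IH) auto
  then show ?case by simp
qed auto

text \<open>Simultaneous renaming of the variables by \<open>h\<close>. A bound variable is moved
  above all values of \<open>h\<close> on the free variables of its scope, which excludes capture;
  the inserted 0 keeps \<open>Max\<close> meaningful when there are none.\<close>

primrec subst_fm :: "('s, 'r) fm \<Rightarrow> (nat \<Rightarrow> nat) \<Rightarrow> ('s, 'r) fm" where
  "subst_fm (Eq i j) h = Eq (h i) (h j)"
| "subst_fm (Atom r is) h = Atom r (map h is)"
| "subst_fm (Neg \<phi>) h = Neg (subst_fm \<phi> h)"
| "subst_fm (Conj \<phi> \<psi>) h = Conj (subst_fm \<phi> h) (subst_fm \<psi> h)"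
| "subst_fm (Ex s i \<phi>) h =
     Ex s (Suc (Max (insert 0 (h ` fv \<phi>))))
       (subst_fm \<phi> (h(i := Suc (Max (insert 0 (h ` fv \<phi>))))))"

lemma fv_subst_fm: "fv (subst_fm \<phi> h) \<subseteq> h ` fv \<phi>"
proof (induction \<phi> arbitrary: h)
  case (Conj \<phi> \<psi>)
  then show ?case by (fastforce simp: image_Un)
next
  case (Ex s i \<phi>)
  let ?j = "Suc (Max (insert 0 (h ` fv \<phi>)))"
  have "fv (subst_fm \<phi> (h(i := ?j))) \<subseteq> h(i := ?j) ` fv \<phi>" by (rule Ex.IH)
  then show ?case by auto
qed auto

lemma sat_subst_fm: "sat M v (subst_fm \<phi> h) = sat M (v \<circ> h) \<phi>"
proof (induction \<phi> arbitrary: h v)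
  case (Ex s i \<phi>)
  define j where "j = Suc (Max (insert 0 (h ` fv \<phi>)))"
  have less: "h k < j" if "k \<in> fv \<phi>" for k
    using that finite_fv[of \<phi>] by (auto simp: j_def less_Suc_eq_le intro!: Max_ge)
  have "sat M (v(j := x)) (subst_fm \<phi> (h(i := j))) = sat M ((v \<circ> h)(i := x)) \<phi>" for x
    unfolding Ex.IH using less by (intro sat_cong) fastforce
  then show ?case by (simp add: j_def[symmetric] comp_def)
qed auto

lemma mem_listset: "xs \<in> listset As \<longleftrightarrow> list_all2 (\<in>) xs As"
  by (induction As arbitrary: xs) (auto simp: set_Cons_def list_all2_Cons2)

lemma mem_tuples: "xs \<in> tuples M \<sigma> \<longleftrightarrow> list_all2 (\<lambda>x s. x \<in> Sort M s) xs \<sigma>"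
  by (simp add: tuples_def mem_listset list.rel_map)

section \<open>Predicates on infinite valuations\<close>

definition envs :: "('s, 'r, 'a) struct \<Rightarrow> (nat \<Rightarrow> 's) \<Rightarrow> (nat \<Rightarrow> 'a) set" where
  "envs M S = {v. \<forall>i. v i \<in> Sort M (S i)}"

text \<open>The variables of a formula are shared between the valuation \<open>v\<close> and the parameters \<open>p\<close>.\<close>

definition mix :: "(nat \<Rightarrow> 'a) \<Rightarrow> (nat \<Rightarrow> 'a) \<Rightarrow> nat \<Rightarrow> 'a" where
  "mix v p = case_sum v p \<circ> sum_decode"

text \<open>Variables and parameters both form infinite sequences, so that the closure rules need
  not track arities. A formula uses finitely many of them, and \<open>definableI\<close> cuts back
  to finite tuples.\<close>

definition definable_pred ::
    "('s, 'r, 'a) struct \<Rightarrow> (nat \<Rightarrow> 's) \<Rightarrow> ((nat \<Rightarrow> 'a) \<Rightarrow> bool) \<Rightarrow> bool" where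
  "definable_pred M S P \<longleftrightarrow>
     (\<exists>\<phi> p. range p \<subseteq> (\<Union>s. Sort M s) \<and> (\<forall>v \<in> envs M S. P v \<longleftrightarrow> sat M (mix v p) \<phi>))"

lemma envs_map: "v \<in> envs M S \<Longrightarrow> map S is = \<sigma> \<Longrightarrow> map v is \<in> tuples M \<sigma>"
  by (auto simp: envs_def mem_tuples list_all2_conv_all_nth)

lemma envs_case_nat [simp]:
  "v \<in> envs M (case_nat s S) \<longleftrightarrow> v 0 \<in> Sort M s \<and> (\<lambda>i. v (Suc i)) \<in> envs M S"
  by (auto simp: envs_def split: nat.splits)

lemma definable_predE:
  assumes "definable_pred M S P"
  obtains \<phi> p where "range p \<subseteq> (\<Union>s. Sort M s)"
    "\<And>v. v \<in> envs M S \<Longrightarrow> P v \<longleftrightarrow> sat M (mix v p) \<phi>"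
  using assms unfolding definable_pred_def by blast

lemma definable_pred_cong:
  assumes "definable_pred M S P" "\<And>v. v \<in> envs M S \<Longrightarrow> P v \<longleftrightarrow> Q v"
  shows "definable_pred M S Q"
  using assms unfolding definable_pred_def by simp

lemma definable_pred_not:
  assumes "definable_pred M S P"
  shows "definable_pred M S (\<lambda>v. \<not> P v)"
proof -
  from assms obtain \<phi> p where "range p \<subseteq> (\<Union>s. Sort M s)"
    "\<And>v. v \<in> envs M S \<Longrightarrow> P v \<longleftrightarrow> sat M (mix v p) \<phi>" by (rule definable_predE) blast
  then show ?thesis
    unfolding definable_pred_def by (intro exI[of _ "Neg \<phi>"] exI[of _ p]) simp
qed

lemma definable_pred_conj:
  assumes "definable_pred M S P" "definable_pred M S Q"
  shows "definable_pred M S (\<lambda>v. P v \<and> Q v)"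
proof -
  obtain \<phi> p where p: "range p \<subseteq> (\<Union>s. Sort M s)"
    "\<And>v. v \<in> envs M S \<Longrightarrow> P v \<longleftrightarrow> sat M (mix v p) \<phi>" using assms(1) by (rule definable_predE) blast
  obtain \<psi> q where q: "range q \<subseteq> (\<Union>s. Sort M s)"
    "\<And>v. v \<in> envs M S \<Longrightarrow> Q v \<longleftrightarrow> sat M (mix v q) \<psi>" using assms(2) by (rule definable_predE) blast
  \<comment> \<open>\<open>h c\<close> fixes the variables and sends parameter number
    \<open>i\<close> to slot \<open>c i\<close> of the merged sequence \<open>mix p q\<close>:
    \<open>Inl\<close> for the parameters of \<phi>, \<open>Inr\<close> for those of \<psi>.\<close>
  define h where "h c = sum_encode \<circ> map_sum id (\<lambda>i. sum_encode (c i)) \<circ> sum_decode"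
    for c :: "nat \<Rightarrow> nat + nat"
  have "mix v (mix p q) \<circ> h Inl = mix v p" "mix v (mix p q) \<circ> h Inr = mix v q" for v
    by (auto simp: mix_def h_def fun_eq_iff split: sum.splits)
  moreover have "p i \<in> (\<Union>s. Sort M s)" "q i \<in> (\<Union>s. Sort M s)" for i
    using p(1) q(1) by blast+
  then have "mix p q i \<in> (\<Union>s. Sort M s)" for i
    by (cases "sum_decode i") (simp_all add: mix_def)
  then have "range (mix p q) \<subseteq> (\<Union>s. Sort M s)" by blast
  ultimately show ?thesis
    unfolding definable_pred_def
    by (intro exI[of _ "Conj (subst_fm \<phi> (h Inl)) (subst_fm \<psi> (h Inr))"] exI[of _ "mix p q"])
      (simp add: sat_subst_fm p q)
qed

lemma definable_pred_comp:
  assumes "definable_pred M (\<lambda>i. S (h i)) P"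
  shows "definable_pred M S (\<lambda>v. P (\<lambda>i. v (h i)))"
proof -
  obtain \<phi> p where p: "range p \<subseteq> (\<Union>s. Sort M s)"
    "\<And>v. v \<in> envs M (\<lambda>i. S (h i)) \<Longrightarrow> P v \<longleftrightarrow> sat M (mix v p) \<phi>"
    using assms(1) by (rule definable_predE) blast
  define k where "k = sum_encode \<circ> map_sum h id \<circ> sum_decode"
  have "mix v p \<circ> k = mix (\<lambda>i. v (h i)) p" for v
    by (auto simp: mix_def k_def fun_eq_iff split: sum.splits)
  moreover have "(\<lambda>i. v (h i)) \<in> envs M (\<lambda>i. S (h i))" if "v \<in> envs M S" for v
    using that by (auto simp: envs_def)
  ultimately show ?thesis
    unfolding definable_pred_def
    by (intro exI[of _ "subst_fm \<phi> k"] exI[of _ p]) (simp add: sat_subst_fm p)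
qed

text \<open>Quantifiers are handled in de Bruijn style: the bound variable is variable \<open>0\<close>.\<close>

lemma definable_pred_ex:
  assumes "definable_pred M (case_nat s S) (\<lambda>v. P (\<lambda>i. v (Suc i)) (v 0))"
  shows "definable_pred M S (\<lambda>v. \<exists>x \<in> Sort M s. P v x)"
proof -
  obtain \<phi> p where p: "range p \<subseteq> (\<Union>s. Sort M s)"
    "\<And>v. v \<in> envs M (case_nat s S) \<Longrightarrow> P (\<lambda>i. v (Suc i)) (v 0) \<longleftrightarrow> sat M (mix v p) \<phi>"
    using assms(1) by (rule definable_predE) blast
  \<comment> \<open>The bound variable occupies parameter slot 0. The true parameters move up by
    one, and slot 0 receives \<open>p 0\<close> as a dummy that the quantifier overwrites.\<close>
  define k where "k = sum_encode \<circ>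
    (\<lambda>c. case c of Inl 0 \<Rightarrow> Inr 0 | Inl (Suc i) \<Rightarrow> Inl i | Inr i \<Rightarrow> Inr (Suc i)) \<circ> sum_decode"
  define j where "j = sum_encode (Inr 0)"
  have neq: "sum_encode (Inl n) \<noteq> j" "sum_encode (Inr (Suc n)) \<noteq> j" for n
    by (auto simp: j_def sum_encode_eq)
  have j: "sum_encode (Inr 0) = j" by (simp add: j_def)
  have eq: "(mix v (case_nat (p 0) p))(j := x) \<circ> k = mix (case_nat x v) p" for v x
    by (rule ext) (auto simp: mix_def k_def neq j split: sum.splits nat.splits)
  have "P v x \<longleftrightarrow> sat M ((mix v (case_nat (p 0) p))(j := x)) (subst_fm \<phi> k)"
    if "v \<in> envs M S" "x \<in> Sort M s" for v x
    using p(2)[of "case_nat x v"] that by (simp add: sat_subst_fm eq)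
  moreover have "range (case_nat (p 0) p) \<subseteq> (\<Union>s. Sort M s)"
    using p(1) by (fastforce split: nat.splits)
  ultimately show ?thesis
    unfolding definable_pred_def
    by (intro exI[of _ "Ex s j (subst_fm \<phi> k)"] exI[of _ "case_nat (p 0) p"]) simp
qed

locale nonempty_sorts =
  fixes M :: "('s, 'r, 'a) struct"
  assumes nonempty: "Sort M s \<noteq> {}"
begin

lemma definable_pred_definable:
  assumes "definable M \<sigma> X" "map S is = \<sigma>"
  shows "definable_pred M S (\<lambda>v. map v is \<in> X)"
proof -
  obtain \<phi> ps where ps: "set ps \<subseteq> (\<Union>s. Sort M s)" "fv \<phi> \<subseteq> {..<length \<sigma> + length ps}"
    and X: "X = {xs \<in> tuples M \<sigma>. sat M (\<lambda>i. (xs @ ps) ! i) \<phi>}"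
    using assms(1) unfolding definable_def by blast
  obtain c where c: "c \<in> Sort M undefined" using nonempty[of undefined] by blast
  define p where "p i = (if i < length ps then ps ! i else c)" for i
  define h where "h i = sum_encode (if i < length \<sigma> then Inl (is ! i) else Inr (i - length \<sigma>))" for i
  have len: "length is = length \<sigma>" using assms(2) by auto
  have "range p \<subseteq> (\<Union>s. Sort M s)"
    using ps(1) c by (force simp: p_def set_conv_nth)
  moreover have "map v is \<in> X \<longleftrightarrow> sat M (mix v p) (subst_fm \<phi> h)" if "v \<in> envs M S" for v
  proof -
    have "sat M (\<lambda>i. (map v is @ ps) ! i) \<phi> = sat M (mix v p \<circ> h) \<phi>"
      using ps(2) len by (intro sat_cong) (auto simp: mix_def h_def p_def nth_append)
    then show ?thesis using envs_map[OF that assms(2)] by (simp add: X sat_subst_fm)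
  qed
  ultimately show ?thesis unfolding definable_pred_def by blast
qed

text \<open>Membership in \<open>X\<close> depends on the first \<open>length \<sigma>\<close>
  variables only, so the remaining ones may be frozen at chosen elements \<open>e\<close> of their
  sorts and counted as parameters. Entry \<open>k\<close> of \<open>ps\<close> holds the value of
  index \<open>k\<close>, and \<open>h\<close> sends every index that is not one of these first
  variables to that entry.\<close>

lemma definableI:
  assumes P: "definable_pred M S P" and S: "map S [0..<length \<sigma>] = \<sigma>"
    and X: "X \<subseteq> tuples M \<sigma>"
    and eq: "\<And>v. v \<in> envs M S \<Longrightarrow> map v [0..<length \<sigma>] \<in> X \<longleftrightarrow> P v"
  shows "definable M \<sigma> X"
proof -
  define n where "n = length \<sigma>"
  obtain \<phi> p where p: "range p \<subseteq> (\<Union>s. Sort M s)"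
    "\<And>v. v \<in> envs M S \<Longrightarrow> P v \<longleftrightarrow> sat M (mix v p) \<phi>"
    using P by (rule definable_predE) blast
  define e where "e s = (SOME x. x \<in> Sort M s)" for s
  have e: "e s \<in> Sort M s" for s
    unfolding e_def some_in_eq by (rule nonempty)
  define K where "K = Suc (Max (insert 0 (fv \<phi>)))"
  have K: "k < K" if "k \<in> fv \<phi>" for k
    using that finite_fv[of \<phi>] by (auto simp: K_def less_Suc_eq_le intro!: Max_ge)
  define ps where "ps = map (mix (\<lambda>i. e (S i)) p) [0..<K]"
  define h where "h k = (case sum_decode k of Inl j \<Rightarrow> if j < n then j else n + k | Inr j \<Rightarrow> n + k)" for k
  have "p k \<in> (\<Union>s. Sort M s)" "e s \<in> (\<Union>s. Sort M s)" for k s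
    using p(1) e by blast+
  then have "mix (\<lambda>i. e (S i)) p k \<in> (\<Union>s. Sort M s)" for k
    by (cases "sum_decode k") (simp_all add: mix_def)
  then have "set ps \<subseteq> (\<Union>s. Sort M s)"
    unfolding ps_def by auto
  moreover have "fv (subst_fm \<phi> h) \<subseteq> {..<length \<sigma> + length ps}"
  proof -
    have "h k < n + K" if "k \<in> fv \<phi>" for k
      using K[OF that] by (auto simp: h_def split: sum.splits)
    then show ?thesis using fv_subst_fm[of \<phi> h] by (auto simp: ps_def n_def dest!: subsetD)
  qed
  moreover
  have "xs \<in> X \<longleftrightarrow> sat M (\<lambda>i. (xs @ ps) ! i) (subst_fm \<phi> h)" if xs: "xs \<in> tuples M \<sigma>" for xs
  proof -
    define v where "v i = (if i < n then xs ! i else e (S i))" for i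
    have len: "length xs = n" using xs by (auto simp: mem_tuples n_def list_all2_conv_all_nth)
    have "S i = \<sigma> ! i" if "i < n" for i using arg_cong[OF S, of "\<lambda>l. l ! i"] that by (simp add: n_def)
    then have v: "v \<in> envs M S"
      using xs e by (auto simp: v_def envs_def mem_tuples n_def list_all2_conv_all_nth)
    have "map v [0..<length \<sigma>] = xs"
      by (intro nth_equalityI) (auto simp: len n_def[symmetric] v_def)
    then have "xs \<in> X \<longleftrightarrow> P v" using eq[OF v] by simp
    also have "\<dots> \<longleftrightarrow> sat M (mix v p) \<phi>" by (rule p(2)[OF v])
    also have "\<dots> \<longleftrightarrow> sat M ((\<lambda>i. (xs @ ps) ! i) \<circ> h) \<phi>"
    proof (intro sat_cong)
      fix k assume "k \<in> fv \<phi>"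
      with K have "k < K" by blast
      then show "mix v p k = ((\<lambda>i. (xs @ ps) ! i) \<circ> h) k"
        by (cases "sum_decode k") (simp_all add: mix_def h_def ps_def v_def nth_append len)
    qed
    finally show ?thesis by (simp add: sat_subst_fm)
  qed
  then have "X = {xs \<in> tuples M \<sigma>. sat M (\<lambda>i. (xs @ ps) ! i) (subst_fm \<phi> h)}"
    using X by auto
  ultimately show ?thesis
    unfolding definable_def by (intro exI[of _ "subst_fm \<phi> h"] exI[of _ ps] conjI)
qed

lemma definable_pred_const: "definable_pred M S (\<lambda>v. b)"
proof -
  obtain c where c: "c \<in> Sort M undefined" using nonempty[of undefined] by blast
  have "definable_pred M S (\<lambda>v. True)"
    unfolding definable_pred_def using c
    by (intro exI[of _ "Eq 0 0"] exI[of _ "\<lambda>_. c"]) auto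
  then have "definable_pred M S (\<lambda>v. True)" "definable_pred M S (\<lambda>v. False)"
    using definable_pred_not[of M S "\<lambda>v. True"] by simp_all
  then show ?thesis by (cases b) simp_all
qed

lemma definable_pred_eq_vars: "definable_pred M S (\<lambda>v. v i = v j)"
proof -
  obtain c where c: "c \<in> Sort M undefined" using nonempty[of undefined] by blast
  show ?thesis
    unfolding definable_pred_def using c
    by (intro exI[of _ "Eq (sum_encode (Inl i)) (sum_encode (Inl j))"] exI[of _ "\<lambda>_. c"])
      (auto simp: mix_def)
qed

lemma definable_pred_eq_const: "c \<in> Sort M s \<Longrightarrow> definable_pred M S (\<lambda>v. v i = c)"
  unfolding definable_pred_def
  by (intro exI[of _ "Eq (sum_encode (Inl i)) (sum_encode (Inr 0))"] exI[of _ "\<lambda>_. c"])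
    (auto simp: mix_def)

lemma definable_pred_rel: "definable_pred M S (\<lambda>v. map v is \<in> Interp M r)"
proof -
  obtain c where c: "c \<in> Sort M undefined" using nonempty[of undefined] by blast
  show ?thesis
    unfolding definable_pred_def using c
    by (intro exI[of _ "Atom r (map (\<lambda>i. sum_encode (Inl i)) is)"] exI[of _ "\<lambda>_. c"])
      (auto simp: mix_def comp_def)
qed

lemma definable_pred_disj:
  "definable_pred M S P \<Longrightarrow> definable_pred M S Q \<Longrightarrow> definable_pred M S (\<lambda>v. P v \<or> Q v)"
  using definable_pred_not[of M S "\<lambda>v. \<not> P v \<and> \<not> Q v"]
  by (simp add: definable_pred_conj definable_pred_not)

lemma definable_pred_ball_finite:
  "finite I \<Longrightarrow> (\<And>i. i \<in> I \<Longrightarrow> definable_pred M S (P i)) \<Longrightarrow> definable_pred M S (\<lambda>v. \<forall>i\<in>I. P i v)"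
  by (induction I rule: finite_induct) (simp_all add: definable_pred_const definable_pred_conj)

subsection \<open>Definable terms\<close>

text \<open>Relational languages have no function symbols, so a term is a map with definable graph;
  variable 0 carries its value.\<close>

definition definable_term :: "(nat \<Rightarrow> 's) \<Rightarrow> 's \<Rightarrow> ((nat \<Rightarrow> 'a) \<Rightarrow> 'a) \<Rightarrow> bool" where
  "definable_term S s t \<longleftrightarrow> (\<forall>v \<in> envs M S. t v \<in> Sort M s) \<and>
     definable_pred M (case_nat s S) (\<lambda>v. v 0 = t (\<lambda>i. v (Suc i)))"

lemma definable_term_var: "S i = s \<Longrightarrow> definable_term S s (\<lambda>v. v i)"
  unfolding definable_term_def using definable_pred_eq_vars by (auto simp: envs_def)

lemma definable_term_const: "c \<in> Sort M s \<Longrightarrow> definable_term S s (\<lambda>v. c)"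
  unfolding definable_term_def using definable_pred_eq_const by blast

lemma definable_term_shift:
  assumes "definable_term S s t"
  shows "definable_term (case_nat s' S) s (\<lambda>v. t (\<lambda>i. v (Suc i)))"
proof -
  define h where "h = case_nat 0 (\<lambda>i. Suc (Suc i))"
  have h: "h 0 = 0" "h (Suc i) = Suc (Suc i)" for i
    by (simp_all add: h_def)
  have "(\<lambda>i. case_nat s (case_nat s' S) (h i)) = case_nat s S"
    by (rule ext) (simp add: h_def split: nat.split)
  then have "definable_pred M (\<lambda>i. case_nat s (case_nat s' S) (h i)) (\<lambda>v. v 0 = t (\<lambda>i. v (Suc i)))"
    using assms by (simp add: definable_term_def)
  then have "definable_pred M (case_nat s (case_nat s' S)) (\<lambda>v. v (h 0) = t (\<lambda>i. v (h (Suc i))))"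
    by (rule definable_pred_comp[where S = "case_nat s (case_nat s' S)" and h = h
          and P = "\<lambda>v. v 0 = t (\<lambda>i. v (Suc i))"])
  then show ?thesis using assms by (simp add: definable_term_def h)
qed

lemma definable_pred_subst:
  assumes t: "definable_term S s t"
    and P: "definable_pred M (case_nat s S) (\<lambda>v. P (\<lambda>i. v (Suc i)) (v 0))"
  shows "definable_pred M S (\<lambda>v. P v (t v))"
proof -
  have "definable_pred M S (\<lambda>v. \<exists>x\<in>Sort M s. x = t v \<and> P v x)"
    using t P by (intro definable_pred_ex definable_pred_conj) (auto simp: definable_term_def)
  then show ?thesis
    by (rule definable_pred_cong) (use t in \<open>auto simp: definable_term_def\<close>)
qed

lemma definable_pred_subst2:
  assumes t: "definable_term S s t" and u: "definable_term S s' u"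
    and P: "definable_pred M (case_nat s' (case_nat s S)) (\<lambda>v. P (v 1) (v 0))"
  shows "definable_pred M S (\<lambda>v. P (t v) (u v))"
proof (rule definable_pred_subst[where P = "\<lambda>v x. P x (u v)" and t = t, OF t])
  show "definable_pred M (case_nat s S) (\<lambda>v. P (v 0) (u (\<lambda>i. v (Suc i))))"
    by (rule definable_pred_subst[where P = "\<lambda>v. P (v 0)" and t = "\<lambda>v. u (\<lambda>i. v (Suc i))"])
      (use P definable_term_shift[OF u] in simp_all)
qed

lemma definable_pred_subst3:
  assumes t: "definable_term S s t" and u: "definable_term S s' u" and w: "definable_term S s'' w"
    and P: "definable_pred M (case_nat s'' (case_nat s' (case_nat s S))) (\<lambda>v. P (v 2) (v 1) (v 0))"
  shows "definable_pred M S (\<lambda>v. P (t v) (u v) (w v))"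
proof (rule definable_pred_subst[where P = "\<lambda>v x. P x (u v) (w v)" and t = t, OF t])
  show "definable_pred M (case_nat s S) (\<lambda>v. P (v 0) (u (\<lambda>i. v (Suc i))) (w (\<lambda>i. v (Suc i))))"
  proof (rule definable_pred_subst[where P = "\<lambda>v x. P (v 0) x (w (\<lambda>i. v (Suc i)))"
        and t = "\<lambda>v. u (\<lambda>i. v (Suc i))"])
    show "definable_term (case_nat s S) s' (\<lambda>v. u (\<lambda>i. v (Suc i)))"
      by (rule definable_term_shift[OF u])
    show "definable_pred M (case_nat s' (case_nat s S))
       (\<lambda>v. P (v (Suc 0)) (v 0) (w (\<lambda>i. v (Suc (Suc i)))))"
      by (rule definable_pred_subst[where P = "\<lambda>v. P (v (Suc 0)) (v 0)"
            and t = "\<lambda>v. w (\<lambda>i. v (Suc (Suc i)))"])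
        (use P definable_term_shift[OF definable_term_shift[OF w]] in \<open>simp_all add: numeral_2_eq_2\<close>)
  qed
qed

lemma definable_pred_eq:
  "definable_term S s t \<Longrightarrow> definable_term S s u \<Longrightarrow> definable_pred M S (\<lambda>v. t v = u v)"
  by (rule definable_pred_subst2[where P = "(=)"]) (auto intro: definable_pred_eq_vars)

end

subsection \<open>Interpretations and stability\<close>

lemma definable_pred_ex_tuple:
  fixes M :: "('s, 'r, 'a) struct"
  assumes "definable_pred M (\<lambda>i. if i < length \<sigma> then \<sigma> ! i else S (i - length \<sigma>))
     (\<lambda>v. P (\<lambda>i. v (i + length \<sigma>)) (map v [0..<length \<sigma>]))"
  shows "definable_pred M S (\<lambda>v. \<exists>xs \<in> tuples M \<sigma>. P v xs)"
  using assms
proof (induction \<sigma> arbitrary: P S)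
  case Nil
  then show ?case by (simp add: tuples_def)
next
  case (Cons s \<sigma>)
  have *: "(\<exists>xs\<in>tuples M (s # \<sigma>). P v xs) \<longleftrightarrow> (\<exists>xs\<in>tuples M \<sigma>. \<exists>x\<in>Sort M s. P v (x # xs))" for v
    by (fastforce simp: tuples_def set_Cons_def)
  have "(\<lambda>i. if i < length (s # \<sigma>) then (s # \<sigma>) ! i else S (i - length (s # \<sigma>))) =
    case_nat s (\<lambda>i. if i < length \<sigma> then \<sigma> ! i else S (i - length \<sigma>))"
    by (auto simp: fun_eq_iff split: nat.splits)
  moreover have "map v [0..<length (s # \<sigma>)] = v 0 # map (\<lambda>i. v (Suc i)) [0..<length \<sigma>]" for v :: "nat \<Rightarrow> 'a"
    by (simp add: upt_conv_Cons map_Suc_upt[symmetric] del: upt_Suc)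
  ultimately show ?case
    using Cons.prems unfolding *
    by (intro Cons.IH definable_pred_ex) (simp del: upt_Suc)
qed

lemma tuples_singleton [simp]: "xs \<in> tuples M [s] \<longleftrightarrow> (\<exists>x \<in> Sort M s. xs = [x])"
  by (auto simp: mem_tuples list_all2_Cons2)

lemma definable_subset_tuples: "definable M \<sigma> X \<Longrightarrow> X \<subseteq> tuples M \<sigma>"
  by (auto simp: definable_def)

locale interpretation_of =
  nonempty_sorts B for B :: "('t, 'q, 'b) struct" +
  fixes A :: "('s, 'r, 'a) struct"
    and \<sigma> :: "'s \<Rightarrow> 't list" and D :: "'s \<Rightarrow> 'b list set" and f :: "'s \<Rightarrow> 'b list \<Rightarrow> 'a"
  assumes dom: "definable B (\<sigma> s) (D s)"
    and image: "f s ` D s = Sort A s"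
    and eq: "definable B (\<sigma> s @ \<sigma> s) {x @ y | x y. x \<in> D s \<and> y \<in> D s \<and> f s x = f s y}"
    and rel: "definable B (concat (map \<sigma> (Profile A r)))
               {concat xs | xs. xs \<in> listset (map D (Profile A r)) \<and>
                  map2 f (Profile A r) xs \<in> Interp A r}"
    and disjoint: "s \<noteq> t \<Longrightarrow> Sort A s \<inter> Sort A t = {}"
    and profile: "Interp A r \<subseteq> tuples A (Profile A r)"
begin

lemma length_dom:
  assumes "x \<in> D s"
  shows "length x = length (\<sigma> s)"
proof -
  have "x \<in> tuples B (\<sigma> s)" using assms definable_subset_tuples[OF dom[of s]] by blast
  then show ?thesis unfolding mem_tuples by (rule list_all2_lengthD)
qed

lemma concat_blocks_eq:
  "xs \<in> listset (map D \<rho>) \<Longrightarrow> ys \<in> listset (map D \<rho>) \<Longrightarrow> concat xs = concat ys \<Longrightarrow> xs = ys"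
proof (induction \<rho> arbitrary: xs ys)
  case (Cons s \<rho>)
  then obtain x xs' y ys' where
    "xs = x # xs'" "ys = y # ys'" "x \<in> D s" "y \<in> D s"
    "xs' \<in> listset (map D \<rho>)" "ys' \<in> listset (map D \<rho>)" "x @ concat xs' = y @ concat ys'"
    by (auto simp: set_Cons_def)
  then show ?case using Cons.IH[of xs' ys'] length_dom[of x s] length_dom[of y s] by simp
qed simp

lemma concat_mem_tuples:
  "xs \<in> listset (map D \<rho>) \<Longrightarrow> concat xs \<in> tuples B (concat (map \<sigma> \<rho>))"
proof (induction \<rho> arbitrary: xs)
  case Nil
  then show ?case by (simp add: tuples_def)
next
  case (Cons s \<rho>)
  then obtain x xs' where *: "xs = x # xs'" "x \<in> D s" "xs' \<in> listset (map D \<rho>)"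
    by (auto simp: set_Cons_def)
  have "x \<in> tuples B (\<sigma> s)" using *(2) definable_subset_tuples[OF dom[of s]] by blast
  with Cons.IH[OF *(3)] show ?case by (auto simp: *(1) mem_tuples intro: list_all2_appendI)
qed

lemma mem_dom_sort: "x \<in> D s \<Longrightarrow> f s x \<in> Sort A s"
  using image[of s] by blast

text \<open>Induction on \<phi>: variable \<open>i\<close> of \<open>A\<close>, of sort
  \<open>SA i\<close>, becomes the block \<open>bl i\<close> of variables of \<open>B\<close>.
  Formulas need not be well sorted. An equation between different sorts or an atom with the wrong
  profile is false in \<open>A\<close>, because sorts are disjoint and relations respect their
  profiles, so it is pulled back to \<open>False\<close>. The assignments \<open>SA\<close>,
  \<open>SB\<close> and \<open>bl\<close> vary in the induction since a quantifier may change the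
  sort of a variable.\<close>

lemma definable_pred_sat:
  assumes "\<And>i. i \<in> fv \<phi> \<Longrightarrow> map SB (bl i) = \<sigma> (SA i)"
  shows "\<exists>Q. definable_pred B SB Q \<and> (\<forall>v \<in> envs B SB. (\<forall>i\<in>fv \<phi>. map v (bl i) \<in> D (SA i)) \<longrightarrow>
           (Q v \<longleftrightarrow> sat A (\<lambda>i. f (SA i) (map v (bl i))) \<phi>))"
  using assms
proof (induction \<phi> arbitrary: SA SB bl)
  case (Eq i j)
  show ?case
  proof (cases "SA i = SA j")
    case True
    let ?E = "{x @ y | x y. x \<in> D (SA i) \<and> y \<in> D (SA i) \<and> f (SA i) x = f (SA i) y}"
    have "definable_pred B SB (\<lambda>v. map v (bl i @ bl j) \<in> ?E)"
      using Eq True by (intro definable_pred_definable[OF eq]) auto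
    moreover have "map v (bl i @ bl j) \<in> ?E \<longleftrightarrow> f (SA i) (map v (bl i)) = f (SA j) (map v (bl j))"
      if "map v (bl i) \<in> D (SA i)" "map v (bl j) \<in> D (SA j)" for v
    proof
      assume "map v (bl i @ bl j) \<in> ?E"
      then obtain x y where xy: "x \<in> D (SA i)" "y \<in> D (SA i)" "f (SA i) x = f (SA i) y"
        "map v (bl i) @ map v (bl j) = x @ y" by auto
      moreover have "length (map v (bl i)) = length x"
        using that xy length_dom by metis
      ultimately show "f (SA i) (map v (bl i)) = f (SA j) (map v (bl j))"
        using True by simp
    qed (use that True in force)
    ultimately show ?thesis by (intro exI conjI) auto
  next
    case False
    then have "f (SA i) (map v (bl i)) \<noteq> f (SA j) (map v (bl j))"
      if "map v (bl i) \<in> D (SA i)" "map v (bl j) \<in> D (SA j)" for v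
      using disjoint[OF False] mem_dom_sort[OF that(1)] mem_dom_sort[OF that(2)] by auto
    then show ?thesis
      by (intro exI[of _ "\<lambda>_. False"]) (simp add: definable_pred_const)
  qed
next
  case (Atom r js)
  show ?case
  proof (cases "map SA js = Profile A r")
    case True
    let ?R = "{concat xs | xs. xs \<in> listset (map D (Profile A r)) \<and>
      map2 f (Profile A r) xs \<in> Interp A r}"
    have "map (\<lambda>i. map SB (bl i)) js = map (\<lambda>i. \<sigma> (SA i)) js"
      using Atom.prems by simp
    then have "map SB (concat (map bl js)) = concat (map \<sigma> (Profile A r))"
      unfolding True[symmetric] by (simp add: map_concat comp_def del: map_eq_conv)
    then have "definable_pred B SB (\<lambda>v. map v (concat (map bl js)) \<in> ?R)"
      by (rule definable_pred_definable[OF rel])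
    moreover have "map v (concat (map bl js)) \<in> ?R \<longleftrightarrow>
        map (\<lambda>i. f (SA i) (map v (bl i))) js \<in> Interp A r"
      if D: "\<forall>i\<in>set js. map v (bl i) \<in> D (SA i)" for v
    proof -
      let ?xs = "map (\<lambda>i. map v (bl i)) js"
      have "?xs \<in> listset (map D (Profile A r))"
        using D unfolding True[symmetric] by (auto simp: mem_listset list_all2_conv_all_nth)
      moreover have "map2 f (Profile A r) ?xs = map (\<lambda>i. f (SA i) (map v (bl i))) js"
        unfolding True[symmetric] by (simp add: zip_map_map zip_same_conv_map)
      moreover have "map v (concat (map bl js)) = concat ?xs"
        by (simp add: map_concat comp_def)
      ultimately show ?thesis
        using concat_blocks_eq by (smt (verit, best) mem_Collect_eq)
    qed
    ultimately show ?thesis by (intro exI conjI) auto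
  next
    case False
    have "map (\<lambda>i. f (SA i) (map v (bl i))) js \<notin> Interp A r"
      if D: "\<forall>i\<in>set js. map v (bl i) \<in> D (SA i)" for v
    proof
      assume "map (\<lambda>i. f (SA i) (map v (bl i))) js \<in> Interp A r"
      then have *: "list_all2 (\<lambda>i s. f (SA i) (map v (bl i)) \<in> Sort A s) js (Profile A r)"
        using profile by (fastforce simp: mem_tuples list.rel_map)
      have "map SA js = Profile A r"
      proof (intro nth_equalityI)
        fix k assume "k < length (map SA js)"
        then have "f (SA (js ! k)) (map v (bl (js ! k))) \<in> Sort A (Profile A r ! k)"
          "f (SA (js ! k)) (map v (bl (js ! k))) \<in> Sort A (SA (js ! k))"
          using * D mem_dom_sort by (auto simp: list_all2_conv_all_nth)
        then show "map SA js ! k = Profile A r ! k"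
          using disjoint[of "SA (js ! k)" "Profile A r ! k"] \<open>k < _\<close> by auto
      qed (use * list_all2_lengthD in auto)
      with False show False by contradiction
    qed
    then show ?thesis
      by (intro exI[of _ "\<lambda>_. False"]) (simp add: definable_pred_const)
  qed
next
  case (Neg \<phi>)
  obtain Q where "definable_pred B SB Q"
    "\<forall>v \<in> envs B SB. (\<forall>i\<in>fv \<phi>. map v (bl i) \<in> D (SA i)) \<longrightarrow>
           (Q v \<longleftrightarrow> sat A (\<lambda>i. f (SA i) (map v (bl i))) \<phi>)"
    using Neg.IH[of SB bl SA] Neg.prems by auto
  then show ?case by (intro exI[of _ "\<lambda>v. \<not> Q v"]) (simp add: definable_pred_not)
next
  case (Conj \<phi> \<psi>)
  obtain Q where "definable_pred B SB Q"
    "\<forall>v \<in> envs B SB. (\<forall>i\<in>fv \<phi>. map v (bl i) \<in> D (SA i)) \<longrightarrow>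
           (Q v \<longleftrightarrow> sat A (\<lambda>i. f (SA i) (map v (bl i))) \<phi>)"
    using Conj.IH(1)[of SB bl SA] Conj.prems by auto
  moreover obtain R where "definable_pred B SB R"
    "\<forall>v \<in> envs B SB. (\<forall>i\<in>fv \<psi>. map v (bl i) \<in> D (SA i)) \<longrightarrow>
           (R v \<longleftrightarrow> sat A (\<lambda>i. f (SA i) (map v (bl i))) \<psi>)"
    using Conj.IH(2)[of SB bl SA] Conj.prems by auto
  ultimately show ?case
    by (intro exI[of _ "\<lambda>v. Q v \<and> R v"]) (simp add: definable_pred_conj)
next
  case (Ex s i \<phi>)
  define n where "n = length (\<sigma> s)"
  define SA' where "SA' = SA(i := s)"
  define SB' where "SB' k = (if k < n then \<sigma> s ! k else SB (k - n))" for k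
  \<comment> \<open>The block of the new variable takes the first \<open>n\<close> indices, and all
    other blocks shift by \<open>n\<close>.\<close>
  define bl' where "bl' = (\<lambda>j. map (\<lambda>k. k + n) (bl j))(i := [0..<n])"
  have "map SB' (bl' j) = \<sigma> (SA' j)" if "j \<in> fv \<phi>" for j
  proof (cases "j = i")
    case True
    then show ?thesis by (auto simp: bl'_def SA'_def SB'_def n_def intro: nth_equalityI)
  next
    case False
    then have "map SB (bl j) = \<sigma> (SA j)" using that Ex.prems by simp
    then show ?thesis using False by (simp add: bl'_def SA'_def SB'_def comp_def)
  qed
  then obtain Q where Q: "definable_pred B SB' Q"
    "\<And>v. v \<in> envs B SB' \<Longrightarrow> (\<forall>j\<in>fv \<phi>. map v (bl' j) \<in> D (SA' j)) \<Longrightarrow>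
           (Q v \<longleftrightarrow> sat A (\<lambda>j. f (SA' j) (map v (bl' j))) \<phi>)"
    using Ex.IH[of SB' bl' SA'] by blast
  define ext where "ext v xs k = (if k < n then xs ! k else v (k - n))"
    for v :: "nat \<Rightarrow> 'b" and xs k
  define R where "R v xs \<longleftrightarrow> xs \<in> D s \<and> Q (ext v xs)" for v xs
  have "definable_pred B SB (\<lambda>v. \<exists>xs\<in>tuples B (\<sigma> s). R v xs)"
  proof (rule definable_pred_ex_tuple)
    have e: "ext (\<lambda>k. v (k + n)) (map v [0..<n]) = v" for v
      by (auto simp: ext_def)
    have "definable_pred B SB' (\<lambda>v. map v [0..<n] \<in> D s \<and> Q v)"
      using Q(1) by (intro definable_pred_conj definable_pred_definable[OF dom])
        (auto simp: SB'_def n_def intro: nth_equalityI)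
    then show "definable_pred B (\<lambda>k. if k < length (\<sigma> s) then \<sigma> s ! k else SB (k - length (\<sigma> s)))
      (\<lambda>v. R (\<lambda>i. v (i + length (\<sigma> s))) (map v [0..<length (\<sigma> s)]))"
      unfolding SB'_def[symmetric] R_def n_def[symmetric] by (simp add: e)
  qed
  moreover have "(\<exists>xs\<in>tuples B (\<sigma> s). R v xs) \<longleftrightarrow>
      sat A (\<lambda>j. f (SA j) (map v (bl j))) (Ex s i \<phi>)"
    if v: "v \<in> envs B SB" and D: "\<forall>j\<in>fv (Ex s i \<phi>). map v (bl j) \<in> D (SA j)" for v
  proof -
    have "Q (ext v xs) \<longleftrightarrow> sat A ((\<lambda>j. f (SA j) (map v (bl j)))(i := f s xs)) \<phi>"
      if xs: "xs \<in> D s" for xs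
    proof -
      have t: "xs \<in> tuples B (\<sigma> s)" using xs definable_subset_tuples[OF dom[of s]] by blast
      then have len: "length xs = n" by (simp add: length_dom xs n_def)
      have env: "ext v xs \<in> envs B SB'"
        using v t by (auto simp: envs_def ext_def SB'_def mem_tuples list_all2_conv_all_nth len)
      have bl: "map (ext v xs) (bl' j) = (if j = i then xs else map v (bl j))" for j
        by (auto simp: bl'_def ext_def len intro: nth_equalityI)
      have "\<forall>j\<in>fv \<phi>. map (ext v xs) (bl' j) \<in> D (SA' j)"
        using xs D by (simp add: bl SA'_def)
      from Q(2)[OF env this] show ?thesis
        unfolding bl by (auto simp: SA'_def fun_upd_def if_distrib cong: if_cong intro!: sat_cong)
    qed
    moreover have "D s \<subseteq> tuples B (\<sigma> s)" by (rule definable_subset_tuples[OF dom])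
    ultimately show ?thesis
      unfolding R_def sat.simps image[of s, symmetric] by blast
  qed
  ultimately show ?case by blast
qed

section \<open>Pulling back definable sets and ladders along an interpretation\<close>

primrec blocks :: "nat \<Rightarrow> nat list \<Rightarrow> nat list list" where
  "blocks k [] = []"
| "blocks k (n # ns) = [k..<k + n] # blocks (k + n) ns"

lemma length_blocks [simp]: "length (blocks k ns) = length ns"
  by (induction ns arbitrary: k) auto

lemma concat_blocks: "concat (blocks k ns) = [k..<k + sum_list ns]"
proof (induction ns arbitrary: k)
  case (Cons n ns)
  have "[k..<k + (n + sum_list ns)] = [k..<k + n] @ [k + n..<k + n + sum_list ns]"
    using upt_add_eq_append[of k "k + n" "sum_list ns"] by (simp add: add.assoc)
  then show ?case using Cons by simp
qed simp

lemma length_blocks_nth: "i < length ns \<Longrightarrow> length (blocks k ns ! i) = ns ! i"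
  by (induction ns arbitrary: k i) (auto simp: nth_Cons split: nat.splits)

lemma concat_eq_lengths:
  "map length xss = map length yss \<Longrightarrow> concat xss = concat yss \<Longrightarrow> xss = yss"
proof (induction xss arbitrary: yss)
  case (Cons xs xss)
  then show ?case by (cases yss) auto
qed simp

text \<open>The blocks are consecutive intervals of indices; their lengths are prescribed by \<rho>,
  so a concatenated tuple determines how it is cut. Formulas without parameters on the side of
  \<open>A\<close> are what the ladders in \<open>stable\<close> are made of.\<close>

lemma definable_sat:
  assumes fv: "fv \<phi> \<subseteq> {..<length \<rho>}"
  shows "definable B (concat (map \<sigma> \<rho>))
    {concat xs | xs. xs \<in> listset (map D \<rho>) \<and> sat A (\<lambda>i. map2 f \<rho> xs ! i) \<phi>}"
    (is "definable B ?\<Sigma> ?X")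
proof -
  define ns where "ns = map (\<lambda>s. length (\<sigma> s)) \<rho>"
  define bl where "bl = blocks 0 ns"
  define SB where "SB k = (if k < length ?\<Sigma> then ?\<Sigma> ! k else undefined)" for k
  have sum: "sum_list ns = length ?\<Sigma>" by (simp add: ns_def length_concat comp_def)
  then have concat_bl: "concat bl = [0..<length ?\<Sigma>]" by (simp add: bl_def concat_blocks)
  have len_bl: "length bl = length \<rho>" by (simp add: bl_def ns_def)
  have SB: "map SB [0..<length ?\<Sigma>] = ?\<Sigma>"
    by (auto simp: SB_def intro: nth_equalityI)
  have len_nth: "length (bl ! i) = length (\<sigma> (\<rho> ! i))" if "i < length \<rho>" for i
    using that by (simp add: bl_def length_blocks_nth ns_def)
  have "map (map SB) bl = map \<sigma> \<rho>"
  proof (rule concat_eq_lengths)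
    show "map length (map (map SB) bl) = map length (map \<sigma> \<rho>)"
      by (intro nth_equalityI) (auto simp: len_bl len_nth)
    show "concat (map (map SB) bl) = concat (map \<sigma> \<rho>)"
      using SB by (simp add: map_concat[symmetric] concat_bl)
  qed
  then have SB_bl: "map SB (bl ! i) = \<sigma> (\<rho> ! i)" if "i < length \<rho>" for i
    using that len_bl by (metis nth_map)
  have "\<exists>Q. definable_pred B SB Q \<and> (\<forall>v \<in> envs B SB. (\<forall>i\<in>fv \<phi>. map v (bl ! i) \<in> D (\<rho> ! i)) \<longrightarrow>
           (Q v \<longleftrightarrow> sat A (\<lambda>i. f (\<rho> ! i) (map v (bl ! i))) \<phi>))"
    using fv by (intro definable_pred_sat) (auto simp: SB_bl)
  then obtain Q where Q: "definable_pred B SB Q"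
    "\<And>v. v \<in> envs B SB \<Longrightarrow> (\<forall>i\<in>fv \<phi>. map v (bl ! i) \<in> D (\<rho> ! i)) \<Longrightarrow>
           (Q v \<longleftrightarrow> sat A (\<lambda>i. f (\<rho> ! i) (map v (bl ! i))) \<phi>)" by blast
  show ?thesis
  proof (rule definableI)
    show "definable_pred B SB (\<lambda>v. (\<forall>i\<in>{..<length \<rho>}. map v (bl ! i) \<in> D (\<rho> ! i)) \<and> Q v)"
      by (intro definable_pred_conj definable_pred_ball_finite definable_pred_definable[OF dom] Q)
        (auto simp: SB_bl)
    show "map SB [0..<length ?\<Sigma>] = ?\<Sigma>" by (fact SB)
    show "?X \<subseteq> tuples B ?\<Sigma>" using concat_mem_tuples by blast
    fix v assume v: "v \<in> envs B SB"
    let ?xs = "map (map v) bl"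
    have c: "map v [0..<length ?\<Sigma>] = concat ?xs" by (simp add: concat_bl[symmetric] map_concat)
    have xs: "?xs \<in> listset (map D \<rho>) \<longleftrightarrow> (\<forall>i\<in>{..<length \<rho>}. map v (bl ! i) \<in> D (\<rho> ! i))"
      by (auto simp: mem_listset list_all2_conv_all_nth len_bl)
    have sat: "sat A (\<lambda>i. map2 f \<rho> ?xs ! i) \<phi> \<longleftrightarrow> sat A (\<lambda>i. f (\<rho> ! i) (map v (bl ! i))) \<phi>"
      using fv by (intro sat_cong) (auto simp: len_bl)
    show "map v [0..<length ?\<Sigma>] \<in> ?X \<longleftrightarrow>
        (\<forall>i\<in>{..<length \<rho>}. map v (bl ! i) \<in> D (\<rho> ! i)) \<and> Q v"
    proof
      assume "map v [0..<length ?\<Sigma>] \<in> ?X"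
      then obtain ys where ys: "concat ?xs = concat ys" "ys \<in> listset (map D \<rho>)"
        "sat A (\<lambda>i. map2 f \<rho> ys ! i) \<phi>" unfolding c by blast
      have "map length ?xs = map length ys"
        using ys(2) length_dom
        by (intro nth_equalityI) (auto simp: len_bl len_nth mem_listset list_all2_conv_all_nth)
      then have "?xs = ys" using ys(1) by (rule concat_eq_lengths)
      then show "(\<forall>i\<in>{..<length \<rho>}. map v (bl ! i) \<in> D (\<rho> ! i)) \<and> Q v"
        using ys(2,3) Q(2)[OF v] fv xs sat by fastforce
    next
      assume R: "(\<forall>i\<in>{..<length \<rho>}. map v (bl ! i) \<in> D (\<rho> ! i)) \<and> Q v"
      then have "sat A (\<lambda>i. map2 f \<rho> ?xs ! i) \<phi>"
        using Q(2)[OF v] fv sat by fastforce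
      with R xs show "map v [0..<length ?\<Sigma>] \<in> ?X" unfolding c by blast
    qed
  qed
qed

lemma tuple_lift:
  assumes "a \<in> tuples A \<rho>"
  shows "\<exists>xs \<in> listset (map D \<rho>). map2 f \<rho> xs = a"
  using assms
proof (induction \<rho> arbitrary: a)
  case Nil
  then show ?case by (simp add: tuples_def)
next
  case (Cons s \<rho>)
  then obtain y b where a: "a = y # b" "y \<in> Sort A s" "b \<in> tuples A \<rho>"
    by (auto simp: tuples_def set_Cons_def)
  from a(2) have "y \<in> f s ` D s" by (simp add: image)
  then obtain x where "x \<in> D s" "f s x = y" by blast
  moreover from Cons.IH[OF a(3)] obtain xs where "xs \<in> listset (map D \<rho>)" "map2 f \<rho> xs = b" by blast
  ultimately show ?case using a(1)
    by (intro bexI[of _ "x # xs"]) (auto simp: set_Cons_def)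
qed

text \<open>Ladders for \<phi> in \<open>A\<close> lift along the surjections \<open>f s\<close> to
  ladders of the same length for the formula \<psi> that defines the pullback. The formula \<psi>
  has parameters and ladders do not allow any, so \<open>ps\<close>, with sorts \<pi>, is appended
  to each of the second tuples.\<close>

lemma stable_transfer:
  assumes "stable B"
  shows "stable A"
  unfolding stable_def
proof (intro allI impI, rule ccontr)
  fix \<phi> :: "('s, 'r) fm" and \<alpha> \<beta>
  assume fv: "fv \<phi> \<subseteq> {..<length \<alpha> + length \<beta>}" and "\<nexists>n. \<not> has_ladder A \<phi> \<alpha> \<beta> n"
  then have ladder: "has_ladder A \<phi> \<alpha> \<beta> n" for n by blast
  let ?X = "{concat xs | xs. xs \<in> listset (map D (\<alpha> @ \<beta>)) \<and> sat A (\<lambda>i. map2 f (\<alpha> @ \<beta>) xs ! i) \<phi>}"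
  have "definable B (concat (map \<sigma> (\<alpha> @ \<beta>))) ?X"
    using fv by (intro definable_sat) simp
  then obtain \<psi> ps where ps: "set ps \<subseteq> (\<Union>s. Sort B s)"
    and fv\<psi>: "fv \<psi> \<subseteq> {..<length (concat (map \<sigma> (\<alpha> @ \<beta>))) + length ps}"
    and X: "?X = {xs \<in> tuples B (concat (map \<sigma> (\<alpha> @ \<beta>))). sat B (\<lambda>i. (xs @ ps) ! i) \<psi>}"
    unfolding definable_def by blast
  obtain \<pi> where \<pi>: "ps \<in> tuples B \<pi>"
  proof -
    have "\<forall>p\<in>set ps. \<exists>s. p \<in> Sort B s" using ps by blast
    then obtain h where "\<forall>p\<in>set ps. p \<in> Sort B (h p)" by metis
    then have "ps \<in> tuples B (map h ps)" by (auto simp: mem_tuples list_all2_conv_all_nth)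
    then show thesis by (rule that)
  qed
  let ?\<alpha> = "concat (map \<sigma> \<alpha>)" and ?\<beta> = "concat (map \<sigma> \<beta>) @ \<pi>"
  have len\<pi>: "length \<pi> = length ps" using \<pi> by (auto simp: mem_tuples dest: list_all2_lengthD)
  have "has_ladder B \<psi> ?\<alpha> ?\<beta> n" for n
  proof -
    obtain a b where ab: "\<And>i. i < n \<Longrightarrow> a i \<in> tuples A \<alpha> \<and> b i \<in> tuples A \<beta>"
      "\<And>i j. i < n \<Longrightarrow> j < n \<Longrightarrow> sat A (\<lambda>k. (a i @ b j) ! k) \<phi> \<longleftrightarrow> i < j"
      using ladder[of n] unfolding has_ladder_def by blast
    have "\<forall>i. i < n \<longrightarrow> (\<exists>xs. xs \<in> listset (map D \<alpha>) \<and> map2 f \<alpha> xs = a i)"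
      using ab(1) tuple_lift by blast
    then obtain x where x: "\<And>i. i < n \<Longrightarrow> x i \<in> listset (map D \<alpha>)" "\<And>i. i < n \<Longrightarrow> map2 f \<alpha> (x i) = a i"
      by metis
    have "\<forall>i. i < n \<longrightarrow> (\<exists>xs. xs \<in> listset (map D \<beta>) \<and> map2 f \<beta> xs = b i)"
      using ab(1) tuple_lift by blast
    then obtain y where y: "\<And>i. i < n \<Longrightarrow> y i \<in> listset (map D \<beta>)" "\<And>i. i < n \<Longrightarrow> map2 f \<beta> (y i) = b i"
      by metis
    have "sat B (\<lambda>k. (concat (x i) @ (concat (y j) @ ps)) ! k) \<psi> \<longleftrightarrow> i < j" if "i < n" "j < n" for i j
    proof -
      let ?z = "x i @ y j"
      have z: "?z \<in> listset (map D (\<alpha> @ \<beta>))"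
        using x(1)[OF that(1)] y(1)[OF that(2)] by (simp add: mem_listset list_all2_appendI)
      have "sat B (\<lambda>k. (concat (x i) @ (concat (y j) @ ps)) ! k) \<psi> \<longleftrightarrow> concat ?z \<in> ?X"
        unfolding X using concat_mem_tuples[OF z] by simp
      also have "\<dots> \<longleftrightarrow> sat A (\<lambda>k. map2 f (\<alpha> @ \<beta>) ?z ! k) \<phi>"
      proof
        assume "concat ?z \<in> ?X"
        then obtain xs where "concat ?z = concat xs" "xs \<in> listset (map D (\<alpha> @ \<beta>))"
          "sat A (\<lambda>k. map2 f (\<alpha> @ \<beta>) xs ! k) \<phi>" by blast
        moreover from this have "xs = ?z" using concat_blocks_eq[OF _ z] by metis
        ultimately show "sat A (\<lambda>k. map2 f (\<alpha> @ \<beta>) ?z ! k) \<phi>" by simp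
      qed (use z in blast)
      also have "map2 f (\<alpha> @ \<beta>) ?z = a i @ b j"
        using x(2)[OF that(1)] y(2)[OF that(2)] x(1)[OF that(1)]
        by (auto simp: mem_listset dest!: list_all2_lengthD)
      finally show ?thesis using ab(2)[OF that] by simp
    qed
    moreover have "concat (x i) \<in> tuples B ?\<alpha> \<and> concat (y i) @ ps \<in> tuples B ?\<beta>" if "i < n" for i
      using concat_mem_tuples[OF x(1)[OF that]] concat_mem_tuples[OF y(1)[OF that]] \<pi>
      by (simp add: mem_tuples list_all2_appendI)
    ultimately show ?thesis
      unfolding has_ladder_def by (intro exI[of _ "\<lambda>i. concat (x i)"] exI[of _ "\<lambda>i. concat (y i) @ ps"]) simp
  qed
  moreover have "fv \<psi> \<subseteq> {..<length ?\<alpha> + length ?\<beta>}"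
    using fv\<psi> by (simp add: len\<pi> add.assoc)
  ultimately show False using assms unfolding stable_def by blast
qed

end

lemma stable_interpretable:
  fixes A :: "('s, 'r, 'a) struct" and B :: "('t, 'q, 'b) struct"
  assumes int: "interpretable_in A B" and "stable B" and "\<And>s. Sort B s \<noteq> {}"
    and "\<And>s t. s \<noteq> t \<Longrightarrow> Sort A s \<inter> Sort A t = {}"
    and "\<And>r. Interp A r \<subseteq> tuples A (Profile A r)"
  shows "stable A"
proof -
  obtain \<sigma> D f where
    "\<forall>s. definable B (\<sigma> s) (D s) \<and> f s ` D s = Sort A s \<and>
       definable B (\<sigma> s @ \<sigma> s) {x @ y | x y. x \<in> D s \<and> y \<in> D s \<and> f s x = f s y}"
    "\<forall>r. definable B (concat (map \<sigma> (Profile A r)))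
       {concat xs | xs. xs \<in> listset (map D (Profile A r)) \<and> map2 f (Profile A r) xs \<in> Interp A r}"
    using int unfolding interpretable_in_def by blast
  then interpret interpretation_of B A \<sigma> D f
    using assms(3-5) by unfold_locales auto
  show ?thesis by (rule stable_transfer[OF \<open>stable B\<close>])
qed

subsection \<open>Four by four matrices in characteristic 2\<close>

text \<open>With all sixteen entries explicit, every matrix identity below becomes a list of field
  identities for the simplifier.\<close>

definition mat4 :: "'k::zero \<Rightarrow> 'k \<Rightarrow> 'k \<Rightarrow> 'k \<Rightarrow> 'k \<Rightarrow> 'k \<Rightarrow> 'k \<Rightarrow> 'k \<Rightarrow> 'k \<Rightarrow> 'k \<Rightarrow> 'k \<Rightarrow> 'k \<Rightarrow>
    'k \<Rightarrow> 'k \<Rightarrow> 'k \<Rightarrow> 'k \<Rightarrow> 'k^4^4" where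
  "mat4 a11 a12 a13 a14 a21 a22 a23 a24 a31 a32 a33 a34 a41 a42 a43 a44 =
     vector [vector [a11, a12, a13, a14], vector [a21, a22, a23, a24],
             vector [a31, a32, a33, a34], vector [a41, a42, a43, a44]]"

lemma vector_4:
  "(vector [x, y, z, w] :: 'a::zero^4) $ 1 = x" "(vector [x, y, z, w] :: 'a^4) $ 2 = y"
  "(vector [x, y, z, w] :: 'a^4) $ 3 = z" "(vector [x, y, z, w] :: 'a^4) $ 4 = w"
  by (simp_all add: vector_def)

lemma mat4_nth [simp]:
  "mat4 a11 a12 a13 a14 a21 a22 a23 a24 a31 a32 a33 a34 a41 a42 a43 a44 $ 1 = vector [a11, a12, a13, a14]"
  "mat4 a11 a12 a13 a14 a21 a22 a23 a24 a31 a32 a33 a34 a41 a42 a43 a44 $ 2 = vector [a21, a22, a23, a24]"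
  "mat4 a11 a12 a13 a14 a21 a22 a23 a24 a31 a32 a33 a34 a41 a42 a43 a44 $ 3 = vector [a31, a32, a33, a34]"
  "mat4 a11 a12 a13 a14 a21 a22 a23 a24 a31 a32 a33 a34 a41 a42 a43 a44 $ 4 = vector [a41, a42, a43, a44]"
  by (simp_all add: mat4_def vector_4)

lemma mat4_eq_iff:
  "mat4 a11 a12 a13 a14 a21 a22 a23 a24 a31 a32 a33 a34 a41 a42 a43 a44 =
   mat4 b11 b12 b13 b14 b21 b22 b23 b24 b31 b32 b33 b34 b41 b42 b43 b44 \<longleftrightarrow>
   a11 = b11 \<and> a12 = b12 \<and> a13 = b13 \<and> a14 = b14 \<and> a21 = b21 \<and> a22 = b22 \<and> a23 = b23 \<and> a24 = b24 \<and>
   a31 = b31 \<and> a32 = b32 \<and> a33 = b33 \<and> a34 = b34 \<and> a41 = b41 \<and> a42 = b42 \<and> a43 = b43 \<and> a44 = b44"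
  by (simp only: vec_eq_iff forall_4 mat4_nth vector_4 simp_thms conj_assoc)

lemma eq_mat4: "A = mat4 (A$1$1) (A$1$2) (A$1$3) (A$1$4) (A$2$1) (A$2$2) (A$2$3) (A$2$4)
    (A$3$1) (A$3$2) (A$3$3) (A$3$4) (A$4$1) (A$4$2) (A$4$3) (A$4$4)"
  by (simp only: vec_eq_iff forall_4 mat4_nth vector_4 simp_thms conj_assoc)

lemma mat4_mult:
  fixes a11 :: "'k::comm_ring_1"
  shows
  "mat4 a11 a12 a13 a14 a21 a22 a23 a24 a31 a32 a33 a34 a41 a42 a43 a44 **
   mat4 b11 b12 b13 b14 b21 b22 b23 b24 b31 b32 b33 b34 b41 b42 b43 b44 =
   mat4
    (a11 * b11 + a12 * b21 + a13 * b31 + a14 * b41) (a11 * b12 + a12 * b22 + a13 * b32 + a14 * b42)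
    (a11 * b13 + a12 * b23 + a13 * b33 + a14 * b43) (a11 * b14 + a12 * b24 + a13 * b34 + a14 * b44)
    (a21 * b11 + a22 * b21 + a23 * b31 + a24 * b41) (a21 * b12 + a22 * b22 + a23 * b32 + a24 * b42)
    (a21 * b13 + a22 * b23 + a23 * b33 + a24 * b43) (a21 * b14 + a22 * b24 + a23 * b34 + a24 * b44)
    (a31 * b11 + a32 * b21 + a33 * b31 + a34 * b41) (a31 * b12 + a32 * b22 + a33 * b32 + a34 * b42)
    (a31 * b13 + a32 * b23 + a33 * b33 + a34 * b43) (a31 * b14 + a32 * b24 + a33 * b34 + a34 * b44)
    (a41 * b11 + a42 * b21 + a43 * b31 + a44 * b41) (a41 * b12 + a42 * b22 + a43 * b32 + a44 * b42)
    (a41 * b13 + a42 * b23 + a43 * b33 + a44 * b43) (a41 * b14 + a42 * b24 + a43 * b34 + a44 * b44)"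
  by (simp only: vec_eq_iff forall_4 mat4_nth vector_4 matrix_matrix_mult_def vec_lambda_beta sum_4
      simp_thms)

lemma mat_1_mat4: "mat 1 = (mat4 1 0 0 0  0 1 0 0  0 0 1 0  0 0 0 1 :: 'k::comm_ring_1^4^4)"
  by (simp add: vec_eq_iff forall_4 mat_def vector_4)

lemma transpose_mat4:
  "transpose (mat4 a11 a12 a13 a14 a21 a22 a23 a24 a31 a32 a33 a34 a41 a42 a43 a44) =
   mat4 a11 a21 a31 a41 a12 a22 a32 a42 a13 a23 a33 a43 a14 a24 a34 a44"
  by (simp add: vec_eq_iff forall_4 transpose_def vector_4)

lemma symp_form_mat4: "symp_form = mat4 0 0 0 1  0 0 1 0  0 (-1) 0 0  (-1) 0 0 0"
  by (simp add: vec_eq_iff forall_4 symp_form_def unit_mat_def vector_4)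

lemma torus_mat_mat4:
  "torus_mat s t = mat4 s 0 0 0  0 t 0 0  0 0 (inverse t) 0  0 0 0 (inverse s)"
  by (simp add: vec_eq_iff forall_4 torus_mat_def vector_4)

lemma root_mat_mat4:
  "root_mat (1, -1) a = mat4 1 a 0 0  0 1 0 0  0 0 1 (-a)  0 0 0 1"
  "root_mat (-1, 1) a = mat4 1 0 0 0  a 1 0 0  0 0 1 0  0 0 (-a) 1"
  "root_mat (1, 1) a = mat4 1 0 a 0  0 1 0 a  0 0 1 0  0 0 0 1"
  "root_mat (-1, -1) a = mat4 1 0 0 0  0 1 0 0  a 0 1 0  0 a 0 1"
  "root_mat (2, 0) a = mat4 1 0 0 a  0 1 0 0  0 0 1 0  0 0 0 1"
  "root_mat (-2, 0) a = mat4 1 0 0 0  0 1 0 0  0 0 1 0  a 0 0 1"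
  "root_mat (0, 2) a = mat4 1 0 0 0  0 1 a 0  0 0 1 0  0 0 0 1"
  "root_mat (0, -2) a = mat4 1 0 0 0  0 1 0 0  0 a 1 0  0 0 0 1"
  by (simp_all add: vec_eq_iff forall_4 root_mat_def root_vector_def unit_mat_def vector_4 mat_def)

lemmas mat4_simps = mat4_mult mat4_eq_iff mat_1_mat4 transpose_mat4 symp_form_mat4
  torus_mat_mat4 root_mat_mat4

section \<open>Closure properties of \<open>K0\<close> and \<open>L0\<close>, and relations between
  root elements\<close>

locale indifferent =
  fixes K0 L0 :: "'k::field set"
  assumes weak_indifferent: "weak_indifferent_set K0 L0"
begin

lemma char2 [simp]: "(x::'k) + x = 0" "(x::'k) + (x + y) = y" "- (x::'k) = x" "(x::'k) - y = x + y"
proof -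
  have "(2::'k) = of_nat CHAR('k)"
    using weak_indifferent by (simp add: weak_indifferent_set_def)
  then have 2: "(2::'k) = 0" by simp
  show *: "x + x = 0" for x :: 'k using arg_cong[OF 2, of "\<lambda>c. c * x"] by simp
  show "x + (x + y) = y" by (simp add: add.assoc[symmetric] *)
  show **: "- x = x" for x :: 'k using *[of x] by (simp add: minus_unique)
  show "x - y = x + y" using **[of y] by (metis diff_conv_add_uminus)
qed

lemma two_eq_0 [simp]: "(2::'k) = 0"
  by (metis char2(1) one_add_one)

lemma add_square: "(x + y)\<^sup>2 = x\<^sup>2 + (y\<^sup>2 :: 'k)"
  by (simp add: power2_sum)

lemma add_eq_0: "x + y = 0 \<longleftrightarrow> x = (y::'k)"
  by (metis char2(1,2) add.right_neutral)

lemma square_inject: "x\<^sup>2 = y\<^sup>2 \<longleftrightarrow> x = (y::'k)"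
  using add_square[of x y] add_eq_0[of x y] add_eq_0[of "x\<^sup>2" "y\<^sup>2"] by auto

lemma K0_add: "a \<in> K0 \<Longrightarrow> b \<in> K0 \<Longrightarrow> a + b \<in> K0" and L0_add: "c \<in> L0 \<Longrightarrow> d \<in> L0 \<Longrightarrow> c + d \<in> L0"
  and K0_0 [simp]: "0 \<in> K0" and L0_0 [simp]: "0 \<in> L0" and square_L0 [simp]: "x\<^sup>2 \<in> L0"
  and L0_K0: "c \<in> L0 \<Longrightarrow> c \<in> K0"
  and square_L0_mult: "a \<in> K0 \<Longrightarrow> c \<in> L0 \<Longrightarrow> a\<^sup>2 * c \<in> L0"
  using weak_indifferent
  by (auto simp: weak_indifferent_set_def add_subgroup_def subspace_over_def)

lemma L0_mult_K0: "c \<in> L0 \<Longrightarrow> a \<in> K0 \<Longrightarrow> c * a \<in> K0"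
  and L0_div_K0: "c \<in> L0 \<Longrightarrow> a \<in> K0 \<Longrightarrow> a / c \<in> K0"
proof -
  assume c: "c \<in> L0" and a: "a \<in> K0"
  have *: "x * a \<in> K0" if "\<And>F. is_subfield F \<Longrightarrow> L0 \<subseteq> F \<Longrightarrow> x \<in> F" for x
    using that weak_indifferent a
    unfolding weak_indifferent_set_def subspace_over_def subfield_generated_def by blast
  show "c * a \<in> K0" using c by (intro *) auto
  have "inverse c * a \<in> K0" using c by (intro *) (auto simp: is_subfield_def)
  then show "a / c \<in> K0" by (simp add: field_simps)
qed

lemma square_K0 [simp]: "x\<^sup>2 \<in> K0"
  by (simp add: L0_K0)

lemma one_L0 [simp]: "1 \<in> L0" and one_K0 [simp]: "1 \<in> K0"
  using square_L0[of 1] square_K0[of 1] by simp_all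

lemma square_K0_mult: "a \<in> K0 \<Longrightarrow> x\<^sup>2 * a \<in> K0"
  by (simp add: L0_mult_K0)

text \<open>The inverse of a equals the square of the inverse times a, and \<open>K0\<close> is
  closed under multiplication by all squares of the field.\<close>

lemma inverse_K0: "a \<in> K0 \<Longrightarrow> inverse a \<in> K0"
  using square_K0_mult[of a "inverse a"] by (cases "a = 0") (simp_all add: power2_eq_square mult.assoc)

text \<open>The same formula works for \<open>L0\<close>. Here the factor must be the square of an
  element of \<open>K0\<close>, which \<open>inverse_K0\<close> provides.\<close>

lemma inverse_L0: "a \<in> L0 \<Longrightarrow> inverse a \<in> L0"
  using square_L0_mult[of "inverse a" a] inverse_K0[of a] L0_K0[of a]
  by (cases "a = 0") (simp_all add: power2_eq_square mult.assoc)

text \<open>The arguments are the coordinates along \<alpha>, \<beta>, \<alpha> + \<beta> and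
  2\<alpha> + \<beta>, in the order of the product in \<open>U4_eq\<close>.\<close>

definition U4 :: "'k \<Rightarrow> 'k \<Rightarrow> 'k \<Rightarrow> 'k \<Rightarrow> 'k^4^4" where
  "U4 a b c d = mat4 1 a (a * b + c) (a * c + d)  0 1 b c  0 0 1 a  0 0 0 1"

abbreviation "xa \<equiv> root_mat (1, -1) :: 'k \<Rightarrow> _"
abbreviation "xb \<equiv> root_mat (0, 2) :: 'k \<Rightarrow> _"

definition na :: "'k^4^4" where "na = mat4 0 1 0 0  1 0 0 0  0 0 0 1  0 0 1 0"
definition nb :: "'k^4^4" where "nb = mat4 1 0 0 0  0 0 1 0  0 1 0 0  0 0 0 1"

lemmas group_simps = mat4_simps U4_def na_def nb_def

text \<open>In characteristic 2 the only commutation between positive root elements with a cost is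
  that of \<open>xb b\<close> with \<open>xa a'\<close>. It adds \<open>b * a'\<close> along
  \<alpha> + \<beta> and \<open>a'\<^sup>2 * b\<close> along 2\<alpha> + \<beta>, and the axioms of
  a weak indifferent set place these terms in \<open>K0\<close> and \<open>L0\<close>.\<close>

lemma U4_mult: "U4 a b c d ** U4 a' b' c' d' = U4 (a + a') (b + b') (c + c' + b * a') (d + d' + a'\<^sup>2 * b)"
  by (simp add: group_simps algebra_simps power2_eq_square)

lemma U4_eq: "U4 a b c d = xa a ** xb b ** root_mat (1, 1) c ** root_mat (2, 0) d"
  by (simp add: group_simps algebra_simps)

lemma U4_0: "U4 0 0 0 0 = mat 1"
  by (simp add: group_simps)

lemma U4_inject: "U4 a b c d = U4 a' b' c' d' \<longleftrightarrow> a = a' \<and> b = b' \<and> c = c' \<and> d = d'"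
  by (auto simp: group_simps)

lemma root_mat_U4:
  "xa a = U4 a 0 0 0" "xb a = U4 0 a 0 0" "root_mat (1, 1) a = U4 0 0 a 0" "root_mat (2, 0) a = U4 0 0 0 a"
  by (simp_all add: group_simps)

lemma n_square [simp]: "na ** na = mat 1" "nb ** nb = mat 1"
  by (simp_all add: group_simps)

lemma torus_mult: "torus_mat s t ** torus_mat s' t' = torus_mat (s * s') (t * t' :: 'k)"
  by (simp add: group_simps)

lemma torus_one: "torus_mat 1 1 = mat 1"
  by (simp add: group_simps)

lemma torus_U4:
  "s \<noteq> 0 \<Longrightarrow> t \<noteq> 0 \<Longrightarrow>
   torus_mat s t ** U4 a b c d = U4 (s / t * a) (t\<^sup>2 * b) (s * t * c) (s\<^sup>2 * d) ** torus_mat s t"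
  by (simp add: group_simps field_simps power2_eq_square)

lemma torus_na: "na ** torus_mat s t = torus_mat t s ** na"
  and torus_nb: "nb ** torus_mat s t = torus_mat s (inverse t) ** nb"
  by (simp_all add: group_simps)

lemma root_mat_conj:
  "root_mat (-1, 1) a = na ** xa a ** na"
  "root_mat (1, 1) a = nb ** xa a ** nb"
  "root_mat (-1, -1) a = nb ** na ** xa a ** na ** nb"
  "root_mat (0, -2) a = nb ** xb a ** nb"
  "root_mat (2, 0) a = na ** xb a ** na"
  "root_mat (-2, 0) a = na ** nb ** xb a ** nb ** na"
  by (simp_all add: group_simps)

lemma n_eq: "na = xa 1 ** root_mat (-1, 1) 1 ** xa 1" "nb = xb 1 ** root_mat (0, -2) 1 ** xb 1"
  by (simp_all add: group_simps)

text \<open>The reflection in a simple root permutes the other positive roots. The one in \<alpha>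
  swaps \<beta> with 2\<alpha> + \<beta> and fixes \<alpha> + \<beta>; in \<open>U4_nb\<close>, the
  one in \<beta> swaps \<alpha> with \<alpha> + \<beta> and fixes 2\<alpha> + \<beta>. Only the
  simple root element has to stay on the left.\<close>

lemma U4_na: "U4 a b c d ** na = xa a ** na ** U4 0 d c b"
  by (simp add: group_simps algebra_simps)

lemma U4_nb: "U4 a b c d ** nb = xb b ** nb ** U4 (c + b * a) 0 a (d + a\<^sup>2 * b)"
  by (simp add: group_simps algebra_simps power2_eq_square)

text \<open>The left side is the element with parameter c of the root group for -\<alpha>, and the
  right side is its Bruhat decomposition in the copy of SL_2 attached to \<alpha>.\<close>

lemma rank_one_a: "c \<noteq> 0 \<Longrightarrow>
    na ** xa c ** na = xa (inverse c) ** torus_mat (inverse c) c ** na ** xa (inverse c)"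
  by (simp add: group_simps field_simps)

lemma rank_one_b: "c \<noteq> 0 \<Longrightarrow>
    nb ** xb c ** nb = xb (inverse c) ** torus_mat 1 (inverse c) ** nb ** xb (inverse c)"
  by (simp add: group_simps field_simps)

end

subsection \<open>The Bruhat decomposition\<close>

context indifferent
begin

section \<open>The cells and their closure under right multiplication\<close>

definition unip :: "('k^4^4) set" where
  "unip = {U4 a b c d | a b c d. a \<in> K0 \<and> b \<in> L0 \<and> c \<in> K0 \<and> d \<in> L0}"

definition weyl :: "('k^4^4) set" where
  "weyl = {mat 1, na, nb, na ** nb, nb ** na, na ** nb ** na, nb ** na ** nb, na ** nb ** na ** nb}"

text \<open>Conjugation by \<open>torus_mat s t\<close> scales the root group for \<gamma> by the
  character \<gamma>. The conditions run over the four short roots for \<open>K0\<close> and the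
  four long ones for \<open>L0\<close>.\<close>

definition preserves :: "'k \<Rightarrow> 'k \<Rightarrow> bool" where
  "preserves s t \<longleftrightarrow>
     (\<forall>a\<in>K0. s / t * a \<in> K0 \<and> t / s * a \<in> K0 \<and> s * t * a \<in> K0 \<and> a / (s * t) \<in> K0) \<and>
     (\<forall>b\<in>L0. s\<^sup>2 * b \<in> L0 \<and> b / s\<^sup>2 \<in> L0 \<and> t\<^sup>2 * b \<in> L0 \<and> b / t\<^sup>2 \<in> L0)"

definition torus :: "('k^4^4) set" where
  "torus = {torus_mat s t | s t. s \<noteq> 0 \<and> t \<noteq> 0 \<and> preserves s t}"

lemma unip_mult: "u \<in> unip \<Longrightarrow> u' \<in> unip \<Longrightarrow> u ** u' \<in> unip"
  unfolding unip_def
  by clarify (auto simp: U4_mult intro!: exI K0_add L0_add L0_mult_K0 square_L0_mult)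

lemma one_unip: "mat 1 \<in> unip"
  unfolding unip_def U4_0[symmetric] by (auto intro!: exI)

lemma torus_unip:
  assumes "h \<in> torus" "u \<in> unip"
  shows "\<exists>u'\<in>unip. h ** u = u' ** h" "\<exists>u'\<in>unip. u ** h = h ** u'"
proof -
  obtain s t where h: "h = torus_mat s t" "s \<noteq> 0" "t \<noteq> 0" "preserves s t"
    using assms(1) by (auto simp: torus_def)
  obtain a b c d where u: "u = U4 a b c d" "a \<in> K0" "b \<in> L0" "c \<in> K0" "d \<in> L0"
    using assms(2) by (auto simp: unip_def)
  have "U4 (s / t * a) (t\<^sup>2 * b) (s * t * c) (s\<^sup>2 * d) \<in> unip"
    using h(4) u(2-) unfolding preserves_def unip_def by blast
  then show "\<exists>u'\<in>unip. h ** u = u' ** h"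
    unfolding u h using torus_U4[OF h(2,3)] by blast
  have "h ** U4 (t / s * a) (b / t\<^sup>2) (c / (s * t)) (d / s\<^sup>2) = u ** h"
    unfolding u h torus_U4[OF h(2,3)] using h(2,3) by simp
  moreover have "U4 (t / s * a) (b / t\<^sup>2) (c / (s * t)) (d / s\<^sup>2) \<in> unip"
    using h(4) u(2-) unfolding preserves_def unip_def by blast
  ultimately show "\<exists>u'\<in>unip. u ** h = h ** u'" by metis
qed

text \<open>Both unipotent factors range over all of \<open>unip\<close>. The expression of a matrix
  is therefore not unique, but membership is easy to propagate.\<close>

definition cells :: "('k^4^4) set \<Rightarrow> ('k^4^4) set" where
  "cells H = {h ** u ** w ** u' | h u w u'. h \<in> H \<and> u \<in> unip \<and> w \<in> weyl \<and> u' \<in> unip}"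

lemma cells_mult_unip: "m \<in> cells H \<Longrightarrow> u \<in> unip \<Longrightarrow> m ** u \<in> cells H"
  unfolding cells_def by (force simp: matrix_mul_assoc[symmetric] intro: unip_mult)

text \<open>The exchange argument for a simple root with reflection \<open>n\<close> and root
  elements \<open>x c\<close>, kept abstract to cover \<alpha> and \<beta>. Split
  \<open>u' ** n\<close> as \<open>x c ** n ** u''\<close>. If \<open>w\<close> keeps the root
  positive, \<open>x c\<close> passes through \<open>w\<close> to the left. Otherwise
  \<open>w = v ** n\<close> where \<open>v\<close> keeps it positive; for
  \<open>c \<noteq> 0\<close> the factor \<open>n ** x c ** n\<close> is replaced by its rank one
  decomposition, whose left root element passes through \<open>v\<close> and whose torus element is
  carried on to the far left.\<close>

lemma cells_mult_reflection:
  assumes H: "H \<subseteq> torus" "\<And>h h'. h \<in> H \<Longrightarrow> h' \<in> H \<Longrightarrow> h ** h' \<in> H"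
    and n: "n ** n = mat 1"
    and x: "\<And>c. c \<in> A \<Longrightarrow> x c \<in> unip" and x0: "x 0 = mat 1"
    and un: "\<And>u. u \<in> unip \<Longrightarrow> \<exists>c\<in>A. \<exists>u'\<in>unip. u ** n = x c ** n ** u'"
    and rank_one: "\<And>c. c \<in> A \<Longrightarrow> c \<noteq> 0 \<Longrightarrow>
      inverse c \<in> A \<and> n ** x c ** n = x (inverse c) ** y c ** n ** x (inverse c)"
    and wn: "\<And>w. w \<in> weyl \<Longrightarrow> w ** n \<in> weyl"
    and sign: "\<And>w. w \<in> weyl \<Longrightarrow>
      (\<forall>c\<in>A. \<exists>u\<in>unip. w ** x c = u ** w) \<or> (\<forall>c\<in>A. \<exists>u\<in>unip. w ** n ** x c = u ** (w ** n))"
    and y: "\<And>w c. w \<in> weyl \<Longrightarrow> c \<in> A \<Longrightarrow> c \<noteq> 0 \<Longrightarrow> \<exists>h\<in>H. w ** y c = h ** w"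
    and m: "m \<in> cells H"
  shows "m ** n \<in> cells H"
proof -
  obtain h u w u' where m: "m = h ** u ** w ** u'" "h \<in> H" "u \<in> unip" "w \<in> weyl" "u' \<in> unip"
    using m by (auto simp: cells_def)
  obtain c u'' where c: "c \<in> A" "u'' \<in> unip" "u' ** n = x c ** n ** u''"
    using un[OF m(5)] by blast
  have mn: "m ** n = h ** u ** (w ** x c ** n) ** u''"
    by (simp add: m(1) c(3) matrix_mul_assoc[symmetric])
  show ?thesis
  proof (cases "\<forall>c\<in>A. \<exists>u\<in>unip. w ** x c = u ** w")
    case True
    then obtain v where v: "v \<in> unip" "w ** x c = v ** w" using c(1) by blast
    then have "m ** n = h ** (u ** v) ** (w ** n) ** u''"
      by (simp add: mn matrix_mul_assoc)
    then show ?thesis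
      unfolding cells_def using m(2,3) v(1) unip_mult wn[OF m(4)] c(2) by blast
  next
    case False
    define v where "v = w ** n"
    have v: "v \<in> weyl" "w = v ** n"
      using wn[OF m(4)] by (simp_all add: v_def matrix_mul_assoc[symmetric] n)
    have pos: "\<exists>u\<in>unip. v ** x c = u ** v" if "c \<in> A" for c
      using sign[OF m(4)] False that by (auto simp: v_def)
    show ?thesis
    proof (cases "c = 0")
      case True
      then have "m ** n = h ** u ** v ** u''"
        unfolding mn by (simp add: x0 v_def)
      then show ?thesis unfolding cells_def using m(2,3) v(1) c(2) by blast
    next
      case False
      then have inv: "inverse c \<in> A"
        and eq: "n ** x c ** n = x (inverse c) ** y c ** n ** x (inverse c)"
        using rank_one c(1) by auto
      obtain u1 where u1: "u1 \<in> unip" "v ** x (inverse c) = u1 ** v" using pos[OF inv] by blast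
      obtain k where k: "k \<in> H" "v ** y c = k ** v" using y[OF v(1) c(1) False] by blast
      obtain u2 where u2: "u2 \<in> unip" "u ** u1 ** k = k ** u2"
        using torus_unip(2)[of k "u ** u1"] k(1) H(1) unip_mult m(3) u1(1) by blast
      have "m ** n = h ** u ** (v ** (n ** x c ** n)) ** u''"
        by (simp add: mn v(2) matrix_mul_assoc)
      also have "\<dots> = h ** u ** ((v ** x (inverse c)) ** y c ** n ** x (inverse c)) ** u''"
        by (simp add: eq matrix_mul_assoc)
      also have "\<dots> = h ** u ** (u1 ** (v ** y c) ** n ** x (inverse c)) ** u''"
        by (simp add: u1(2) matrix_mul_assoc)
      also have "\<dots> = h ** (u ** u1 ** k) ** (v ** n) ** (x (inverse c) ** u'')"
        by (simp add: k(2) matrix_mul_assoc)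
      also have "\<dots> = (h ** k) ** u2 ** w ** (x (inverse c) ** u'')"
        by (simp add: u2(2) v(2)[symmetric] matrix_mul_assoc)
      finally show ?thesis
        unfolding cells_def using H(2)[OF m(2) k(1)] u2(1) m(4) unip_mult[OF x[OF inv] c(2)] by blast
    qed
  qed
qed

lemma weyl_mult: "w \<in> weyl \<Longrightarrow> w ** na \<in> weyl" "w \<in> weyl \<Longrightarrow> w ** nb \<in> weyl"
  unfolding weyl_def by (auto simp: group_simps)

lemma xa_unip: "c \<in> K0 \<Longrightarrow> xa c \<in> unip" and xb_unip: "c \<in> L0 \<Longrightarrow> xb c \<in> unip"
  unfolding root_mat_U4 unip_def by (auto intro!: exI)

text \<open>Of w(\<alpha>) and its negative, the image of \<alpha> under w composed with the
  reflection in \<alpha>, one is positive. Weyl elements preserve root length, so the positive one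
  is \<alpha> or \<alpha> + \<beta>, which explains the two candidates for \<open>u\<close>.\<close>

lemma sign_a:
  assumes "w \<in> weyl"
  shows "(\<forall>c\<in>K0. \<exists>u\<in>unip. w ** xa c = u ** w) \<or> (\<forall>c\<in>K0. \<exists>u\<in>unip. w ** na ** xa c = u ** (w ** na))"
proof -
  have u: "U4 c 0 0 0 \<in> unip" "U4 0 0 c 0 \<in> unip" if "c \<in> K0" for c
    using that by (auto simp: unip_def intro!: exI)
  have "(\<forall>c. \<exists>u\<in>{U4 c 0 0 0, U4 0 0 c 0}. w ** xa c = u ** w) \<or>
    (\<forall>c. \<exists>u\<in>{U4 c 0 0 0, U4 0 0 c 0}. w ** na ** xa c = u ** (w ** na))"
    using assms unfolding weyl_def by (elim insertE emptyE) (simp_all add: group_simps)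
  then show ?thesis using u by blast
qed

lemma sign_b:
  assumes "w \<in> weyl"
  shows "(\<forall>c\<in>L0. \<exists>u\<in>unip. w ** xb c = u ** w) \<or> (\<forall>c\<in>L0. \<exists>u\<in>unip. w ** nb ** xb c = u ** (w ** nb))"
proof -
  have u: "U4 0 c 0 0 \<in> unip" "U4 0 0 0 c \<in> unip" if "c \<in> L0" for c
    using that by (auto simp: unip_def intro!: exI)
  have "(\<forall>c. \<exists>u\<in>{U4 0 c 0 0, U4 0 0 0 c}. w ** xb c = u ** w) \<or>
    (\<forall>c. \<exists>u\<in>{U4 0 c 0 0, U4 0 0 0 c}. w ** nb ** xb c = u ** (w ** nb))"
    using assms unfolding weyl_def by (elim insertE emptyE) (simp_all add: group_simps)
  then show ?thesis using u by blast
qed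

lemma cells_mult_na:
  assumes "H \<subseteq> torus" "\<And>h h'. h \<in> H \<Longrightarrow> h' \<in> H \<Longrightarrow> h ** h' \<in> H"
    and "\<And>w c. w \<in> weyl \<Longrightarrow> c \<in> K0 \<Longrightarrow> c \<noteq> 0 \<Longrightarrow> \<exists>h\<in>H. w ** torus_mat (inverse c) c = h ** w"
    and "m \<in> cells H"
  shows "m ** na \<in> cells H"
proof (rule cells_mult_reflection[where A = K0 and x = xa and y = "\<lambda>c. torus_mat (inverse c) c", OF assms(1,2)])
  fix u assume "u \<in> unip"
  then obtain a b c d where u: "u = U4 a b c d" "a \<in> K0" "b \<in> L0" "c \<in> K0" "d \<in> L0"
    by (auto simp: unip_def)
  moreover from u have "U4 0 d c b \<in> unip" by (auto simp: unip_def U4_inject)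
  ultimately show "\<exists>c\<in>K0. \<exists>u'\<in>unip. u ** na = xa c ** na ** u'" using U4_na by blast
qed (use assms in \<open>auto simp: xa_unip weyl_mult sign_a inverse_K0 rank_one_a root_mat_U4(1)[of 0] U4_0\<close>)

lemma cells_mult_nb:
  assumes "H \<subseteq> torus" "\<And>h h'. h \<in> H \<Longrightarrow> h' \<in> H \<Longrightarrow> h ** h' \<in> H"
    and "\<And>w c. w \<in> weyl \<Longrightarrow> c \<in> L0 \<Longrightarrow> c \<noteq> 0 \<Longrightarrow> \<exists>h\<in>H. w ** torus_mat 1 (inverse c) = h ** w"
    and "m \<in> cells H"
  shows "m ** nb \<in> cells H"
proof (rule cells_mult_reflection[where A = L0 and x = xb and y = "\<lambda>c. torus_mat 1 (inverse c)", OF assms(1,2)])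
  fix u assume "u \<in> unip"
  then obtain a b c d where u: "u = U4 a b c d" "a \<in> K0" "b \<in> L0" "c \<in> K0" "d \<in> L0"
    by (auto simp: unip_def)
  moreover from u have "U4 (c + b * a) 0 a (d + a\<^sup>2 * b) \<in> unip"
    by (auto simp: unip_def U4_inject intro!: K0_add L0_add L0_mult_K0 square_L0_mult)
  ultimately show "\<exists>c\<in>L0. \<exists>u'\<in>unip. u ** nb = xb c ** nb ** u'" using U4_nb by blast
qed (use assms in \<open>auto simp: xb_unip weyl_mult sign_b inverse_L0 rank_one_b root_mat_U4(2)[of 0] U4_0\<close>)

definition param :: "int \<times> int \<Rightarrow> 'k set" where
  "param \<gamma> = (if \<gamma> \<in> long_roots then L0 else K0)"

lemma param_simps [simp]:
  "param (1, -1) = K0" "param (-1, 1) = K0" "param (1, 1) = K0" "param (-1, -1) = K0"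
  "param (0, 2) = L0" "param (0, -2) = L0" "param (2, 0) = L0" "param (-2, 0) = L0"
  by (simp_all add: param_def long_roots_def)

text \<open>By \<open>root_mat_conj\<close> every root element is a simple root element conjugated
  by a product of reflections, and simple root elements with admissible parameters lie in
  \<open>unip\<close>.\<close>

lemma cells_mult_root:
  assumes na: "\<And>m. m \<in> cells H \<Longrightarrow> m ** na \<in> cells H" and nb: "\<And>m. m \<in> cells H \<Longrightarrow> m ** nb \<in> cells H"
    and m: "m \<in> cells H" and \<gamma>: "\<gamma> \<in> short_roots \<union> long_roots" and a: "a \<in> param \<gamma>"
  shows "m ** root_mat \<gamma> a \<in> cells H"
proof -
  have x: "m ** xa a \<in> cells H" if "a \<in> K0" "m \<in> cells H" for m
    using that cells_mult_unip xa_unip by blast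
  have y: "m ** xb a \<in> cells H" if "a \<in> L0" "m \<in> cells H" for m
    using that cells_mult_unip xb_unip by blast
  consider "\<gamma> = (1, -1)" | "\<gamma> = (-1, 1)" | "\<gamma> = (1, 1)" | "\<gamma> = (-1, -1)"
    | "\<gamma> = (2, 0)" | "\<gamma> = (-2, 0)" | "\<gamma> = (0, 2)" | "\<gamma> = (0, -2)"
    using \<gamma> by (auto simp: short_roots_def long_roots_def)
  then show ?thesis
    by cases (use a m in \<open>simp_all add: root_mat_conj matrix_mul_assoc na nb x y\<close>)
qed

section \<open>Upper triangular elements of the cells\<close>

definition upper :: "'k^4^4 \<Rightarrow> bool" where
  "upper A \<longleftrightarrow> A$2$1 = 0 \<and> A$3$1 = 0 \<and> A$4$1 = 0 \<and> A$3$2 = 0 \<and> A$4$2 = 0 \<and> A$4$3 = 0"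

lemma upper_mult: "upper A \<Longrightarrow> upper B \<Longrightarrow> upper (A ** B)"
  by (simp add: upper_def matrix_matrix_mult_def sum_4)

lemma upper_U4: "upper (U4 a b c d)" and upper_torus: "upper (torus_mat s t)"
  by (simp_all add: upper_def U4_def torus_mat_mat4 vector_4)

lemma upper_weyl: "w \<in> weyl \<Longrightarrow> upper w \<Longrightarrow> w = mat 1"
  unfolding weyl_def by (elim insertE emptyE) (simp_all add: upper_def group_simps vector_4)

lemma U4_inverse: "U4 a b c d ** U4 a b (c + b * a) (d + a\<^sup>2 * b) = mat 1"
  "U4 a b (c + b * a) (d + a\<^sup>2 * b) ** U4 a b c d = mat 1"
  by (simp_all add: U4_mult U4_0 ac_simps)

lemma torus_inverse: "s \<noteq> 0 \<Longrightarrow> t \<noteq> 0 \<Longrightarrow> torus_mat (inverse s) (inverse t) ** torus_mat s t = (mat 1 :: 'k^4^4)"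
  by (simp add: torus_mult torus_one)

text \<open>Uniqueness in the Bruhat decomposition, for the cell of the identity.\<close>

lemma upper_cells:
  assumes "H \<subseteq> torus" "m \<in> cells H" "upper m"
  shows "\<exists>h\<in>H. \<exists>u\<in>unip. m = h ** u"
proof -
  obtain h u w u' where m: "m = h ** u ** w ** u'" "h \<in> H" "u \<in> unip" "w \<in> weyl" "u' \<in> unip"
    using assms(2) by (auto simp: cells_def)
  obtain s t where h: "h = torus_mat s t" "s \<noteq> 0" "t \<noteq> 0"
    using m(2) assms(1) by (auto simp: torus_def)
  obtain v where v: "upper v" "v ** u = mat 1"
    using m(3) U4_inverse upper_U4 by (auto simp: unip_def) blast
  obtain v' where v': "upper v'" "u' ** v' = mat 1"
    using m(5) U4_inverse upper_U4 by (auto simp: unip_def) blast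
  let ?k = "torus_mat (inverse s) (inverse t)"
  \<comment> \<open>Stripping the invertible upper triangular factors from both sides leaves
    \<open>w\<close>, which is thus an upper triangular permutation matrix.\<close>
  have "v ** ?k ** m ** v' = v ** (?k ** h) ** u ** w ** (u' ** v')"
    by (simp add: m(1) matrix_mul_assoc)
  also have "\<dots> = w"
    using v(2) v'(2) torus_inverse[OF h(2,3)] by (simp add: h(1))
  finally have "upper w"
    using v(1) v'(1) assms(3) upper_mult upper_torus by metis
  with m(4) have "w = mat 1" by (rule upper_weyl)
  then have "m = h ** (u ** u')" by (simp add: m(1) matrix_mul_assoc)
  with m(2) unip_mult[OF m(3,5)] show ?thesis by blast
qed

text \<open>The coordinates are arbitrary field elements beforehand. The matrix lies in the cell of
  the identity, comparison of diagonals makes the torus factor trivial, and the coordinates of the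
  \<open>unip\<close> factor can be read off.\<close>

lemma U4_cells:
  assumes "H \<subseteq> torus" "U4 a b c d \<in> cells H"
  shows "a \<in> K0 \<and> b \<in> L0 \<and> c \<in> K0 \<and> d \<in> L0"
proof -
  obtain h u where hu: "h \<in> H" "u \<in> unip" "U4 a b c d = h ** u"
    using upper_cells[OF assms upper_U4] by blast
  obtain s t where h: "h = torus_mat s t" "s \<noteq> 0" "t \<noteq> 0"
    using hu(1) assms(1) by (auto simp: torus_def)
  obtain a' b' c' d' where u: "u = U4 a' b' c' d'" "a' \<in> K0" "b' \<in> L0" "c' \<in> K0" "d' \<in> L0"
    using hu(2) by (auto simp: unip_def)
  have "s = 1" "t = 1" using hu(3) unfolding u h by (auto simp: group_simps)
  then have "U4 a b c d = U4 a' b' c' d'" using hu(3) by (simp add: u h torus_one)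
  then show ?thesis using u(2-) by (simp add: U4_inject)
qed

lemma torus_mat_cells:
  assumes "H \<subseteq> torus" "torus_mat s t \<in> cells H"
  shows "torus_mat s t \<in> H"
proof -
  obtain h u where hu: "h \<in> H" "u \<in> unip" "torus_mat s t = h ** u"
    using upper_cells[OF assms upper_torus] by blast
  obtain s' t' where h: "h = torus_mat s' t'" "s' \<noteq> 0" "t' \<noteq> 0"
    using hu(1) assms(1) by (auto simp: torus_def)
  obtain a' b' c' d' where u: "u = U4 a' b' c' d'"
    using hu(2) by (auto simp: unip_def)
  have "s = s'" "t = t'" using hu(3) unfolding u h by (auto simp: group_simps)
  then show ?thesis using hu(1) h(1) by simp
qed

section \<open>Torus elements that preserve \<open>K0\<close> and \<open>L0\<close>\<close>

lemma preserves_swap: "preserves s t \<Longrightarrow> preserves t s"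
  by (simp add: preserves_def mult.commute)

lemma preserves_inverse:
  assumes "preserves s t" "s \<noteq> 0" "t \<noteq> 0"
  shows "preserves s (inverse t)"
proof -
  have "s / inverse t * a = s * t * a" "inverse t / s * a = a / (s * t)"
    "s * inverse t * a = s / t * a" "a / (s * inverse t) = t / s * a"
    "(inverse t)\<^sup>2 * a = a / t\<^sup>2" "a / (inverse t)\<^sup>2 = t\<^sup>2 * a" for a
    using assms(2,3) by (simp_all add: field_simps)
  then show ?thesis using assms(1) unfolding preserves_def by simp
qed

lemma preservesD:
  assumes "preserves s t"
  shows "a \<in> K0 \<Longrightarrow> s / t * a \<in> K0" "a \<in> K0 \<Longrightarrow> t / s * a \<in> K0"
    "a \<in> K0 \<Longrightarrow> s * t * a \<in> K0" "a \<in> K0 \<Longrightarrow> a / (s * t) \<in> K0"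
    "b \<in> L0 \<Longrightarrow> s\<^sup>2 * b \<in> L0" "b \<in> L0 \<Longrightarrow> b / s\<^sup>2 \<in> L0"
    "b \<in> L0 \<Longrightarrow> t\<^sup>2 * b \<in> L0" "b \<in> L0 \<Longrightarrow> b / t\<^sup>2 \<in> L0"
  using assms unfolding preserves_def by blast+

lemma preserves_mult:
  assumes "preserves s t" "preserves s' t'"
  shows "preserves (s * s') (t * t')"
proof -
  have *: "s * s' / (t * t') * a = s / t * (s' / t' * a)" "t * t' / (s * s') * a = t / s * (t' / s' * a)"
    "s * s' * (t * t') * a = s * t * (s' * t' * a)" "a / (s * s' * (t * t')) = a / (s * t) / (s' * t')"
    "(s * s')\<^sup>2 * a = s\<^sup>2 * (s'\<^sup>2 * a)" "(t * t')\<^sup>2 * a = t\<^sup>2 * (t'\<^sup>2 * a)"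
    "a / (s * s')\<^sup>2 = a / s\<^sup>2 / s'\<^sup>2" "a / (t * t')\<^sup>2 = a / t\<^sup>2 / t'\<^sup>2" for a
    by (simp_all add: power_mult_distrib)
  show ?thesis
    unfolding preserves_def *
    by (intro conjI ballI preservesD[OF assms(1)] preservesD[OF assms(2)])
qed

lemma preserves_a: "c \<in> K0 \<Longrightarrow> c \<noteq> 0 \<Longrightarrow> preserves (inverse c) c"
  using square_L0_mult[of c] square_L0_mult[of "inverse c"] inverse_K0[of c]
    square_K0_mult[of _ c] square_K0_mult[of _ "inverse c"]
  by (auto simp: preserves_def field_simps power2_eq_square)

text \<open>The short characters take the values c and its inverse, so this uses that
  \<open>K0\<close> is a space over the field generated by \<open>L0\<close>. The long ones take the
  value 1 or a square of c or of its inverse.\<close>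

lemma preserves_b: "c \<in> L0 \<Longrightarrow> c \<noteq> 0 \<Longrightarrow> preserves 1 (inverse c)"
  using square_L0_mult[of c] square_L0_mult[of "inverse c"] inverse_K0[of c] L0_K0[of c]
    L0_mult_K0[of c] L0_div_K0[of c]
  by (auto simp: preserves_def field_simps power2_eq_square)

lemma torus_closed: "h \<in> torus \<Longrightarrow> h' \<in> torus \<Longrightarrow> h ** h' \<in> torus"
  using preserves_mult unfolding torus_def by (force simp: torus_mult)

lemma weyl_torus_mat:
  assumes "w \<in> weyl" "s \<noteq> 0" "t \<noteq> 0" "preserves s t"
  shows "\<exists>s' t'. s' \<noteq> 0 \<and> t' \<noteq> 0 \<and> preserves s' t' \<and> w ** torus_mat s t = torus_mat s' t' ** w"
proof -
  \<comment> \<open>\<open>P\<close> is closed under products, so the two simple reflections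
    suffice.\<close>
  define P where "P w \<longleftrightarrow> (\<forall>s t. s \<noteq> 0 \<and> t \<noteq> 0 \<and> preserves s t \<longrightarrow>
    (\<exists>s' t'. s' \<noteq> 0 \<and> t' \<noteq> 0 \<and> preserves s' t' \<and> w ** torus_mat s t = torus_mat s' t' ** w))" for w
  have 1: "P (mat 1)" unfolding P_def by auto
  have a: "P na" unfolding P_def using preserves_swap torus_na by metis
  have b: "P nb" unfolding P_def using preserves_inverse torus_nb by (metis nonzero_imp_inverse_nonzero)
  have m: "P (v ** w)" if v: "P v" and w: "P w" for v w
    unfolding P_def
  proof (intro allI impI)
    fix s t assume "s \<noteq> 0 \<and> t \<noteq> 0 \<and> preserves s t"
    with w[unfolded P_def] obtain s1 t1 where 1: "s1 \<noteq> 0 \<and> t1 \<noteq> 0 \<and> preserves s1 t1"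
      "w ** torus_mat s t = torus_mat s1 t1 ** w" by blast
    with v[unfolded P_def] 1(1) obtain s2 t2 where 2: "s2 \<noteq> 0 \<and> t2 \<noteq> 0 \<and> preserves s2 t2"
      "v ** torus_mat s1 t1 = torus_mat s2 t2 ** v" by blast
    have "v ** w ** torus_mat s t = torus_mat s2 t2 ** (v ** w)"
      using 1(2) 2(2) by (metis matrix_mul_assoc)
    with 2(1) show "\<exists>s' t'. s' \<noteq> 0 \<and> t' \<noteq> 0 \<and> preserves s' t' \<and>
        v ** w ** torus_mat s t = torus_mat s' t' ** (v ** w)" by blast
  qed
  have "P w"
    using assms(1) unfolding weyl_def by (elim insertE emptyE) (simp_all only: 1 a b m)
  then show ?thesis using assms(2-) unfolding P_def by blast
qed

section \<open>Words of bounded length in root elements\<close>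

primrec word :: "(int \<times> int) list \<Rightarrow> 'k list \<Rightarrow> 'k^4^4" where
  "word [] as = mat 1"
| "word (\<gamma> # \<gamma>s) as = root_mat \<gamma> (hd as) ** word \<gamma>s (tl as)"

lemma word_append:
  "length as = length \<gamma>s \<Longrightarrow> word (\<gamma>s @ \<delta>s) (as @ bs) = word \<gamma>s as ** word \<delta>s bs"
  by (induction \<gamma>s arbitrary: as) (auto simp: matrix_mul_assoc[symmetric] length_Suc_conv)

definition params :: "(int \<times> int) list \<Rightarrow> 'k list set" where
  "params \<gamma>s = {as. list_all2 (\<lambda>a \<gamma>. a \<in> param \<gamma>) as \<gamma>s}"

lemma params_append: "as \<in> params \<gamma>s \<Longrightarrow> bs \<in> params \<delta>s \<Longrightarrow> as @ bs \<in> params (\<gamma>s @ \<delta>s)"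
  by (simp add: params_def list_all2_appendI)

lemma word_params_append:
  assumes "\<exists>as\<in>params \<gamma>s. A = word \<gamma>s as" "\<exists>bs\<in>params \<delta>s. B = word \<delta>s bs"
  shows "\<exists>as\<in>params (\<gamma>s @ \<delta>s). A ** B = word (\<gamma>s @ \<delta>s) as"
proof -
  obtain as bs where *: "as \<in> params \<gamma>s" "A = word \<gamma>s as" "bs \<in> params \<delta>s" "B = word \<delta>s bs"
    using assms by blast
  have "length as = length \<gamma>s" using *(1) by (simp add: params_def list_all2_lengthD)
  then show ?thesis using * params_append by (metis word_append)
qed

definition unip_roots :: "(int \<times> int) list" where
  "unip_roots = [(1, -1), (0, 2), (1, 1), (2, 0)]"

text \<open>Every Weyl element arises from \<open>na ** nb ** na ** nb\<close> by omitting factors.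
  By \<open>n_eq\<close> each reflection is a product of three root elements with parameter 1, and
  parameter 0 omits it, so one pattern of twelve roots serves all eight elements.\<close>

definition weyl_roots :: "(int \<times> int) list" where
  "weyl_roots = [(1, -1), (-1, 1), (1, -1)] @ [(0, 2), (0, -2), (0, 2)] @
                [(1, -1), (-1, 1), (1, -1)] @ [(0, 2), (0, -2), (0, 2)]"

definition roots :: "(int \<times> int) list" where
  "roots = unip_roots @ weyl_roots @ unip_roots"

lemma unip_word: "u \<in> unip \<Longrightarrow> \<exists>as\<in>params unip_roots. u = word unip_roots as"
proof -
  assume "u \<in> unip"
  then obtain a b c d where "u = U4 a b c d" "a \<in> K0" "b \<in> L0" "c \<in> K0" "d \<in> L0"
    by (auto simp: unip_def)
  then show ?thesis
    by (intro bexI[of _ "[a, b, c, d]"])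
      (auto simp: unip_roots_def params_def U4_eq matrix_mul_assoc)
qed

lemma weyl_word:
  assumes "w \<in> weyl"
  shows "\<exists>as\<in>params weyl_roots. w = word weyl_roots as"
proof -
  have a: "\<exists>as\<in>params [(1, -1), (-1, 1), (1, -1)]. m = word [(1, -1), (-1, 1), (1, -1)] as"
    if "m \<in> {mat 1, na}" for m
    using that
  proof (elim insertE emptyE)
    assume "m = mat 1"
    then show ?thesis by (intro bexI[of _ "[0, 0, 0]"]) (auto simp: params_def group_simps)
  next
    assume "m = na"
    then show ?thesis
      by (intro bexI[of _ "[1, 1, 1]"]) (auto simp: params_def n_eq(1) matrix_mul_assoc)
  qed
  have b: "\<exists>as\<in>params [(0, 2), (0, -2), (0, 2)]. m = word [(0, 2), (0, -2), (0, 2)] as"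
    if "m \<in> {mat 1, nb}" for m
    using that
  proof (elim insertE emptyE)
    assume "m = mat 1"
    then show ?thesis by (intro bexI[of _ "[0, 0, 0]"]) (auto simp: params_def group_simps)
  next
    assume "m = nb"
    then show ?thesis
      by (intro bexI[of _ "[1, 1, 1]"]) (auto simp: params_def n_eq(2) matrix_mul_assoc)
  qed
  have "\<exists>p\<in>{mat 1, na}. \<exists>q\<in>{mat 1, nb}. \<exists>r\<in>{mat 1, na}. \<exists>s\<in>{mat 1, nb}. w = p ** (q ** (r ** s))"
    using assms unfolding weyl_def by (elim insertE emptyE) (simp_all add: matrix_mul_assoc)
  then obtain p q r s where "p \<in> {mat 1, na}" "q \<in> {mat 1, nb}" "r \<in> {mat 1, na}" "s \<in> {mat 1, nb}"
    and w: "w = p ** (q ** (r ** s))" by blast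
  then show ?thesis unfolding w weyl_roots_def by (intro word_params_append a b)
qed

lemma cells_word:
  assumes "m \<in> cells H"
  shows "\<exists>h\<in>H. \<exists>as\<in>params roots. m = h ** word roots as"
proof -
  obtain h u w u' where m: "m = h ** u ** w ** u'" "h \<in> H" "u \<in> unip" "w \<in> weyl" "u' \<in> unip"
    using assms by (auto simp: cells_def)
  have "\<exists>as\<in>params roots. u ** (w ** u') = word roots as"
    unfolding roots_def using m(3-5) by (intro word_params_append unip_word weyl_word)
  then show ?thesis using m(1,2) by (metis matrix_mul_assoc)
qed

end

subsection \<open>The mixed group inside \<open>PSp\<^sub>4\<close>\<close>

context indifferent
begin

lemma Sp4_simps [simp]: "x \<otimes>\<^bsub>Sp4\<^esub> y = x ** y" "\<one>\<^bsub>Sp4\<^esub> = mat 1"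
  by (simp_all add: Sp4_def)

lemma Sp4_iff: "A \<in> carrier Sp4 \<longleftrightarrow> transpose A ** symp_form ** A = symp_form"
  by (simp add: Sp4_def)

lemma symp_form_square: "symp_form ** symp_form = (mat 1 :: 'k^4^4)"
  by (simp add: group_simps)

lemma Sp4_mult: "A \<in> carrier Sp4 \<Longrightarrow> B \<in> carrier Sp4 \<Longrightarrow> A ** B \<in> carrier Sp4"
  for A B :: "'k^4^4"
proof -
  assume AB: "A \<in> carrier Sp4" "B \<in> carrier Sp4"
  have "transpose (A ** B) ** symp_form ** (A ** B)
      = transpose B ** (transpose A ** symp_form ** A) ** B"
    by (simp add: matrix_transpose_mul matrix_mul_assoc)
  then show ?thesis using AB by (simp add: Sp4_iff)
qed

lemma Sp4_inverse:
  fixes A :: "'k^4^4"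
  assumes "A \<in> carrier Sp4"
  shows "\<exists>B\<in>carrier Sp4. B ** A = mat 1 \<and> A ** B = mat 1"
proof
  \<comment> \<open>In characteristic 2 \<open>symp_form\<close> is an involution, so multiplying
    the defining equation by it on the left exhibits a left inverse.\<close>
  let ?B = "symp_form ** transpose A ** symp_form"
  have "?B ** A = symp_form ** (transpose A ** symp_form ** A)" by (simp add: matrix_mul_assoc)
  then have 1: "?B ** A = mat 1" using assms by (simp add: Sp4_iff symp_form_square)
  then have 2: "A ** ?B = mat 1" using matrix_left_right_inverse by blast
  have "transpose ?B ** symp_form ** ?B = transpose ?B ** (transpose A ** symp_form ** A) ** ?B"
    using assms by (simp add: Sp4_iff)
  also have "\<dots> = transpose (A ** ?B) ** symp_form ** (A ** ?B)"
    by (simp only: matrix_transpose_mul matrix_mul_assoc)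
  also have "\<dots> = symp_form" by (simp only: 2 transpose_mat matrix_mul_lid matrix_mul_rid)
  finally have "?B \<in> carrier Sp4" by (simp only: Sp4_iff)
  with 1 2 show "?B ** A = mat 1 \<and> A ** ?B = mat 1" "?B \<in> carrier Sp4" by blast+
qed

lemma one_Sp4: "mat 1 \<in> carrier Sp4"
  by (simp add: Sp4_iff)

lemma group_Sp4: "group (Sp4 :: ('k^4^4) monoid)"
proof (rule groupI)
  show "\<exists>y\<in>carrier Sp4. y \<otimes>\<^bsub>Sp4\<^esub> x = \<one>\<^bsub>Sp4\<^esub>" if "x \<in> carrier Sp4" for x :: "'k^4^4"
    using Sp4_inverse[OF that] by auto
qed (simp_all add: Sp4_mult one_Sp4 matrix_mul_assoc)

lemma root_mat_Sp4: "\<gamma> \<in> short_roots \<union> long_roots \<Longrightarrow> root_mat \<gamma> (a :: 'k) \<in> carrier Sp4"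
  by (auto simp: short_roots_def long_roots_def Sp4_iff group_simps)

lemma torus_mat_Sp4: "s \<noteq> 0 \<Longrightarrow> t \<noteq> 0 \<Longrightarrow> torus_mat s (t :: 'k) \<in> carrier Sp4"
  by (simp add: Sp4_iff group_simps)

text \<open>The three commutation relations leave only the diagonal (a11, a22, a22, a11) and the
  corner a14. The symplectic condition gives a11 and a22 square 1, and in characteristic 2 the only
  square root of 1 is 1. This serves both the triviality of the centre and the definability of the
  root group.\<close>

lemma long_root_centralizer:
  assumes "A \<in> carrier Sp4" "A ** xb 1 = xb 1 ** A" "A ** root_mat (0, -2) 1 = root_mat (0, -2) 1 ** A"
    "A ** root_mat (2, 0) 1 = root_mat (2, 0) 1 ** A"
  shows "\<exists>d. A = U4 0 0 0 d"
proof -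
  obtain a11 a12 a13 a14 a21 a22 a23 a24 a31 a32 a33 a34 a41 a42 a43 a44 where
    A: "A = mat4 a11 a12 a13 a14 a21 a22 a23 a24 a31 a32 a33 a34 a41 a42 a43 a44"
    using eq_mat4 by blast
  have z: "a12 = 0" "a13 = 0" "a21 = 0" "a31 = 0" "a41 = 0" "a42 = 0" "a43 = 0" "a24 = 0" "a34 = 0"
    "a23 = 0" "a32 = 0" "a33 = a22" "a44 = a11"
    using assms(2-4) unfolding A by (auto simp: group_simps)
  have "a22\<^sup>2 = 1\<^sup>2" "a11\<^sup>2 = 1\<^sup>2"
    using assms(1) unfolding A z by (auto simp: group_simps Sp4_iff power2_eq_square)
  then have "a22 = 1" "a11 = 1" by (simp_all only: square_inject)
  then show ?thesis unfolding A z by (simp add: group_simps)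
qed

lemma short_root_centralizer:
  assumes "A \<in> carrier Sp4" "A ** xa 1 = xa 1 ** A" "A ** root_mat (-1, 1) 1 = root_mat (-1, 1) 1 ** A"
    "A ** root_mat (1, 1) 1 = root_mat (1, 1) 1 ** A"
  shows "\<exists>c. A = U4 0 0 c 0"
proof -
  obtain a11 a12 a13 a14 a21 a22 a23 a24 a31 a32 a33 a34 a41 a42 a43 a44 where
    A: "A = mat4 a11 a12 a13 a14 a21 a22 a23 a24 a31 a32 a33 a34 a41 a42 a43 a44"
    using eq_mat4 by blast
  have z: "a12 = 0" "a21 = 0" "a22 = a11" "a31 = 0" "a32 = 0" "a41 = 0" "a42 = 0" "a43 = 0" "a34 = 0"
    "a14 = 0" "a23 = 0" "a24 = a13" "a33 = a11" "a44 = a11"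
    using assms(2-4) unfolding A by (auto simp: group_simps)
  have "a11\<^sup>2 = 1\<^sup>2"
    using assms(1) unfolding A z by (auto simp: group_simps Sp4_iff power2_eq_square)
  then have "a11 = 1" by (simp only: square_inject)
  then show ?thesis unfolding A z by (simp add: group_simps)
qed

text \<open>A central element satisfies both centralizer lemmas, hence lies in the root groups for
  2\<alpha> + \<beta> and \<alpha> + \<beta> at once.\<close>

lemma center_Sp4: "center Sp4 = {mat 1 :: 'k^4^4}"
proof
  show "{mat 1} \<subseteq> center (Sp4 :: ('k^4^4) monoid)" by (simp add: center_def one_Sp4)
  show "center Sp4 \<subseteq> {mat 1 :: 'k^4^4}"
  proof
    fix A :: "'k^4^4" assume "A \<in> center Sp4"
    then have A: "A \<in> carrier Sp4" "\<And>B. B \<in> carrier Sp4 \<Longrightarrow> A ** B = B ** A"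
      by (auto simp: center_def)
    note c = A(2)[OF root_mat_Sp4]
    obtain d where "A = U4 0 0 0 d"
      using long_root_centralizer[OF A(1)] c by (auto simp: short_roots_def long_roots_def)
    moreover obtain c where "A = U4 0 0 c 0"
      using short_root_centralizer[OF A(1)] c by (auto simp: short_roots_def long_roots_def)
    ultimately have "A = U4 0 0 0 0" by (simp add: U4_inject)
    then show "A \<in> {mat 1}" by (simp add: U4_0)
  qed
qed

lemma proj_Sp4_eq: "proj_Sp4 A = {A :: 'k^4^4}"
  by (simp add: proj_Sp4_def center_Sp4 r_coset_def)

lemma carrier_PSp4: "carrier PSp4 = (\<lambda>A. {A :: 'k^4^4}) ` carrier Sp4"
  unfolding PSp4_def center_Sp4 FactGroup_def RCOSETS_def r_coset_def by auto

lemma mult_PSp4: "{A} \<otimes>\<^bsub>PSp4\<^esub> {B} = {A ** B :: 'k^4^4}"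
  by (simp add: PSp4_def center_Sp4 FactGroup_def set_mult_def)

lemma group_PSp4: "group (PSp4 :: ('k^4^4) set monoid)"
  using normal.factorgroup_is_group[OF group.one_is_normal[OF group_Sp4]]
  by (simp add: PSp4_def center_Sp4)

end

section \<open>Transport between matrices and \<open>PSp4\<close>\<close>

locale mixed_group = indifferent K0 L0
  for K0 L0 :: "'k::field set" +
  fixes g :: "('k^4^4) set" and T :: "('k^4^4) set set"
  assumes g: "g \<in> carrier PSp4"
    and subgroup_T: "subgroup T PSp4"
    and T_split: "T \<subseteq> split_torus g"
    and T_normalizes: "t \<in> T \<Longrightarrow> conj_by PSp4 t ` PSp4_mixed g L0 K0 = PSp4_mixed g L0 K0"
    and split_T: "split_torus g \<inter> PSp4_mixed g L0 K0 \<subseteq> T"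
begin

interpretation PSp4: group "PSp4 :: ('k^4^4) set monoid"
  by (rule group_PSp4)

text \<open>Since the centre is trivial, cosets are singletons and this is an isomorphism from
  \<open>Sp4\<close> onto \<open>PSp4\<close>. The conjugation by \<open>g\<close> sends the
  diagonal torus to the chosen one, so all computations can use diagonal tori.\<close>

definition theta :: "'k^4^4 \<Rightarrow> ('k^4^4) set" where
  "theta A = conj_by PSp4 g {A}"

lemma singleton_PSp4: "A \<in> carrier Sp4 \<Longrightarrow> {A :: 'k^4^4} \<in> carrier PSp4"
  by (simp add: carrier_PSp4)

lemma theta_carrier [simp]: "A \<in> carrier Sp4 \<Longrightarrow> theta A \<in> carrier PSp4"
  using g singleton_PSp4 by (simp add: theta_def conj_by_def)

lemma theta_mult:
  assumes "A \<in> carrier Sp4" "B \<in> carrier Sp4"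
  shows "theta A \<otimes>\<^bsub>PSp4\<^esub> theta B = theta (A ** B)"
proof -
  have *: "{A} \<in> carrier PSp4" "{B} \<in> carrier PSp4" using assms singleton_PSp4 by auto
  have "inv\<^bsub>PSp4\<^esub> g \<otimes>\<^bsub>PSp4\<^esub> (g \<otimes>\<^bsub>PSp4\<^esub> x) = x" if "x \<in> carrier PSp4" for x
    using g that by (simp add: PSp4.m_assoc[symmetric])
  then have "theta A \<otimes>\<^bsub>PSp4\<^esub> theta B = g \<otimes>\<^bsub>PSp4\<^esub> ({A} \<otimes>\<^bsub>PSp4\<^esub> {B}) \<otimes>\<^bsub>PSp4\<^esub> inv\<^bsub>PSp4\<^esub> g"
    using g * by (simp add: theta_def conj_by_def PSp4.m_assoc)
  then show ?thesis by (simp add: theta_def conj_by_def mult_PSp4)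
qed

lemma theta_inject:
  assumes "A \<in> carrier Sp4" "B \<in> carrier Sp4"
  shows "theta A = theta B \<longleftrightarrow> A = B"
proof -
  have *: "{A} \<in> carrier PSp4" "{B} \<in> carrier PSp4" using assms singleton_PSp4 by auto
  then have "theta A = theta B \<longleftrightarrow> {A} = {B}"
    unfolding theta_def conj_by_def using g by simp
  then show ?thesis by simp
qed

lemma theta_surj:
  assumes "x \<in> carrier PSp4"
  shows "\<exists>A\<in>carrier Sp4. x = theta A"
proof -
  have "inv\<^bsub>PSp4\<^esub> g \<otimes>\<^bsub>PSp4\<^esub> x \<otimes>\<^bsub>PSp4\<^esub> g \<in> carrier PSp4" using g assms by simp
  then obtain A where A: "A \<in> carrier Sp4" "inv\<^bsub>PSp4\<^esub> g \<otimes>\<^bsub>PSp4\<^esub> x \<otimes>\<^bsub>PSp4\<^esub> g = {A}"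
    by (auto simp: carrier_PSp4)
  have "g \<otimes>\<^bsub>PSp4\<^esub> (inv\<^bsub>PSp4\<^esub> g \<otimes>\<^bsub>PSp4\<^esub> y) = y" if "y \<in> carrier PSp4" for y
    using g that by (simp add: PSp4.m_assoc[symmetric])
  then have "theta A = x"
    unfolding theta_def conj_by_def A(2)[symmetric] using g assms by (simp add: PSp4.m_assoc)
  with A(1) show ?thesis by blast
qed

lemma theta_one: "theta (mat 1) = \<one>\<^bsub>PSp4\<^esub>"
  using theta_mult[OF one_Sp4 one_Sp4] theta_carrier[OF one_Sp4] by simp

lemma theta_inv:
  assumes "A \<in> carrier Sp4" "B \<in> carrier Sp4" "A ** B = mat 1"
  shows "inv\<^bsub>PSp4\<^esub> theta A = theta B"
proof -
  have "B ** A = mat 1" using assms(3) matrix_left_right_inverse by blast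
  then have "theta B \<otimes>\<^bsub>PSp4\<^esub> theta A = \<one>\<^bsub>PSp4\<^esub>"
    using assms by (simp add: theta_mult theta_one)
  then show ?thesis using assms by (simp add: PSp4.inv_equality)
qed

lemma conj_by_theta_eq:
  assumes "A \<in> carrier Sp4" "B \<in> carrier Sp4" "C \<in> carrier Sp4"
  shows "conj_by PSp4 (theta A) (theta B) = theta C \<longleftrightarrow> A ** B = C ** A"
proof -
  have "conj_by PSp4 (theta A) (theta B) = theta C \<longleftrightarrow>
      theta A \<otimes>\<^bsub>PSp4\<^esub> theta B = theta C \<otimes>\<^bsub>PSp4\<^esub> theta A"
    unfolding conj_by_def using assms by (intro PSp4.inv_solve_right') simp_all
  then show ?thesis using assms by (simp add: theta_mult theta_inject Sp4_mult)
qed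

lemma split_torus_eq: "split_torus g = theta ` {torus_mat s t | s t. s \<noteq> 0 \<and> t \<noteq> 0}"
  unfolding split_torus_def theta_def proj_Sp4_eq by auto

lemma root_elt_eq: "root_elt g \<gamma> a = theta (root_mat \<gamma> a)"
  by (simp add: root_elt_def theta_def proj_Sp4_eq)

definition S_mat :: "('k^4^4) set" where
  "S_mat = {A \<in> carrier Sp4. theta A \<in> PSp4_mixed g L0 K0}"

definition T_mat :: "('k^4^4) set" where
  "T_mat = {A \<in> carrier Sp4. theta A \<in> T}"

lemma subgroup_mixed: "subgroup (PSp4_mixed g L0 K0) PSp4"
  unfolding PSp4_mixed_def
  by (rule PSp4.generate_is_subgroup)
    (auto simp: root_elt_eq intro!: theta_carrier root_mat_Sp4)

lemma S_mult: "A \<in> S_mat \<Longrightarrow> B \<in> S_mat \<Longrightarrow> A ** B \<in> S_mat"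
  using subgroup.m_closed[OF subgroup_mixed] by (auto simp: S_mat_def Sp4_mult theta_mult[symmetric])

lemma TT_mult: "A \<in> T_mat \<Longrightarrow> B \<in> T_mat \<Longrightarrow> A ** B \<in> T_mat"
  using subgroup.m_closed[OF subgroup_T] by (auto simp: T_mat_def Sp4_mult theta_mult[symmetric])

lemma S_one: "mat 1 \<in> S_mat" and TT_one: "mat 1 \<in> T_mat"
  using subgroup.one_closed[OF subgroup_mixed] subgroup.one_closed[OF subgroup_T]
  by (simp_all add: S_mat_def T_mat_def one_Sp4 theta_one)

lemma root_mat_S: "\<gamma> \<in> short_roots \<union> long_roots \<Longrightarrow> a \<in> param \<gamma> \<Longrightarrow> root_mat \<gamma> a \<in> S_mat"
  unfolding S_mat_def PSp4_mixed_def using root_mat_Sp4[of \<gamma> a]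
  by (auto simp: root_elt_eq[symmetric] param_def short_roots_def long_roots_def intro!: generate.incl)

lemma root_mat_S_simps:
  "a \<in> K0 \<Longrightarrow> root_mat (1, -1) a \<in> S_mat" "a \<in> K0 \<Longrightarrow> root_mat (-1, 1) a \<in> S_mat"
  "a \<in> K0 \<Longrightarrow> root_mat (1, 1) a \<in> S_mat" "a \<in> K0 \<Longrightarrow> root_mat (-1, -1) a \<in> S_mat"
  "a \<in> L0 \<Longrightarrow> root_mat (2, 0) a \<in> S_mat" "a \<in> L0 \<Longrightarrow> root_mat (-2, 0) a \<in> S_mat"
  "a \<in> L0 \<Longrightarrow> root_mat (0, 2) a \<in> S_mat" "a \<in> L0 \<Longrightarrow> root_mat (0, -2) a \<in> S_mat"
  by (auto intro!: root_mat_S simp: short_roots_def long_roots_def)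

lemma n_S: "na \<in> S_mat" "nb \<in> S_mat"
  unfolding n_eq by (intro S_mult root_mat_S_simps one_K0 one_L0)+

lemma root_mat_square: "\<gamma> \<in> short_roots \<union> long_roots \<Longrightarrow> root_mat \<gamma> a ** root_mat \<gamma> a = (mat 1 :: 'k^4^4)"
  by (auto simp: short_roots_def long_roots_def group_simps)

lemma param_short: "\<gamma> \<in> short_roots \<Longrightarrow> param \<gamma> = K0" and param_long: "\<gamma> \<in> long_roots \<Longrightarrow> param \<gamma> = L0"
  by (auto simp: param_def short_roots_def long_roots_def)

lemma generatorE:
  assumes "h \<in> (\<Union>\<gamma>\<in>short_roots. root_elt g \<gamma> ` K0) \<union> (\<Union>\<gamma>\<in>long_roots. root_elt g \<gamma> ` L0)"
  obtains \<gamma> a where "\<gamma> \<in> short_roots \<union> long_roots" "a \<in> param \<gamma>" "h = theta (root_mat \<gamma> a)"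
  using assms
proof (elim UnE UN_E imageE)
  fix \<gamma> a assume "\<gamma> \<in> short_roots" "h = root_elt g \<gamma> a" "a \<in> K0"
  then show thesis by (intro that[of \<gamma> a]) (simp_all add: root_elt_eq param_short)
next
  fix \<gamma> a assume "\<gamma> \<in> long_roots" "h = root_elt g \<gamma> a" "a \<in> L0"
  then show thesis by (intro that[of \<gamma> a]) (simp_all add: root_elt_eq param_long)
qed

text \<open>The property that right multiplication preserves the cells passes to products, hence
  from generators to the generated group. Root elements are involutions, so inverses of generators
  are generators.\<close>

lemma cells_mult_S:
  assumes na: "\<And>m. m \<in> cells H \<Longrightarrow> m ** na \<in> cells H" and nb: "\<And>m. m \<in> cells H \<Longrightarrow> m ** nb \<in> cells H"
    and A: "A \<in> S_mat" and m: "m \<in> cells H"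
  shows "m ** A \<in> cells H"
proof -
  have "\<exists>B\<in>carrier Sp4. x = theta B \<and> (\<forall>m\<in>cells H. m ** B \<in> cells H)" if "x \<in> PSp4_mixed g L0 K0" for x
    using that unfolding PSp4_mixed_def
  proof induction
    case one
    then show ?case using one_Sp4 theta_one by (intro bexI[of _ "mat 1"]) auto
  next
    case (incl h)
    then obtain \<gamma> a where \<gamma>: "\<gamma> \<in> short_roots \<union> long_roots" "a \<in> param \<gamma>" "h = theta (root_mat \<gamma> a)"
      by (rule generatorE)
    show ?case
      using \<gamma>(3) root_mat_Sp4[OF \<gamma>(1)] cells_mult_root[OF na nb _ \<gamma>(1,2)] by blast
  next
    case (inv h)
    then obtain \<gamma> a where \<gamma>: "\<gamma> \<in> short_roots \<union> long_roots" "a \<in> param \<gamma>" "h = theta (root_mat \<gamma> a)"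
      by (rule generatorE)
    have "inv\<^bsub>PSp4\<^esub> h = theta (root_mat \<gamma> a)"
      unfolding \<gamma>(3) using \<gamma>(1) by (intro theta_inv root_mat_Sp4 root_mat_square)
    then show ?case
      using root_mat_Sp4[OF \<gamma>(1)] cells_mult_root[OF na nb _ \<gamma>(1,2)] by blast
  next
    case (eng h1 h2)
    then obtain B C where "B \<in> carrier Sp4" "h1 = theta B" "\<forall>m\<in>cells H. m ** B \<in> cells H"
      "C \<in> carrier Sp4" "h2 = theta C" "\<forall>m\<in>cells H. m ** C \<in> cells H" by blast
    then show ?case
      by (intro bexI[of _ "B ** C"]) (auto simp: theta_mult matrix_mul_assoc Sp4_mult)
  qed
  then obtain B where "B \<in> carrier Sp4" "theta A = theta B" "\<forall>m\<in>cells H. m ** B \<in> cells H"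
    using A unfolding S_mat_def by blast
  then show ?thesis using A m by (auto simp: S_mat_def theta_inject)
qed

lemma one_cells: "mat 1 \<in> H \<Longrightarrow> mat 1 \<in> cells H"
  unfolding cells_def weyl_def using one_unip by force

lemma one_torus: "mat 1 \<in> torus"
  unfolding torus_def torus_one[symmetric] by (auto simp: preserves_def intro!: exI)

lemma torus_weyl:
  assumes "w \<in> weyl" "s \<noteq> 0" "t \<noteq> 0" "preserves s t"
  shows "\<exists>h\<in>torus. w ** torus_mat s t = h ** w"
  using weyl_torus_mat[OF assms] unfolding torus_def by blast

lemma S_cells_torus: "S_mat \<subseteq> cells torus"
proof
  fix A assume A: "A \<in> S_mat"
  have "mat 1 ** A \<in> cells torus"
  proof (rule cells_mult_S[OF _ _ A one_cells[OF one_torus]])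
    show "m ** na \<in> cells torus" if "m \<in> cells torus" for m
      by (rule cells_mult_na[OF order.refl torus_closed _ that])
        (auto intro!: torus_weyl preserves_a)
    show "m ** nb \<in> cells torus" if "m \<in> cells torus" for m
      by (rule cells_mult_nb[OF order.refl torus_closed _ that])
        (auto intro!: torus_weyl preserves_b)
  qed
  then show "A \<in> cells torus" by simp
qed

lemma TT_torus_mat:
  assumes "A \<in> T_mat"
  obtains s t where "A = torus_mat s t" "s \<noteq> 0" "t \<noteq> 0"
proof -
  have "theta A \<in> split_torus g" using assms T_split by (auto simp: T_mat_def)
  then obtain s t where "theta A = theta (torus_mat s t)" "s \<noteq> 0" "t \<noteq> 0"
    by (auto simp: split_torus_eq)
  then show thesis using that assms torus_mat_Sp4 by (simp add: T_mat_def theta_inject)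
qed

lemma TT_inverse:
  assumes "torus_mat s t \<in> T_mat" "s \<noteq> 0" "t \<noteq> 0"
  shows "torus_mat (inverse s) (inverse t) \<in> T_mat"
proof -
  have "inv\<^bsub>PSp4\<^esub> theta (torus_mat s t) = theta (torus_mat (inverse s) (inverse t))"
    using assms(2,3) by (intro theta_inv torus_mat_Sp4) (simp_all add: torus_mult torus_one)
  then show ?thesis
    using subgroup.m_inv_closed[OF subgroup_T, of "theta (torus_mat s t)"] assms
    by (simp add: T_mat_def torus_mat_Sp4)
qed

lemma TT_normalizes:
  assumes "A \<in> T_mat" "B \<in> S_mat"
  shows "\<exists>C\<in>S_mat. A ** B = C ** A" "\<exists>C\<in>S_mat. B ** A = A ** C"
proof -
  have *: "conj_by PSp4 (theta A) ` PSp4_mixed g L0 K0 = PSp4_mixed g L0 K0"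
    using assms(1) by (intro T_normalizes) (simp add: T_mat_def)
  have lift: "\<exists>C\<in>S_mat. x = theta C" if "x \<in> PSp4_mixed g L0 K0" for x
    using theta_surj[of x] subgroup.mem_carrier[OF subgroup_mixed that] that by (auto simp: S_mat_def)
  have A: "A \<in> carrier Sp4" and B: "B \<in> carrier Sp4" "theta B \<in> PSp4_mixed g L0 K0"
    using assms by (auto simp: T_mat_def S_mat_def)
  have "conj_by PSp4 (theta A) (theta B) \<in> PSp4_mixed g L0 K0" using * B(2) by blast
  then obtain C where C: "C \<in> S_mat" "conj_by PSp4 (theta A) (theta B) = theta C" using lift by blast
  then show "\<exists>C\<in>S_mat. A ** B = C ** A" using conj_by_theta_eq[OF A B(1)] by (auto simp: S_mat_def)
  obtain y where "y \<in> PSp4_mixed g L0 K0" "theta B = conj_by PSp4 (theta A) y" using * B(2) by blast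
  then obtain D where D: "D \<in> S_mat" "conj_by PSp4 (theta A) (theta D) = theta B" using lift by metis
  then have "A ** D = B ** A" using conj_by_theta_eq[OF A _ B(1)] by (auto simp: S_mat_def)
  then show "\<exists>C\<in>S_mat. B ** A = A ** C" using D(1) by metis
qed

lemma S_U4: "U4 a b c d \<in> S_mat \<Longrightarrow> a \<in> K0 \<and> b \<in> L0 \<and> c \<in> K0 \<and> d \<in> L0"
  using U4_cells[OF order.refl] S_cells_torus by blast

text \<open>The conjugate by an element of \<open>T_mat\<close> is again unipotent with scaled
  coordinates. It lies in the mixed group by normalization, and there \<open>S_U4\<close> confines
  the coordinates.\<close>

lemma TT_mult_U4:
  assumes "torus_mat s t \<in> T_mat" "s \<noteq> 0" "t \<noteq> 0" "U4 a b c d \<in> S_mat"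
  shows "s / t * a \<in> K0 \<and> t\<^sup>2 * b \<in> L0 \<and> s * t * c \<in> K0 \<and> s\<^sup>2 * d \<in> L0"
proof -
  obtain C where C: "C \<in> S_mat" "torus_mat s t ** U4 a b c d = C ** torus_mat s t"
    using TT_normalizes(1)[OF assms(1,4)] by blast
  then have "U4 (s / t * a) (t\<^sup>2 * b) (s * t * c) (s\<^sup>2 * d) ** torus_mat s t = C ** torus_mat s t"
    using torus_U4[OF assms(2,3)] by metis
  then have "U4 (s / t * a) (t\<^sup>2 * b) (s * t * c) (s\<^sup>2 * d) ** (torus_mat s t ** torus_mat (inverse s) (inverse t))
      = C ** (torus_mat s t ** torus_mat (inverse s) (inverse t))"
    by (metis matrix_mul_assoc)
  then have "U4 (s / t * a) (t\<^sup>2 * b) (s * t * c) (s\<^sup>2 * d) = C"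
    using assms(2,3) by (simp add: torus_mult torus_one)
  with C(1) show ?thesis using S_U4 by metis
qed

lemma U4_S: "a \<in> K0 \<Longrightarrow> b \<in> L0 \<Longrightarrow> c \<in> K0 \<Longrightarrow> d \<in> L0 \<Longrightarrow> U4 a b c d \<in> S_mat"
  unfolding U4_eq by (intro S_mult root_mat_S_simps)

lemma TT_torus: "T_mat \<subseteq> torus"
proof
  fix A assume A: "A \<in> T_mat"
  then obtain s t where st: "A = torus_mat s t" "s \<noteq> 0" "t \<noteq> 0" by (rule TT_torus_mat)
  have inv: "torus_mat (inverse s) (inverse t) \<in> T_mat" using A st TT_inverse by blast
  have "preserves s t"
    unfolding preserves_def
  proof (intro conjI ballI)
    fix a assume a: "a \<in> K0"
    \<comment> \<open>One matrix tests both characters s / t and \<open>s * t\<close>; the inverse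
      torus element supplies their reciprocals.\<close>
    have u: "U4 a 0 a 0 \<in> S_mat" using a by (simp add: U4_S)
    show "s / t * a \<in> K0" "s * t * a \<in> K0" using TT_mult_U4[OF A[unfolded st] st(2,3) u] by auto
    show "t / s * a \<in> K0" "a / (s * t) \<in> K0"
      using TT_mult_U4[OF inv _ _ u] st by (auto simp: field_simps)
  next
    fix b assume b: "b \<in> L0"
    have u: "U4 0 b 0 b \<in> S_mat" using b by (simp add: U4_S)
    show "s\<^sup>2 * b \<in> L0" "t\<^sup>2 * b \<in> L0" using TT_mult_U4[OF A[unfolded st] st(2,3) u] by auto
    show "b / s\<^sup>2 \<in> L0" "b / t\<^sup>2 \<in> L0"
      using TT_mult_U4[OF inv _ _ u] st by (auto simp: field_simps)
  qed
  then show "A \<in> torus" using st by (auto simp: torus_def)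
qed

lemma weyl_S: "w \<in> weyl \<Longrightarrow> w \<in> S_mat"
  unfolding weyl_def using n_S S_mult S_one by (elim insertE emptyE) simp_all

lemma torus_mat_S_TT:
  assumes "torus_mat s t \<in> S_mat" "s \<noteq> 0" "t \<noteq> 0"
  shows "torus_mat s t \<in> T_mat"
  using assms split_T by (auto simp: S_mat_def T_mat_def split_torus_eq)

lemma weyl_inverse: "w \<in> weyl \<Longrightarrow> \<exists>w'\<in>weyl. w ** w' = mat 1"
  unfolding weyl_def by (elim insertE emptyE) (simp_all add: group_simps)

text \<open>A Weyl conjugate of a torus element of the mixed group is again a torus element of the
  mixed group, and \<open>T\<close> contains all of these.\<close>

lemma TT_weyl:
  assumes "w \<in> weyl" "torus_mat s t \<in> S_mat" "s \<noteq> 0" "t \<noteq> 0" "preserves s t"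
  shows "\<exists>h\<in>T_mat. w ** torus_mat s t = h ** w"
proof -
  obtain s' t' where st: "s' \<noteq> 0" "t' \<noteq> 0" "w ** torus_mat s t = torus_mat s' t' ** w"
    using weyl_torus_mat[OF assms(1,3-5)] by blast
  obtain w' where w': "w' \<in> weyl" "w ** w' = mat 1" using weyl_inverse[OF assms(1)] by blast
  have "torus_mat s' t' = w ** torus_mat s t ** w'"
    using w'(2) by (simp add: st(3) matrix_mul_assoc[symmetric])
  then have "torus_mat s' t' \<in> S_mat" using assms(1,2) w'(1) weyl_S S_mult by simp
  then have "torus_mat s' t' \<in> T_mat" using st(1,2) by (rule torus_mat_S_TT)
  with st(3) show ?thesis by blast
qed

lemma torus_a_S: "c \<in> K0 \<Longrightarrow> c \<noteq> 0 \<Longrightarrow> torus_mat (inverse c) c \<in> S_mat"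
proof -
  assume c: "c \<in> K0" "c \<noteq> 0"
  \<comment> \<open>This is \<open>rank_one_a\<close> solved for its torus factor.\<close>
  have "torus_mat (inverse c) c = xa (inverse c) ** (na ** xa c ** na) ** xa (inverse c) ** na"
    unfolding rank_one_a[OF c(2)] using c(2) by (simp add: group_simps)
  then show ?thesis using c inverse_K0 by (simp add: S_mult n_S root_mat_S_simps)
qed

lemma torus_b_S: "c \<in> L0 \<Longrightarrow> c \<noteq> 0 \<Longrightarrow> torus_mat 1 (inverse c) \<in> S_mat"
proof -
  assume c: "c \<in> L0" "c \<noteq> 0"
  have "torus_mat 1 (inverse c) = xb (inverse c) ** (nb ** xb c ** nb) ** xb (inverse c) ** nb"
    unfolding rank_one_b[OF c(2)] using c(2) by (simp add: group_simps)
  then show ?thesis using c inverse_L0 by (simp add: S_mult n_S root_mat_S_simps)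
qed

section \<open>The group G as a group of matrices\<close>

definition G_mat :: "('k^4^4) set" where
  "G_mat = {t ** s | t s. t \<in> T_mat \<and> s \<in> S_mat}"

lemma GG_mult: "A \<in> G_mat \<Longrightarrow> B \<in> G_mat \<Longrightarrow> A ** B \<in> G_mat"
proof -
  assume "A \<in> G_mat" "B \<in> G_mat"
  then obtain t s t' s' where *: "A = t ** s" "B = t' ** s'" "t \<in> T_mat" "s \<in> S_mat" "t' \<in> T_mat" "s' \<in> S_mat"
    by (auto simp: G_mat_def)
  obtain C where C: "C \<in> S_mat" "s ** t' = t' ** C" using TT_normalizes(2)[OF *(5,4)] by blast
  have "A ** B = (t ** t') ** (C ** s')"
    unfolding *(1,2) using C(2) by (metis matrix_mul_assoc)
  then show ?thesis unfolding G_mat_def using TT_mult[OF *(3,5)] S_mult[OF C(1) *(6)] by blast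
qed

lemma S_GG: "A \<in> S_mat \<Longrightarrow> A \<in> G_mat" and TT_GG: "A \<in> T_mat \<Longrightarrow> A \<in> G_mat"
  unfolding G_mat_def using S_one TT_one by (force, force)

lemma GG_Sp4: "A \<in> G_mat \<Longrightarrow> A \<in> carrier Sp4"
  by (auto simp: G_mat_def S_mat_def T_mat_def Sp4_mult)

lemma GG_cells: "G_mat \<subseteq> cells T_mat"
proof
  fix A assume "A \<in> G_mat"
  then obtain t s where *: "A = t ** s" "t \<in> T_mat" "s \<in> S_mat" by (auto simp: G_mat_def)
  \<comment> \<open>Only the factor from the mixed group needs the closure argument;
    \<open>t\<close> is absorbed into the torus factor on the left.\<close>
  have "mat 1 ** s \<in> cells T_mat"
  proof (rule cells_mult_S[OF _ _ *(3) one_cells[OF TT_one]])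
    show "m ** na \<in> cells T_mat" if "m \<in> cells T_mat" for m
      by (rule cells_mult_na[OF TT_torus TT_mult _ that])
        (auto intro!: TT_weyl preserves_a torus_a_S)
    show "m ** nb \<in> cells T_mat" if "m \<in> cells T_mat" for m
      by (rule cells_mult_nb[OF TT_torus TT_mult _ that])
        (auto intro!: TT_weyl preserves_b torus_b_S)
  qed
  then obtain h u w u' where "s = h ** u ** w ** u'" "h \<in> T_mat" "u \<in> unip" "w \<in> weyl" "u' \<in> unip"
    by (auto simp: cells_def)
  then have "A = (t ** h) ** u ** w ** u'" "t ** h \<in> T_mat" using * TT_mult by (simp_all add: matrix_mul_assoc)
  then show "A \<in> cells T_mat" unfolding cells_def using \<open>u \<in> unip\<close> \<open>w \<in> weyl\<close> \<open>u' \<in> unip\<close> by blast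
qed

lemma GG_U4: "U4 a b c d \<in> G_mat \<longleftrightarrow> a \<in> K0 \<and> b \<in> L0 \<and> c \<in> K0 \<and> d \<in> L0"
  using U4_cells[OF TT_torus] GG_cells S_GG U4_S by blast

lemma GG_torus_mat: "torus_mat s t \<in> G_mat \<Longrightarrow> torus_mat s t \<in> T_mat"
  using torus_mat_cells[OF TT_torus] GG_cells by blast

lemma set_roots: "set roots \<subseteq> short_roots \<union> long_roots"
  by (auto simp: roots_def unip_roots_def weyl_roots_def short_roots_def long_roots_def)

lemma word_S:
  "set \<gamma>s \<subseteq> short_roots \<union> long_roots \<Longrightarrow> as \<in> params \<gamma>s \<Longrightarrow> word \<gamma>s as \<in> S_mat"
  by (induction \<gamma>s arbitrary: as)
    (auto simp: params_def list_all2_Cons2 S_one intro!: S_mult root_mat_S)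

lemma GG_word: "G_mat = {h ** word roots as | h as. h \<in> T_mat \<and> as \<in> params roots}"
  using GG_cells cells_word word_S[OF set_roots] by (force simp: G_mat_def)

lemma T_theta: "T = theta ` T_mat"
  using theta_surj subgroup.mem_carrier[OF subgroup_T] by (force simp: T_mat_def)

lemma theta_GG: "T <#>\<^bsub>PSp4\<^esub> PSp4_mixed g L0 K0 = theta ` G_mat"
proof -
  have S_mat: "PSp4_mixed g L0 K0 = theta ` S_mat"
    using theta_surj subgroup.mem_carrier[OF subgroup_mixed] by (force simp: S_mat_def)
  have G_mat: "G_mat = (\<lambda>p. fst p ** snd p) ` (T_mat \<times> S_mat)"
    by (fastforce simp: G_mat_def image_iff)
  have "(\<Union>x\<in>T_mat. \<Union>y\<in>S_mat. {theta x \<otimes>\<^bsub>PSp4\<^esub> theta y}) =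
      (\<lambda>p. theta (fst p) \<otimes>\<^bsub>PSp4\<^esub> theta (snd p)) ` (T_mat \<times> S_mat)"
    by (simp add: set_eq_iff image_iff)
  then have "theta ` T_mat <#>\<^bsub>PSp4\<^esub> theta ` S_mat = (\<lambda>p. theta (fst p) \<otimes>\<^bsub>PSp4\<^esub> theta (snd p)) ` (T_mat \<times> S_mat)"
    unfolding set_mult_def by (simp only: image_image)
  also have "\<dots> = theta ` G_mat"
    unfolding G_mat image_image by (rule image_cong) (auto simp: theta_mult T_mat_def S_mat_def)
  finally show ?thesis using arg_cong2[OF T_theta S_mat, of "set_mult PSp4"] by (rule trans[rotated])
qed

end

subsection \<open>Interpreting the structure in the group\<close>

lemma (in nonempty_sorts) definable_term_fun:
  assumes t: "definable_term S s t" and u: "definable_term S s' u"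
    and F: "\<And>x y. x \<in> Sort M s \<Longrightarrow> y \<in> Sort M s' \<Longrightarrow> F x y \<in> Sort M s''"
    and r: "\<And>x y z. x \<in> Sort M s \<Longrightarrow> y \<in> Sort M s' \<Longrightarrow> z \<in> Sort M s'' \<Longrightarrow>
      [x, y, z] \<in> Interp M r \<longleftrightarrow> z = F x y"
  shows "definable_term S s'' (\<lambda>v. F (t v) (u v))"
  unfolding definable_term_def
proof
  show "\<forall>v\<in>envs M S. F (t v) (u v) \<in> Sort M s''"
    using t u F by (auto simp: definable_term_def)
  have "definable_pred M (case_nat s'' S)
      (\<lambda>v. [t (\<lambda>i. v (Suc i)), u (\<lambda>i. v (Suc i)), v 0] \<in> Interp M r)"
  proof (rule definable_pred_subst3[where P = "\<lambda>x y z. [x, y, z] \<in> Interp M r"])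
    show "definable_term (case_nat s'' S) s (\<lambda>v. t (\<lambda>i. v (Suc i)))" by (rule definable_term_shift[OF t])
    show "definable_term (case_nat s'' S) s' (\<lambda>v. u (\<lambda>i. v (Suc i)))" by (rule definable_term_shift[OF u])
    show "definable_term (case_nat s'' S) s'' (\<lambda>v. v 0)" by (rule definable_term_var) simp
    show "definable_pred M (case_nat s'' (case_nat s' (case_nat s (case_nat s'' S))))
        (\<lambda>v. [v 2, v 1, v 0] \<in> Interp M r)"
      using definable_pred_rel[of _ "[2, 1, 0]"] by simp
  qed
  then show "definable_pred M (case_nat s'' S) (\<lambda>v. v 0 = F (t (\<lambda>i. v (Suc i))) (u (\<lambda>i. v (Suc i))))"
    by (rule definable_pred_cong) (use t u r in \<open>auto simp: definable_term_def\<close>)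
qed

lemma unit_env: "(S :: nat \<Rightarrow> unit) = (\<lambda>_. ())"
  by auto

context mixed_group
begin

abbreviation GS :: "(unit, unit, ('k^4^4) set) struct" where
  "GS \<equiv> group_struct (PSp4\<lparr>carrier := theta ` G_mat\<rparr>)"

lemma GS_simps [simp]:
  "Sort GS u = theta ` G_mat" "Profile GS u = [(), (), ()]"
  "[x, y, z] \<in> Interp GS u \<longleftrightarrow> x \<in> theta ` G_mat \<and> y \<in> theta ` G_mat \<and> z = x \<otimes>\<^bsub>PSp4\<^esub> y"
  by (auto simp: group_struct_def)

lemma GG_one: "mat 1 \<in> G_mat"
  by (rule S_GG[OF S_one])

sublocale GS: nonempty_sorts GS
  by unfold_locales (use GG_one in auto)

abbreviation defpred :: "((nat \<Rightarrow> ('k^4^4) set) \<Rightarrow> bool) \<Rightarrow> bool" where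
  "defpred \<equiv> definable_pred GS (\<lambda>_. ())"

abbreviation defterm :: "((nat \<Rightarrow> ('k^4^4) set) \<Rightarrow> ('k^4^4) set) \<Rightarrow> bool" where
  "defterm \<equiv> GS.definable_term (\<lambda>_. ()) ()"

lemma theta_mult_GG: "A \<in> G_mat \<Longrightarrow> B \<in> G_mat \<Longrightarrow> theta A \<otimes>\<^bsub>PSp4\<^esub> theta B = theta (A ** B)"
  by (simp add: theta_mult GG_Sp4)

lemma theta_inject_GG [simp]: "A \<in> G_mat \<Longrightarrow> B \<in> G_mat \<Longrightarrow> theta A = theta B \<longleftrightarrow> A = B"
  by (simp add: theta_inject GG_Sp4)

lemma theta_mem_GG: "A \<in> G_mat \<Longrightarrow> X \<subseteq> G_mat \<Longrightarrow> theta A \<in> theta ` X \<longleftrightarrow> A \<in> X"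
  using theta_inject_GG by blast

lemma defterm_var: "defterm (\<lambda>v. v i)"
  by (rule GS.definable_term_var) simp

lemma defterm_const: "A \<in> G_mat \<Longrightarrow> defterm (\<lambda>v. theta A)"
  by (rule GS.definable_term_const) simp

lemma theta_GG_closed:
  assumes "x \<in> theta ` G_mat" "y \<in> theta ` G_mat"
  shows "x \<otimes>\<^bsub>PSp4\<^esub> y \<in> theta ` G_mat"
proof -
  obtain A B where "A \<in> G_mat" "x = theta A" "B \<in> G_mat" "y = theta B" using assms by blast
  then show ?thesis using GG_mult[of A B] by (simp add: theta_mult_GG)
qed

lemma defterm_mult: "defterm t \<Longrightarrow> defterm u \<Longrightarrow> defterm (\<lambda>v. t v \<otimes>\<^bsub>PSp4\<^esub> u v)"
  by (rule GS.definable_term_fun[where s = "()" and s' = "()" and r = "()" and F = "(\<otimes>\<^bsub>PSp4\<^esub>)"])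
    (simp_all add: theta_GG_closed)

section \<open>Definable subsets of the group\<close>

definition defset :: "('k^4^4) set set \<Rightarrow> bool" where
  "defset U \<longleftrightarrow> U \<subseteq> theta ` G_mat \<and> defpred (\<lambda>v. v 0 \<in> U)"

lemma defpred_mem: "defset U \<Longrightarrow> defterm t \<Longrightarrow> defpred (\<lambda>v. t v \<in> U)"
  by (rule GS.definable_pred_subst[where P = "\<lambda>v x. x \<in> U" and s = "()"])
    (simp_all add: defset_def unit_env[of "case_nat _ _"])

lemma defpred_bex:
  assumes "defset U" "defpred (\<lambda>v. P (\<lambda>i. v (Suc i)) (v 0))"
  shows "defpred (\<lambda>v. \<exists>x\<in>U. P v x)"
proof -
  have "defpred (\<lambda>v. v 0 \<in> U \<and> P (\<lambda>i. v (Suc i)) (v 0))"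
    using assms by (intro definable_pred_conj) (simp_all add: defset_def)
  then have "defpred (\<lambda>v. \<exists>x\<in>Sort GS (). x \<in> U \<and> P v x)"
    by (intro definable_pred_ex[where P = "\<lambda>v x. x \<in> U \<and> P v x"]) (simp add: unit_env[of "case_nat _ _"])
  moreover have "(\<exists>x\<in>Sort GS (). x \<in> U \<and> P v x) \<longleftrightarrow> (\<exists>x\<in>U. P v x)" for v
    using assms(1) by (auto simp: defset_def)
  ultimately show ?thesis by simp
qed

lemma defpred_eq: "defterm t \<Longrightarrow> defterm u \<Longrightarrow> defpred (\<lambda>v. t v = u v)"
  by (rule GS.definable_pred_eq)

lemmas defpred_intros =
  definable_pred_conj GS.definable_pred_disj defpred_eq defpred_mem
  defterm_var defterm_const defterm_mult

lemma defsetI: "U \<subseteq> theta ` G_mat \<Longrightarrow> defpred P \<Longrightarrow> (\<And>v. v 0 \<in> theta ` G_mat \<Longrightarrow> v 0 \<in> U \<longleftrightarrow> P v) \<Longrightarrow> defset U"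
  unfolding defset_def by (auto elim!: definable_pred_cong simp: envs_def)

lemma defset_centralizer:
  assumes "C1 \<in> G_mat" "C2 \<in> G_mat" "C3 \<in> G_mat"
  shows "defset (theta ` {A \<in> G_mat. A ** C1 = C1 ** A \<and> A ** C2 = C2 ** A \<and> A ** C3 = C3 ** A})"
proof (rule defsetI)
  show "defpred (\<lambda>v. v 0 \<otimes>\<^bsub>PSp4\<^esub> theta C1 = theta C1 \<otimes>\<^bsub>PSp4\<^esub> v 0 \<and>
      v 0 \<otimes>\<^bsub>PSp4\<^esub> theta C2 = theta C2 \<otimes>\<^bsub>PSp4\<^esub> v 0 \<and> v 0 \<otimes>\<^bsub>PSp4\<^esub> theta C3 = theta C3 \<otimes>\<^bsub>PSp4\<^esub> v 0)"
    by (intro defpred_intros assms)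
  show "v 0 \<in> theta ` {A \<in> G_mat. A ** C1 = C1 ** A \<and> A ** C2 = C2 ** A \<and> A ** C3 = C3 ** A} \<longleftrightarrow>
     v 0 \<otimes>\<^bsub>PSp4\<^esub> theta C1 = theta C1 \<otimes>\<^bsub>PSp4\<^esub> v 0 \<and>
      v 0 \<otimes>\<^bsub>PSp4\<^esub> theta C2 = theta C2 \<otimes>\<^bsub>PSp4\<^esub> v 0 \<and> v 0 \<otimes>\<^bsub>PSp4\<^esub> theta C3 = theta C3 \<otimes>\<^bsub>PSp4\<^esub> v 0"
    if v0: "v 0 \<in> theta ` G_mat" for v :: "nat \<Rightarrow> _"
  proof -
    obtain A where A: "A \<in> G_mat" "v 0 = theta A" using v0 by blast
    show ?thesis
      unfolding A(2) using A(1) assms by (subst theta_mem_GG) (auto simp: theta_mult_GG GG_mult)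
  qed
qed auto

lemma defset_conj:
  assumes "defset (theta ` X)" "X \<subseteq> G_mat" "n \<in> G_mat" "n ** n = mat 1"
  shows "defset (theta ` (\<lambda>A. n ** A ** n) ` X)"
proof (rule defsetI)
  have n: "n ** (n ** A ** n) ** n = A" for A
  proof -
    have "n ** (n ** A ** n) ** n = (n ** n) ** A ** (n ** n)" by (simp only: matrix_mul_assoc)
    then show ?thesis by (simp add: assms(4))
  qed
  have sub: "(\<lambda>A. n ** A ** n) ` X \<subseteq> G_mat" using assms(2,3) GG_mult by blast
  then show "theta ` (\<lambda>A. n ** A ** n) ` X \<subseteq> theta ` G_mat" by (rule image_mono)
  show "defpred (\<lambda>v. theta n \<otimes>\<^bsub>PSp4\<^esub> v 0 \<otimes>\<^bsub>PSp4\<^esub> theta n \<in> theta ` X)"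
    by (intro defpred_intros assms)
  show "v 0 \<in> theta ` (\<lambda>A. n ** A ** n) ` X \<longleftrightarrow> theta n \<otimes>\<^bsub>PSp4\<^esub> v 0 \<otimes>\<^bsub>PSp4\<^esub> theta n \<in> theta ` X"
    if v0: "v 0 \<in> theta ` G_mat" for v :: "nat \<Rightarrow> _"
  proof -
    obtain A where A: "A \<in> G_mat" "v 0 = theta A" using v0 by blast
    have "A \<in> (\<lambda>A. n ** A ** n) ` X \<longleftrightarrow> n ** A ** n \<in> X"
    proof
      assume "A \<in> (\<lambda>A. n ** A ** n) ` X"
      then obtain B where "B \<in> X" "A = n ** B ** n" by blast
      then show "n ** A ** n \<in> X" using n[of B] by simp
    next
      assume "n ** A ** n \<in> X"
      then have "n ** (n ** A ** n) ** n \<in> (\<lambda>A. n ** A ** n) ` X" by (rule imageI)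
      then show "A \<in> (\<lambda>A. n ** A ** n) ` X" using n[of A] by simp
    qed
    then show ?thesis
      unfolding A(2) using A(1) assms(2,3) sub by (simp add: theta_mult_GG GG_mult theta_mem_GG)
  qed
qed

section \<open>Root groups and the torus as definable subsets\<close>

definition rootgp :: "int \<times> int \<Rightarrow> ('k^4^4) set" where
  "rootgp \<gamma> = root_mat \<gamma> ` param \<gamma>"

lemma root_mat_GG:
  "a \<in> K0 \<Longrightarrow> root_mat (1, -1) a \<in> G_mat" "a \<in> K0 \<Longrightarrow> root_mat (-1, 1) a \<in> G_mat"
  "a \<in> K0 \<Longrightarrow> root_mat (1, 1) a \<in> G_mat" "a \<in> K0 \<Longrightarrow> root_mat (-1, -1) a \<in> G_mat"
  "a \<in> L0 \<Longrightarrow> root_mat (2, 0) a \<in> G_mat" "a \<in> L0 \<Longrightarrow> root_mat (-2, 0) a \<in> G_mat"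
  "a \<in> L0 \<Longrightarrow> root_mat (0, 2) a \<in> G_mat" "a \<in> L0 \<Longrightarrow> root_mat (0, -2) a \<in> G_mat"
  by (rule S_GG, rule root_mat_S_simps, assumption)+

lemma n_GG: "na \<in> G_mat" "nb \<in> G_mat"
  by (rule S_GG, rule n_S)+

lemma rootgp_GG:
  "rootgp (1, -1) \<subseteq> G_mat" "rootgp (-1, 1) \<subseteq> G_mat" "rootgp (1, 1) \<subseteq> G_mat"
  "rootgp (2, 0) \<subseteq> G_mat" "rootgp (-2, 0) \<subseteq> G_mat" "rootgp (0, 2) \<subseteq> G_mat" "rootgp (0, -2) \<subseteq> G_mat"
  by (auto simp: rootgp_def root_mat_GG)

text \<open>Within the full symplectic group the centralizer gives the root group over the whole
  field; intersecting with G cuts the parameter down to \<open>L0\<close> by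
  \<open>GG_U4\<close>.\<close>

lemma defset_rootgp_20: "defset (theta ` rootgp (2, 0))"
proof -
  let ?C = "{A \<in> G_mat. A ** xb 1 = xb 1 ** A \<and> A ** root_mat (0, -2) 1 = root_mat (0, -2) 1 ** A \<and>
    A ** root_mat (2, 0) 1 = root_mat (2, 0) 1 ** A}"
  have "?C = rootgp (2, 0)"
  proof
    show "?C \<subseteq> rootgp (2, 0)"
    proof
      fix A assume A: "A \<in> ?C"
      then obtain d where d: "A = U4 0 0 0 d" using long_root_centralizer[of A] GG_Sp4[of A] by blast
      then have "d \<in> L0" using A GG_U4[of 0 0 0 d] by simp
      then show "A \<in> rootgp (2, 0)" by (simp add: d rootgp_def root_mat_U4)
    qed
    show "rootgp (2, 0) \<subseteq> ?C"
      using rootgp_GG(4) by (auto simp: rootgp_def root_mat_mat4 mat4_mult mat4_eq_iff ac_simps)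
  qed
  then show ?thesis
    using defset_centralizer[OF root_mat_GG(7,8,5), of 1 1 1] by simp
qed

text \<open>This needs characteristic 2: adding \<alpha> or -\<alpha> to \<alpha> + \<beta> gives a
  root, but the commutators carry the constant 2. So the root group for \<alpha> + \<beta> commutes
  with those for \<alpha> and -\<alpha>, as in the long case.\<close>

lemma defset_rootgp_11: "defset (theta ` rootgp (1, 1))"
proof -
  let ?C = "{A \<in> G_mat. A ** xa 1 = xa 1 ** A \<and> A ** root_mat (-1, 1) 1 = root_mat (-1, 1) 1 ** A \<and>
    A ** root_mat (1, 1) 1 = root_mat (1, 1) 1 ** A}"
  have "?C = rootgp (1, 1)"
  proof
    show "?C \<subseteq> rootgp (1, 1)"
    proof
      fix A assume A: "A \<in> ?C"
      then obtain d where d: "A = U4 0 0 d 0" using short_root_centralizer[of A] GG_Sp4[of A] by blast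
      then have "d \<in> K0" using A GG_U4[of 0 0 d 0] by simp
      then show "A \<in> rootgp (1, 1)" by (simp add: d rootgp_def root_mat_U4)
    qed
    show "rootgp (1, 1) \<subseteq> ?C"
      using rootgp_GG(3) by (auto simp: rootgp_def root_mat_mat4 mat4_mult mat4_eq_iff ac_simps)
  qed
  then show ?thesis
    using defset_centralizer[OF root_mat_GG(1,2,3), of 1 1 1] by simp
qed

lemma rootgp_conj:
  "rootgp (1, -1) = (\<lambda>A. nb ** A ** nb) ` rootgp (1, 1)"
  "rootgp (-1, 1) = (\<lambda>A. na ** A ** na) ` rootgp (1, -1)"
  "rootgp (0, 2) = (\<lambda>A. na ** A ** na) ` rootgp (2, 0)"
  "rootgp (0, -2) = (\<lambda>A. nb ** A ** nb) ` rootgp (0, 2)"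
  "rootgp (-2, 0) = (\<lambda>A. na ** A ** na) ` rootgp (0, -2)"
  unfolding rootgp_def image_image
  by (rule image_cong; simp add: group_simps)+

lemma defset_rootgp:
  "defset (theta ` rootgp (1, -1))" "defset (theta ` rootgp (-1, 1))"
  "defset (theta ` rootgp (0, 2))" "defset (theta ` rootgp (0, -2))" "defset (theta ` rootgp (-2, 0))"
proof -
  show 1: "defset (theta ` rootgp (1, -1))"
    using defset_conj[OF defset_rootgp_11 rootgp_GG(3) n_GG(2)] by (simp add: rootgp_conj(1))
  show "defset (theta ` rootgp (-1, 1))"
    using defset_conj[OF 1 rootgp_GG(1) n_GG(1)] by (simp add: rootgp_conj(2))
  show 2: "defset (theta ` rootgp (0, 2))"
    using defset_conj[OF defset_rootgp_20 rootgp_GG(4) n_GG(1)] by (simp add: rootgp_conj(3))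
  show 3: "defset (theta ` rootgp (0, -2))"
    using defset_conj[OF 2 rootgp_GG(6) n_GG(2)] by (simp add: rootgp_conj(4))
  show "defset (theta ` rootgp (-2, 0))"
    using defset_conj[OF 3 rootgp_GG(7) n_GG(1)] by (simp add: rootgp_conj(5))
qed

text \<open>Testing parameter 1 is enough. A torus element sends it to a square, which is in
  \<open>L0\<close>. Conversely the four equations kill all entries off the diagonal, the symplectic
  condition pairs the diagonal entries as inverses, and \<open>GG_torus_mat\<close> places the
  resulting torus matrix in \<open>T_mat\<close>.\<close>

lemma TT_iff:
  assumes "A \<in> G_mat"
  shows "A \<in> T_mat \<longleftrightarrow> (\<forall>\<gamma>\<in>long_roots. \<exists>B\<in>rootgp \<gamma>. A ** root_mat \<gamma> 1 = B ** A)"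
proof
  assume "A \<in> T_mat"
  then obtain s t where st: "A = torus_mat s t" "s \<noteq> 0" "t \<noteq> 0" by (rule TT_torus_mat)
  have eqs: "torus_mat s t ** root_mat (2, 0) 1 = root_mat (2, 0) (s\<^sup>2) ** torus_mat s t"
    "torus_mat s t ** root_mat (-2, 0) 1 = root_mat (-2, 0) ((inverse s)\<^sup>2) ** torus_mat s t"
    "torus_mat s t ** root_mat (0, 2) 1 = root_mat (0, 2) (t\<^sup>2) ** torus_mat s t"
    "torus_mat s t ** root_mat (0, -2) 1 = root_mat (0, -2) ((inverse t)\<^sup>2) ** torus_mat s t"
    using st by (simp_all add: group_simps field_simps power2_eq_square)
  have mem: "root_mat \<gamma> (c\<^sup>2) \<in> rootgp \<gamma>" if "\<gamma> \<in> long_roots" for \<gamma> c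
    using that by (simp add: rootgp_def param_long)
  show "\<forall>\<gamma>\<in>long_roots. \<exists>B\<in>rootgp \<gamma>. A ** root_mat \<gamma> 1 = B ** A"
  proof
    fix \<gamma> :: "int \<times> int" assume \<gamma>: "\<gamma> \<in> long_roots"
    then have "\<exists>c. torus_mat s t ** root_mat \<gamma> 1 = root_mat \<gamma> (c\<^sup>2) ** torus_mat s t"
      unfolding long_roots_def using eqs by (elim insertE emptyE) blast+
    with mem[OF \<gamma>] show "\<exists>B\<in>rootgp \<gamma>. A ** root_mat \<gamma> 1 = B ** A" unfolding st(1) by blast
  qed
next
  assume R: "\<forall>\<gamma>\<in>long_roots. \<exists>B\<in>rootgp \<gamma>. A ** root_mat \<gamma> 1 = B ** A"
  obtain p q r s where eqs:
    "A ** root_mat (2, 0) 1 = root_mat (2, 0) p ** A" "A ** root_mat (-2, 0) 1 = root_mat (-2, 0) q ** A"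
    "A ** root_mat (0, 2) 1 = root_mat (0, 2) r ** A" "A ** root_mat (0, -2) 1 = root_mat (0, -2) s ** A"
    using R by (auto simp: long_roots_def rootgp_def)
  obtain a11 a12 a13 a14 a21 a22 a23 a24 a31 a32 a33 a34 a41 a42 a43 a44 where
    A: "A = mat4 a11 a12 a13 a14 a21 a22 a23 a24 a31 a32 a33 a34 a41 a42 a43 a44"
    using eq_mat4 by blast
  have z: "a12 = 0" "a13 = 0" "a14 = 0" "a21 = 0" "a23 = 0" "a24 = 0" "a31 = 0" "a32 = 0" "a34 = 0"
    "a41 = 0" "a42 = 0" "a43 = 0"
    using eqs unfolding A root_mat_mat4 mat4_mult mat4_eq_iff by auto
  have "a11 * a44 = 1" "a22 * a33 = 1"
    using GG_Sp4[OF assms] unfolding A z by (auto simp: group_simps Sp4_iff)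
  then have "a44 = inverse a11" "a33 = inverse a22" by (simp_all add: inverse_unique)
  then have "A = torus_mat a11 a22" unfolding A z by (simp add: torus_mat_mat4)
  then show "A \<in> T_mat" using assms GG_torus_mat by simp
qed

lemma TT_subset: "T_mat \<subseteq> G_mat"
  using TT_GG by blast

lemma defset_T: "defset (theta ` T_mat)"
proof (rule defsetI)
  show "theta ` T_mat \<subseteq> theta ` G_mat" using TT_subset by blast
  have long: "defset (theta ` rootgp \<gamma>)" "root_mat \<gamma> 1 \<in> G_mat" "rootgp \<gamma> \<subseteq> G_mat" if "\<gamma> \<in> long_roots" for \<gamma>
    using that defset_rootgp defset_rootgp_20 root_mat_GG rootgp_GG unfolding long_roots_def
    by (elim insertE emptyE; simp)+
  have "finite long_roots" by (simp add: long_roots_def)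
  then show "defpred (\<lambda>v. \<forall>\<gamma>\<in>long_roots. \<exists>y\<in>theta ` rootgp \<gamma>.
      v 0 \<otimes>\<^bsub>PSp4\<^esub> theta (root_mat \<gamma> 1) = y \<otimes>\<^bsub>PSp4\<^esub> v 0)"
    using long by (intro GS.definable_pred_ball_finite defpred_bex defpred_intros)
  show "v 0 \<in> theta ` T_mat \<longleftrightarrow> (\<forall>\<gamma>\<in>long_roots. \<exists>y\<in>theta ` rootgp \<gamma>.
      v 0 \<otimes>\<^bsub>PSp4\<^esub> theta (root_mat \<gamma> 1) = y \<otimes>\<^bsub>PSp4\<^esub> v 0)"
    if v0: "v 0 \<in> theta ` G_mat" for v :: "nat \<Rightarrow> _"
  proof -
    obtain A where A: "A \<in> G_mat" "v 0 = theta A" using v0 by blast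
    have "(\<exists>y\<in>theta ` rootgp \<gamma>. theta A \<otimes>\<^bsub>PSp4\<^esub> theta (root_mat \<gamma> 1) = y \<otimes>\<^bsub>PSp4\<^esub> theta A) \<longleftrightarrow>
        (\<exists>B\<in>rootgp \<gamma>. A ** root_mat \<gamma> 1 = B ** A)" if "\<gamma> \<in> long_roots" for \<gamma>
    proof -
      have "theta A \<otimes>\<^bsub>PSp4\<^esub> theta (root_mat \<gamma> 1) = theta B \<otimes>\<^bsub>PSp4\<^esub> theta A \<longleftrightarrow> A ** root_mat \<gamma> 1 = B ** A"
        if "B \<in> rootgp \<gamma>" for B
        using A(1) long(2,3)[OF \<open>\<gamma> \<in> long_roots\<close>] that
        by (simp add: theta_mult_GG GG_mult subset_iff)
      then show ?thesis by auto
    qed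
    then show ?thesis
      unfolding A(2) using TT_iff[OF A(1)] by (simp add: theta_mem_GG[OF A(1) TT_subset])
  qed
qed

end

section \<open>The long root group and \<mu> expressed by group equations\<close>

context mixed_group
begin

text \<open>Root elements are involutions, so the left side is the commutator of \<open>xa 1\<close>
  and \<open>xb b\<close>. Its coordinates along \<alpha> + \<beta> and 2\<alpha> + \<beta> are both
  b, and \<open>nb ** xa a ** nb\<close> is the root element for \<alpha> + \<beta> with parameter
  a.\<close>

lemma commutator_eq:
  "xa 1 ** xb b ** xa 1 ** xb b = nb ** xa a ** nb ** root_mat (2, 0) d \<longleftrightarrow> a = b \<and> d = b"
  unfolding group_simps by (auto simp: add_eq_0)

text \<open>For \<open>a \<noteq> 0\<close> the triple product has the form \<open>A ** na\<close>
  with \<open>A\<close> in the torus only if q is the inverse of a. Then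
  \<open>A = torus_mat a (inverse a)\<close>, whose character s / t is the square of a, so it scales
  the parameter of \<open>xa\<close> by this square. For \<open>a = 0\<close> no such
  \<open>A\<close> exists, which forces the separate clause.\<close>

lemma mu_iff:
  assumes "a \<in> K0" "b \<in> K0" "c \<in> K0"
  shows "c = a\<^sup>2 * b \<longleftrightarrow> a = 0 \<and> c = 0 \<or>
    (\<exists>q\<in>K0. \<exists>A\<in>T_mat. xa a ** root_mat (-1, 1) q ** xa a = A ** na \<and> xa c ** A = A ** xa b)"
proof
  assume c: "c = a\<^sup>2 * b"
  show "a = 0 \<and> c = 0 \<or>
    (\<exists>q\<in>K0. \<exists>A\<in>T_mat. xa a ** root_mat (-1, 1) q ** xa a = A ** na \<and> xa c ** A = A ** xa b)"
  proof (cases "a = 0")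
    case False
    have "torus_mat a (inverse a) \<in> S_mat" using torus_a_S[of "inverse a"] False assms(1) inverse_K0 by simp
    then have "torus_mat a (inverse a) \<in> T_mat" using False by (intro torus_mat_S_TT) auto
    moreover have "xa a ** root_mat (-1, 1) (inverse a) ** xa a = torus_mat a (inverse a) ** na"
      using False by (simp add: group_simps)
    moreover have "xa c ** torus_mat a (inverse a) = torus_mat a (inverse a) ** xa b"
      unfolding c using False by (simp add: group_simps power2_eq_square field_simps)
    ultimately show ?thesis using inverse_K0[OF assms(1)] by blast
  qed (simp add: c)
next
  assume "a = 0 \<and> c = 0 \<or>
    (\<exists>q\<in>K0. \<exists>A\<in>T_mat. xa a ** root_mat (-1, 1) q ** xa a = A ** na \<and> xa c ** A = A ** xa b)"
  then show "c = a\<^sup>2 * b"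
  proof (elim disjE bexE conjE)
    fix q A assume *: "A \<in> T_mat" "xa a ** root_mat (-1, 1) q ** xa a = A ** na" "xa c ** A = A ** xa b"
    obtain s t where A: "A = torus_mat s t" using *(1) by (rule TT_torus_mat)
    have 1: "1 + a * q = 0" and s: "a + (1 + a * q) * a = s" and t: "q = t" and 2: "c * t = s * b"
      using *(2,3) unfolding A by (auto simp: group_simps algebra_simps)
    from 1 s have "s = a" by simp
    from 1 t have "a * t = 1" using add_eq_0[of 1 "a * q"] by simp
    then have "c = a * (c * t)" by (metis mult.assoc mult.commute mult_1)
    then show ?thesis unfolding 2 \<open>s = a\<close> by (simp add: power2_eq_square mult.assoc)
  qed simp
qed

lemma definable1:
  assumes "defset X" "defpred (\<lambda>v. R (v 0))"
  shows "definable GS [()] {[x] | x. x \<in> X \<and> R x}"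
proof (rule GS.definableI[where S = "\<lambda>_. ()"])
  show "defpred (\<lambda>v. v 0 \<in> X \<and> R (v 0))"
    by (intro defpred_intros assms)
  show "{[x] | x. x \<in> X \<and> R x} \<subseteq> tuples GS [()]"
    using assms(1) by (auto simp: defset_def)
qed auto

lemma definable2:
  assumes "defset X" "defset Y" "defpred (\<lambda>v. R (v 0) (v 1))"
  shows "definable GS [(), ()] {[x, y] | x y. x \<in> X \<and> y \<in> Y \<and> R x y}"
proof (rule GS.definableI[where S = "\<lambda>_. ()"])
  show "defpred (\<lambda>v. v 0 \<in> X \<and> v 1 \<in> Y \<and> R (v 0) (v 1))"
    by (intro defpred_intros assms)
  show "{[x, y] | x y. x \<in> X \<and> y \<in> Y \<and> R x y} \<subseteq> tuples GS [(), ()]"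
    using assms(1,2) by (auto simp: defset_def mem_tuples)
qed (auto simp: upt_rec)

lemma definable3:
  assumes "defset X" "defset Y" "defset Z" "defpred (\<lambda>v. R (v 0) (v 1) (v 2))"
  shows "definable GS [(), (), ()] {[x, y, z] | x y z. x \<in> X \<and> y \<in> Y \<and> z \<in> Z \<and> R x y z}"
proof (rule GS.definableI[where S = "\<lambda>_. ()"])
  show "defpred (\<lambda>v. v 0 \<in> X \<and> v 1 \<in> Y \<and> v 2 \<in> Z \<and> R (v 0) (v 1) (v 2))"
    by (intro defpred_intros assms)
  show "{[x, y, z] | x y z. x \<in> X \<and> y \<in> Y \<and> z \<in> Z \<and> R x y z} \<subseteq> tuples GS [(), (), ()]"
    using assms(1-3) by (auto simp: defset_def mem_tuples)
qed (auto simp: upt_rec numeral_2_eq_2)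

abbreviation MS :: "(m_sort, m_rel, 'k + ('k^4^4) set) struct" where
  "MS \<equiv> M_struct g K0 L0 T"

definition code_set :: "m_sort \<Rightarrow> ('k^4^4) set set" where
  "code_set s = (case s of Field_Sort \<Rightarrow> theta ` rootgp (1, -1) | Torus_Sort \<Rightarrow> theta ` T_mat)"

definition decode :: "m_sort \<Rightarrow> ('k^4^4) set list \<Rightarrow> 'k + ('k^4^4) set" where
  "decode s xs = (case s of Field_Sort \<Rightarrow> Inl (THE a. hd xs = theta (xa a)) | Torus_Sort \<Rightarrow> Inr (hd xs))"

lemma decode_simps [simp]: "decode Field_Sort [theta (xa a)] = Inl a" "decode Torus_Sort [t] = Inr t"
proof -
  have "xa b \<in> carrier Sp4" for b
    by (rule root_mat_Sp4) (simp add: short_roots_def)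
  then have "theta (xa a) = theta (xa b) \<longleftrightarrow> xa a = xa b" for b by (simp add: theta_inject)
  then have "theta (xa a) = theta (xa b) \<longleftrightarrow> a = b" for b by (simp add: group_simps)
  then show "decode Field_Sort [theta (xa a)] = Inl a" by (simp add: decode_def)
qed (simp add: decode_def)

lemma code_set_Field: "x \<in> code_set Field_Sort \<longleftrightarrow> (\<exists>a\<in>K0. x = theta (xa a))"
  and code_set_Torus: "x \<in> code_set Torus_Sort \<longleftrightarrow> (\<exists>A\<in>T_mat. x = theta A)"
  by (auto simp: code_set_def rootgp_def)

lemma defset_code_set: "defset (code_set s)"
  by (cases s) (simp_all add: code_set_def defset_rootgp defset_T)

text \<open>Elements of \<open>L0\<close> are coded in the short root group like the rest of
  \<open>K0\<close>. This relation passes from the code to the long root element with the same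
  parameter; \<open>w\<close> absorbs the 2\<alpha> + \<beta> part of the commutator in
  \<open>commutator_eq\<close>.\<close>

definition link :: "('k^4^4) set \<Rightarrow> ('k^4^4) set \<Rightarrow> bool" where
  "link x y \<longleftrightarrow> (\<exists>w\<in>theta ` rootgp (2, 0).
     theta (xa 1) \<otimes>\<^bsub>PSp4\<^esub> y \<otimes>\<^bsub>PSp4\<^esub> theta (xa 1) \<otimes>\<^bsub>PSp4\<^esub> y = theta nb \<otimes>\<^bsub>PSp4\<^esub> x \<otimes>\<^bsub>PSp4\<^esub> theta nb \<otimes>\<^bsub>PSp4\<^esub> w)"

lemma link_iff:
  assumes "a \<in> K0" "b \<in> L0"
  shows "link (theta (xa a)) (theta (xb b)) \<longleftrightarrow> a = b"
proof -
  have "theta (xa 1) \<otimes>\<^bsub>PSp4\<^esub> theta (xb b) \<otimes>\<^bsub>PSp4\<^esub> theta (xa 1) \<otimes>\<^bsub>PSp4\<^esub> theta (xb b) =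
      theta nb \<otimes>\<^bsub>PSp4\<^esub> theta (xa a) \<otimes>\<^bsub>PSp4\<^esub> theta nb \<otimes>\<^bsub>PSp4\<^esub> theta (root_mat (2, 0) d) \<longleftrightarrow> a = b \<and> d = b"
    if "d \<in> L0" for d
    using assms that
    by (simp add: theta_mult_GG GG_mult root_mat_GG n_GG commutator_eq)
  then show ?thesis using assms by (auto simp: link_def rootgp_def)
qed

lemma defpred_link:
  assumes "defterm t" "defterm u"
  shows "defpred (\<lambda>v. link (t v) (u v))"
proof (rule GS.definable_pred_subst2[where P = link, OF assms])
  have "defpred (\<lambda>v. link (v 1) (v 0))"
    unfolding link_def using defset_rootgp_20 root_mat_GG(1)[of 1] n_GG
    by (intro defpred_bex defpred_intros) auto
  then show "definable_pred GS (case_nat () (case_nat () (\<lambda>_. ()))) (\<lambda>v. link (v 1) (v 0))"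
    by (simp only: unit_env[of "case_nat _ _"])
qed

lemma rel_set3:
  fixes D :: "'s \<Rightarrow> 'b list set"
  assumes "\<And>s. D s = {[x] | x. x \<in> E s}"
    and "\<And>x y z. x \<in> E s1 \<Longrightarrow> y \<in> E s2 \<Longrightarrow> z \<in> E s3 \<Longrightarrow> [f s1 [x], f s2 [y], f s3 [z]] \<in> I \<longleftrightarrow> R x y z"
  shows "{concat xs | xs. xs \<in> listset (map D [s1, s2, s3]) \<and> map2 f [s1, s2, s3] xs \<in> I} =
    {[x, y, z] | x y z. x \<in> E s1 \<and> y \<in> E s2 \<and> z \<in> E s3 \<and> R x y z}" (is "?L = ?R")
proof (intro subset_antisym subsetI)
  fix l assume "l \<in> ?L"
  then obtain x y z where "x \<in> E s1" "y \<in> E s2" "z \<in> E s3" "l = [x, y, z]"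
    "[f s1 [x], f s2 [y], f s3 [z]] \<in> I"
    by (auto simp: assms(1) set_Cons_def)
  then show "l \<in> ?R" using assms(2) by blast
next
  fix l assume "l \<in> ?R"
  then obtain x y z where *: "x \<in> E s1" "y \<in> E s2" "z \<in> E s3" "l = [x, y, z]"
    "[f s1 [x], f s2 [y], f s3 [z]] \<in> I" using assms(2) by blast
  then show "l \<in> ?L"
    by (intro CollectI exI[of _ "[[x], [y], [z]]"]) (auto simp: assms(1) set_Cons_def)
qed

lemma rel_set1:
  fixes D :: "'s \<Rightarrow> 'b list set"
  assumes "\<And>s. D s = {[x] | x. x \<in> E s}"
    and "\<And>x. x \<in> E s1 \<Longrightarrow> [f s1 [x]] \<in> I \<longleftrightarrow> R x"
  shows "{concat xs | xs. xs \<in> listset (map D [s1]) \<and> map2 f [s1] xs \<in> I} = {[x] | x. x \<in> E s1 \<and> R x}"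
    (is "?L = ?R")
proof (intro subset_antisym subsetI)
  fix l assume "l \<in> ?L"
  then obtain x where "x \<in> E s1" "l = [x]" "[f s1 [x]] \<in> I"
    by (auto simp: assms(1) set_Cons_def)
  then show "l \<in> ?R" using assms(2) by blast
next
  fix l assume "l \<in> ?R"
  then obtain x where *: "x \<in> E s1" "l = [x]" "[f s1 [x]] \<in> I" using assms(2) by blast
  then show "l \<in> ?L"
    by (intro CollectI exI[of _ "[[x]]"]) (auto simp: assms(1) set_Cons_def)
qed

lemma MS_interp:
  "[Inl a] \<in> Interp MS In_L0 \<longleftrightarrow> a \<in> L0"
  "[Inl a, Inl b, Inl c] \<in> Interp MS Add \<longleftrightarrow> a \<in> K0 \<and> b \<in> K0 \<and> c = a + b"
  "[Inl a, Inl b, Inl c] \<in> Interp MS Mu \<longleftrightarrow> a \<in> K0 \<and> b \<in> K0 \<and> c = a\<^sup>2 * b"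
  "[Inr t, Inr u, Inr w] \<in> Interp MS Torus_Mult \<longleftrightarrow> t \<in> T \<and> u \<in> T \<and> w = t \<otimes>\<^bsub>PSp4\<^esub> u"
  "[Inr t, Inl a, Inl b] \<in> Interp MS Act_K0 \<longleftrightarrow> t \<in> T \<and> a \<in> K0 \<and> b \<in> K0 \<and>
     conj_by PSp4 t (theta (xa a)) = theta (xa b)"
  "[Inr t, Inl a, Inl b] \<in> Interp MS Act_L0 \<longleftrightarrow> t \<in> T \<and> a \<in> L0 \<and> b \<in> L0 \<and>
     conj_by PSp4 t (theta (xb a)) = theta (xb b)"
  by (auto simp: M_struct_def root_elt_eq root_alpha_def root_beta_def)

lemma MS_act:
  assumes "A \<in> T_mat"
  shows "[Inr (theta A), Inl a, Inl b] \<in> Interp MS Act_K0 \<longleftrightarrow> a \<in> K0 \<and> b \<in> K0 \<and> A ** xa a = xa b ** A"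
    "[Inr (theta A), Inl a, Inl b] \<in> Interp MS Act_L0 \<longleftrightarrow> a \<in> L0 \<and> b \<in> L0 \<and> A ** xb a = xb b ** A"
proof -
  have A: "A \<in> carrier Sp4" "theta A \<in> T" using assms by (simp_all add: T_mat_def)
  show "[Inr (theta A), Inl a, Inl b] \<in> Interp MS Act_K0 \<longleftrightarrow> a \<in> K0 \<and> b \<in> K0 \<and> A ** xa a = xa b ** A"
    "[Inr (theta A), Inl a, Inl b] \<in> Interp MS Act_L0 \<longleftrightarrow> a \<in> L0 \<and> b \<in> L0 \<and> A ** xb a = xb b ** A"
    using A conj_by_theta_eq[OF A(1) root_mat_Sp4 root_mat_Sp4]
    by (simp_all add: MS_interp short_roots_def long_roots_def)
qed

lemma MS_profile:
  "Profile MS In_L0 = [Field_Sort]" "Profile MS Add = [Field_Sort, Field_Sort, Field_Sort]"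
  "Profile MS Mu = [Field_Sort, Field_Sort, Field_Sort]"
  "Profile MS Torus_Mult = [Torus_Sort, Torus_Sort, Torus_Sort]"
  "Profile MS Act_K0 = [Torus_Sort, Field_Sort, Field_Sort]"
  "Profile MS Act_L0 = [Torus_Sort, Field_Sort, Field_Sort]"
  "Sort MS Field_Sort = Inl ` K0" "Sort MS Torus_Sort = Inr ` T"
  by (simp_all add: M_struct_def)

lemma theta_xa_eq: "a \<in> K0 \<Longrightarrow> b \<in> K0 \<Longrightarrow> theta (xa a) = theta (xa b) \<longleftrightarrow> a = b"
  by (simp add: root_mat_GG) (simp add: group_simps)

lemma xa_add: "xa a ** xa b = xa (a + b)"
  by (simp add: group_simps ac_simps)

lemma decode_inject:
  "x \<in> code_set s \<Longrightarrow> y \<in> code_set s \<Longrightarrow> decode s [x] = decode s [y] \<longleftrightarrow> x = y"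
  by (cases s) (auto simp: code_set_Field)

lemma M_interpretable_in_G: "interpretable_in MS GS"
proof -
  define D where "D s = {[x] | x. x \<in> code_set s}" for s
  let ?\<sigma> = "\<lambda>_::m_sort. [()]"
  note bex = defpred_bex defset_rootgp defset_rootgp_20 defset_T
  have one: "theta (xa 0) = theta (mat 1)" by (simp add: group_simps)
  have sorts: "definable GS (?\<sigma> s) (D s) \<and> decode s ` D s = Sort MS s \<and>
      definable GS (?\<sigma> s @ ?\<sigma> s) {x @ y | x y. x \<in> D s \<and> y \<in> D s \<and> decode s x = decode s y}" for s
  proof (intro conjI)
    show "definable GS (?\<sigma> s) (D s)"
      unfolding D_def using definable1[OF defset_code_set GS.definable_pred_const[of _ True]] by simp
    show "decode s ` D s = Sort MS s"
    proof (cases s)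
      case Field_Sort
      have "D Field_Sort = (\<lambda>a. [theta (xa a)]) ` K0" by (auto simp: D_def code_set_Field)
      then show ?thesis unfolding Field_Sort by (simp add: image_image MS_profile)
    next
      case Torus_Sort
      have "D Torus_Sort = (\<lambda>t. [t]) ` (theta ` T_mat)" by (auto simp: D_def code_set_Torus)
      then show ?thesis unfolding Torus_Sort T_theta[symmetric] by (simp add: image_image MS_profile)
    qed
    have "{x @ y | x y. x \<in> D s \<and> y \<in> D s \<and> decode s x = decode s y} =
        {[x, y] | x y. x \<in> code_set s \<and> y \<in> code_set s \<and> x = y}" (is "?L = ?R")
    proof (intro subset_antisym subsetI)
      fix l assume "l \<in> ?L"
      then obtain x y where "x \<in> code_set s" "y \<in> code_set s" "decode s [x] = decode s [y]" "l = [x, y]"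
        by (auto simp: D_def)
      then show "l \<in> ?R" using decode_inject[of x s y] by auto
    next
      fix l assume "l \<in> ?R"
      then obtain x where "x \<in> code_set s" "l = [x, x]" by auto
      then show "l \<in> ?L" by (intro CollectI exI[of _ "[x]"]) (simp add: D_def)
    qed
    moreover have "definable GS [(), ()] {[x, y] | x y. x \<in> code_set s \<and> y \<in> code_set s \<and> x = y}"
      by (intro definable2 defset_code_set defpred_intros)
    ultimately show "definable GS (?\<sigma> s @ ?\<sigma> s) {x @ y | x y. x \<in> D s \<and> y \<in> D s \<and> decode s x = decode s y}"
      by simp
  qed
  have rel3: "definable GS (concat (map ?\<sigma> [s1, s2, s3]))
      {concat xs | xs. xs \<in> listset (map D [s1, s2, s3]) \<and> map2 decode [s1, s2, s3] xs \<in> I}"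
    if "\<And>x y z. x \<in> code_set s1 \<Longrightarrow> y \<in> code_set s2 \<Longrightarrow> z \<in> code_set s3 \<Longrightarrow>
        [decode s1 [x], decode s2 [y], decode s3 [z]] \<in> I \<longleftrightarrow> R x y z"
      and "defpred (\<lambda>v. R (v 0) (v 1) (v 2))" for s1 s2 s3 I R
  proof -
    have "definable GS [(), (), ()] {[x, y, z] | x y z.
        x \<in> code_set s1 \<and> y \<in> code_set s2 \<and> z \<in> code_set s3 \<and> R x y z}"
      by (rule definable3[OF defset_code_set defset_code_set defset_code_set that(2)])
    moreover have "concat (map ?\<sigma> [s1, s2, s3]) = [(), (), ()]" by simp
    ultimately show ?thesis by (simp only: rel_set3[where f = decode and I = I and R = R, OF D_def that(1)])
  qed
  have "definable GS (concat (map ?\<sigma> (Profile MS r)))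
      {concat xs | xs. xs \<in> listset (map D (Profile MS r)) \<and> map2 decode (Profile MS r) xs \<in> Interp MS r}" for r
  proof (cases r)
    case In_L0
    \<comment> \<open>An element of \<open>K0\<close> is in \<open>L0\<close> iff its code is linked
      to an element of the long root group for \<beta>.\<close>
    define R where "R x \<longleftrightarrow> (\<exists>y\<in>theta ` rootgp (0, 2). link x y)" for x
    have "[decode Field_Sort [x]] \<in> Interp MS In_L0 \<longleftrightarrow> R x" if x: "x \<in> code_set Field_Sort" for x
    proof -
      obtain a where a: "a \<in> K0" "x = theta (xa a)" using x by (auto simp: code_set_Field)
      have "R x \<longleftrightarrow> (\<exists>b\<in>L0. a = b)"
        unfolding R_def a(2) using link_iff[OF a(1)] by (simp add: rootgp_def)
      then show ?thesis by (auto simp: a(2) MS_interp)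
    qed
    then have "{concat xs | xs. xs \<in> listset (map D [Field_Sort]) \<and> map2 decode [Field_Sort] xs \<in> Interp MS In_L0}
      = {[x] | x. x \<in> code_set Field_Sort \<and> R x}"
      by (rule rel_set1[OF D_def])
    moreover have "definable GS [()] {[x] | x. x \<in> code_set Field_Sort \<and> R x}"
      unfolding R_def by (intro definable1 defset_code_set bex defpred_link defterm_var)
    moreover have "concat (map ?\<sigma> [Field_Sort]) = [()]" by simp
    ultimately show ?thesis unfolding In_L0 MS_profile by (simp only:)
  next
    case Add
    show ?thesis unfolding Add MS_profile
    proof (rule rel3[where R = "\<lambda>x y z. z = x \<otimes>\<^bsub>PSp4\<^esub> y"])
      show "defpred (\<lambda>v. v 2 = v 0 \<otimes>\<^bsub>PSp4\<^esub> v 1)" by (intro defpred_intros)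
      fix x y z assume "x \<in> code_set Field_Sort" "y \<in> code_set Field_Sort" "z \<in> code_set Field_Sort"
      then obtain a b c where "a \<in> K0" "b \<in> K0" "c \<in> K0" "x = theta (xa a)" "y = theta (xa b)" "z = theta (xa c)"
        by (auto simp: code_set_Field)
      then show "[decode Field_Sort [x], decode Field_Sort [y], decode Field_Sort [z]] \<in> Interp MS Add \<longleftrightarrow>
          z = x \<otimes>\<^bsub>PSp4\<^esub> y"
        by (simp add: MS_interp theta_mult_GG root_mat_GG xa_add theta_xa_eq K0_add del: theta_inject_GG)
    qed
  next
    case Mu
    \<comment> \<open>This is \<open>mu_iff\<close> read in the group, where
      \<open>theta (mat 1)\<close> is the code of 0.\<close>
    let ?R = "\<lambda>x y z. x = theta (mat 1) \<and> z = theta (mat 1) \<or>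
      (\<exists>q\<in>theta ` rootgp (-1, 1). \<exists>h\<in>theta ` T_mat.
         x \<otimes>\<^bsub>PSp4\<^esub> q \<otimes>\<^bsub>PSp4\<^esub> x = h \<otimes>\<^bsub>PSp4\<^esub> theta na \<and> z \<otimes>\<^bsub>PSp4\<^esub> h = h \<otimes>\<^bsub>PSp4\<^esub> y)"
    show ?thesis unfolding Mu MS_profile
    proof (rule rel3[where R = ?R])
      show "defpred (\<lambda>v. ?R (v 0) (v 1) (v 2))"
        by (intro defpred_intros bex GG_one n_GG)
      fix x y z assume "x \<in> code_set Field_Sort" "y \<in> code_set Field_Sort" "z \<in> code_set Field_Sort"
      then obtain a b c where abc: "a \<in> K0" "b \<in> K0" "c \<in> K0" "x = theta (xa a)" "y = theta (xa b)" "z = theta (xa c)"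
        by (auto simp: code_set_Field)
      have "theta (xa a) \<otimes>\<^bsub>PSp4\<^esub> theta (root_mat (-1, 1) q) \<otimes>\<^bsub>PSp4\<^esub> theta (xa a) = theta A \<otimes>\<^bsub>PSp4\<^esub> theta na \<and>
          theta (xa c) \<otimes>\<^bsub>PSp4\<^esub> theta A = theta A \<otimes>\<^bsub>PSp4\<^esub> theta (xa b) \<longleftrightarrow>
          xa a ** root_mat (-1, 1) q ** xa a = A ** na \<and> xa c ** A = A ** xa b"
        if "q \<in> K0" "A \<in> T_mat" for q A
        using abc(1-3) that TT_GG[OF that(2)]
        by (simp add: theta_mult_GG GG_mult root_mat_GG n_GG)
      then have "(\<exists>q\<in>theta ` rootgp (-1, 1). \<exists>h\<in>theta ` T_mat.
         x \<otimes>\<^bsub>PSp4\<^esub> q \<otimes>\<^bsub>PSp4\<^esub> x = h \<otimes>\<^bsub>PSp4\<^esub> theta na \<and> z \<otimes>\<^bsub>PSp4\<^esub> h = h \<otimes>\<^bsub>PSp4\<^esub> y) \<longleftrightarrow>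
         (\<exists>q\<in>K0. \<exists>A\<in>T_mat. xa a ** root_mat (-1, 1) q ** xa a = A ** na \<and> xa c ** A = A ** xa b)"
        unfolding abc(4-6) rootgp_def by simp
      moreover have "x = theta (mat 1) \<longleftrightarrow> a = 0" "z = theta (mat 1) \<longleftrightarrow> c = 0"
        unfolding one[symmetric] abc(4,6) using abc(1,3) by (simp_all add: theta_xa_eq del: theta_inject_GG)
      ultimately show "[decode Field_Sort [x], decode Field_Sort [y], decode Field_Sort [z]] \<in> Interp MS Mu \<longleftrightarrow> ?R x y z"
        using mu_iff[OF abc(1-3)] abc(1,2) unfolding abc(4-6) by (simp add: MS_interp)
    qed
  next
    case Torus_Mult
    show ?thesis unfolding Torus_Mult MS_profile
    proof (rule rel3[where R = "\<lambda>x y z. z = x \<otimes>\<^bsub>PSp4\<^esub> y"])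
      show "defpred (\<lambda>v. v 2 = v 0 \<otimes>\<^bsub>PSp4\<^esub> v 1)" by (intro defpred_intros)
      fix x y z assume "x \<in> code_set Torus_Sort" "y \<in> code_set Torus_Sort" "z \<in> code_set Torus_Sort"
      then have "x \<in> T" "y \<in> T" by (auto simp: code_set_Torus T_mat_def)
      then show "[decode Torus_Sort [x], decode Torus_Sort [y], decode Torus_Sort [z]] \<in> Interp MS Torus_Mult \<longleftrightarrow>
          z = x \<otimes>\<^bsub>PSp4\<^esub> y" by (simp add: MS_interp)
    qed
  next
    case Act_K0
    show ?thesis unfolding Act_K0 MS_profile
    proof (rule rel3[where R = "\<lambda>t x y. t \<otimes>\<^bsub>PSp4\<^esub> x = y \<otimes>\<^bsub>PSp4\<^esub> t"])
      show "defpred (\<lambda>v. v 0 \<otimes>\<^bsub>PSp4\<^esub> v 1 = v 2 \<otimes>\<^bsub>PSp4\<^esub> v 0)" by (intro defpred_intros)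
      fix t x y assume "t \<in> code_set Torus_Sort" "x \<in> code_set Field_Sort" "y \<in> code_set Field_Sort"
      then obtain A a b where *: "A \<in> T_mat" "a \<in> K0" "b \<in> K0" "t = theta A" "x = theta (xa a)" "y = theta (xa b)"
        by (auto simp: code_set_Field code_set_Torus)
      then show "[decode Torus_Sort [t], decode Field_Sort [x], decode Field_Sort [y]] \<in> Interp MS Act_K0 \<longleftrightarrow>
          t \<otimes>\<^bsub>PSp4\<^esub> x = y \<otimes>\<^bsub>PSp4\<^esub> t"
        using TT_GG[OF *(1)] by (simp add: MS_act theta_mult_GG GG_mult root_mat_GG)
    qed
  next
    case Act_L0
    \<comment> \<open>The codes lie in the short root group, on which \<open>T\<close> acts by
      another character, so both are first carried to the long root group by
      \<open>link\<close>.\<close>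
    let ?R = "\<lambda>t x y. \<exists>x'\<in>theta ` rootgp (0, 2). \<exists>y'\<in>theta ` rootgp (0, 2).
      link x x' \<and> link y y' \<and> t \<otimes>\<^bsub>PSp4\<^esub> x' = y' \<otimes>\<^bsub>PSp4\<^esub> t"
    show ?thesis unfolding Act_L0 MS_profile
    proof (rule rel3[where R = ?R])
      show "defpred (\<lambda>v. ?R (v 0) (v 1) (v 2))"
        by (intro defpred_intros bex defpred_link)
      fix t x y assume "t \<in> code_set Torus_Sort" "x \<in> code_set Field_Sort" "y \<in> code_set Field_Sort"
      then obtain A a b where *: "A \<in> T_mat" "a \<in> K0" "b \<in> K0" "t = theta A" "x = theta (xa a)" "y = theta (xa b)"
        by (auto simp: code_set_Field code_set_Torus)
      have "theta A \<otimes>\<^bsub>PSp4\<^esub> theta (xb c) = theta (xb d) \<otimes>\<^bsub>PSp4\<^esub> theta A \<longleftrightarrow> A ** xb c = xb d ** A"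
        if "c \<in> L0" "d \<in> L0" for c d
        using that TT_GG[OF *(1)] by (simp add: theta_mult_GG GG_mult root_mat_GG)
      then have "?R t x y \<longleftrightarrow> (\<exists>c\<in>L0. \<exists>d\<in>L0. a = c \<and> b = d \<and> A ** xb c = xb d ** A)"
        unfolding *(4-6) rootgp_def using link_iff[OF *(2)] link_iff[OF *(3)]
        by (simp cong: conj_cong)
      then show "[decode Torus_Sort [t], decode Field_Sort [x], decode Field_Sort [y]] \<in> Interp MS Act_L0 \<longleftrightarrow> ?R t x y"
        unfolding *(4-6) by (simp add: MS_act[OF *(1)])
    qed
  qed
  note rel = this
  show ?thesis
    unfolding interpretable_in_def
  proof (rule exI[of _ ?\<sigma>], rule exI[of _ D], rule exI[of _ decode], rule conjI)
    show "\<forall>s. definable GS (?\<sigma> s) (D s) \<and> decode s ` D s = Sort MS s \<and>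
      definable GS (?\<sigma> s @ ?\<sigma> s) {x @ y | x y. x \<in> D s \<and> y \<in> D s \<and> decode s x = decode s y}"
      by (rule allI) (rule sorts)
  qed (rule allI, rule rel)
qed

end

subsection \<open>Interpreting the group in the structure\<close>

lemma (in nonempty_sorts) definable_term_cong:
  assumes "definable_term E s t" "\<And>v. v \<in> envs M E \<Longrightarrow> t v = u v"
  shows "definable_term E s u"
proof -
  have "definable_pred M (case_nat s E) (\<lambda>v. v 0 = u (\<lambda>i. v (Suc i)))"
    by (rule definable_pred_cong[where P = "\<lambda>v. v 0 = t (\<lambda>i. v (Suc i))"])
      (use assms in \<open>simp_all add: definable_term_def\<close>)
  then show ?thesis using assms by (simp add: definable_term_def)
qed

context mixed_group
begin

sublocale MS: nonempty_sorts MS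
proof
  show "Sort MS s \<noteq> {}" for s
    using K0_0 subgroup.one_closed[OF subgroup_T] by (cases s) (auto simp: MS_profile simp del: K0_0)
qed

section \<open>Definable terms with values in \<open>K0\<close>\<close>

definition kterm :: "(nat \<Rightarrow> m_sort) \<Rightarrow> ((nat \<Rightarrow> 'k + ('k^4^4) set) \<Rightarrow> 'k) \<Rightarrow> bool" where
  "kterm E t \<longleftrightarrow> MS.definable_term E Field_Sort (\<lambda>v. Inl (t v))"

lemma kterm_K0: "kterm E t \<Longrightarrow> v \<in> envs MS E \<Longrightarrow> t v \<in> K0"
  by (auto simp: kterm_def MS.definable_term_def MS_profile)

lemma kterm_cong: "kterm E t \<Longrightarrow> (\<And>v. v \<in> envs MS E \<Longrightarrow> t v = u v) \<Longrightarrow> kterm E u"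
  unfolding kterm_def by (erule MS.definable_term_cong) simp

lemma kterm_const: "c \<in> K0 \<Longrightarrow> kterm E (\<lambda>v. c)"
  unfolding kterm_def by (rule MS.definable_term_const) (simp add: MS_profile)

lemma kterm_var:
  assumes "E i = Field_Sort"
  shows "kterm E (\<lambda>v. projl (v i))"
  unfolding kterm_def
proof (rule MS.definable_term_cong)
  show "MS.definable_term E Field_Sort (\<lambda>v. v i)" by (rule MS.definable_term_var[where S = E, OF assms])
  fix v assume "v \<in> envs MS E"
  then have "v i \<in> Sort MS (E i)" by (simp add: envs_def)
  then show "v i = Inl (projl (v i))" by (auto simp: assms MS_profile)
qed

lemma kterm_shift: "kterm E t \<Longrightarrow> kterm (case_nat s E) (\<lambda>v. t (\<lambda>i. v (Suc i)))"
  unfolding kterm_def by (rule MS.definable_term_shift)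

lemma ktermI:
  assumes "\<And>v. v \<in> envs MS E \<Longrightarrow> t v \<in> K0"
    and "definable_pred MS (case_nat Field_Sort E) (\<lambda>v. projl (v 0) = t (\<lambda>i. v (Suc i)))"
  shows "kterm E t"
proof -
  have "definable_pred MS (case_nat Field_Sort E) (\<lambda>v. v 0 = Inl (t (\<lambda>i. v (Suc i))))"
    by (rule definable_pred_cong[OF assms(2)]) (auto simp: MS_profile)
  then show ?thesis using assms(1) by (auto simp: kterm_def MS.definable_term_def MS_profile)
qed

lemma kterm_fun:
  assumes t: "kterm E t" and u: "kterm E u"
    and F: "\<And>a b. a \<in> K0 \<Longrightarrow> b \<in> K0 \<Longrightarrow> F a b \<in> K0"
    and r: "\<And>a b c. a \<in> K0 \<Longrightarrow> b \<in> K0 \<Longrightarrow> c \<in> K0 \<Longrightarrow> [Inl a, Inl b, Inl c] \<in> Interp MS r \<longleftrightarrow> c = F a b"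
  shows "kterm E (\<lambda>v. F (t v) (u v))"
proof (rule ktermI)
  let ?t = "\<lambda>v. t (\<lambda>i. v (Suc i))" and ?u = "\<lambda>v. u (\<lambda>i. v (Suc i))"
  show "F (t v) (u v) \<in> K0" if "v \<in> envs MS E" for v
    using F t u kterm_K0 that by blast
  have "definable_pred MS (case_nat Field_Sort E) (\<lambda>v. [Inl (?t v), Inl (?u v), v 0] \<in> Interp MS r)"
  proof (rule MS.definable_pred_subst3[where P = "\<lambda>x y z. [x, y, z] \<in> Interp MS r"])
    show "MS.definable_term (case_nat Field_Sort E) Field_Sort (\<lambda>v. Inl (?t v))"
      using kterm_shift[OF t] by (simp add: kterm_def)
    show "MS.definable_term (case_nat Field_Sort E) Field_Sort (\<lambda>v. Inl (?u v))"
      using kterm_shift[OF u] by (simp add: kterm_def)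
    show "MS.definable_term (case_nat Field_Sort E) Field_Sort (\<lambda>v. v 0)"
      by (rule MS.definable_term_var) simp
  qed (use MS.definable_pred_rel[of _ "[2, 1, 0]"] in simp)
  then show "definable_pred MS (case_nat Field_Sort E) (\<lambda>v. projl (v 0) = F (?t v) (?u v))"
    by (rule definable_pred_cong) (use r kterm_K0[OF t] kterm_K0[OF u] in \<open>auto simp: MS_profile\<close>)
qed

lemma kterm_add: "kterm E t \<Longrightarrow> kterm E u \<Longrightarrow> kterm E (\<lambda>v. t v + u v)"
  by (rule kterm_fun[where F = "(+)" and r = Add]) (simp_all add: MS_interp K0_add)

lemma kterm_mu: "kterm E t \<Longrightarrow> kterm E u \<Longrightarrow> kterm E (\<lambda>v. (t v)\<^sup>2 * u v)"
  by (rule kterm_fun[where F = "\<lambda>a b. a\<^sup>2 * b" and r = Mu]) (simp_all add: MS_interp square_K0_mult)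

lemma kterm_square: "kterm E t \<Longrightarrow> kterm E (\<lambda>v. (t v)\<^sup>2)"
  using kterm_mu[OF _ kterm_const[OF one_K0]] by simp

lemma definable_pred_kterm_eq:
  "kterm E t \<Longrightarrow> kterm E u \<Longrightarrow> definable_pred MS E (\<lambda>v. t v = u v)"
  using MS.definable_pred_eq[of E Field_Sort "\<lambda>v. Inl (t v)" "\<lambda>v. Inl (u v)"] by (simp add: kterm_def)

lemma kterm_if: "kterm E t \<Longrightarrow> kterm E u \<Longrightarrow> kterm E (\<lambda>v. if b then t v else u v)"
  by (cases b) auto

text \<open>The product is a partial operation on \<^term>\<open>K0\<close>; its graph \<open>z = x y\<close> is defined by \<open>z\<^sup>2 = x\<^sup>2 y\<^sup>2\<close>.\<close>

lemma kterm_times: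
  assumes "kterm E t" "kterm E u" "\<And>v. v \<in> envs MS E \<Longrightarrow> t v * u v \<in> K0"
  shows "kterm E (\<lambda>v. t v * u v)"
proof (rule ktermI)
  have "definable_pred MS (case_nat Field_Sort E)
      (\<lambda>v. (projl (v 0))\<^sup>2 = (t (\<lambda>i. v (Suc i)))\<^sup>2 * (u (\<lambda>i. v (Suc i)))\<^sup>2)"
    using assms(1,2) by (intro definable_pred_kterm_eq kterm_square kterm_mu kterm_var kterm_shift) auto
  then show "definable_pred MS (case_nat Field_Sort E) (\<lambda>v. projl (v 0) = t (\<lambda>i. v (Suc i)) * u (\<lambda>i. v (Suc i)))"
    by (simp add: power_mult_distrib[symmetric] square_inject)
qed (rule assms(3))

text \<open>The two equations \<open>z\<^sup>2 * x = z\<close> and \<open>x\<^sup>2 * z = x\<close>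
  use only \<mu>. Together they characterize the inverse, including the convention that the inverse
  of 0 is 0.\<close>

lemma kterm_inverse:
  assumes "kterm E t"
  shows "kterm E (\<lambda>v. inverse (t v))"
proof (rule ktermI)
  have "definable_pred MS (case_nat Field_Sort E)
      (\<lambda>v. (projl (v 0))\<^sup>2 * t (\<lambda>i. v (Suc i)) = projl (v 0) \<and> (t (\<lambda>i. v (Suc i)))\<^sup>2 * projl (v 0) = t (\<lambda>i. v (Suc i)))"
    using assms by (intro definable_pred_conj definable_pred_kterm_eq kterm_mu kterm_var kterm_shift) auto
  moreover have "z\<^sup>2 * x = z \<and> x\<^sup>2 * z = x \<longleftrightarrow> z = inverse x" for x z :: 'k
    by (cases "x = 0") (auto simp: power2_eq_square field_simps)
  ultimately show "definable_pred MS (case_nat Field_Sort E) (\<lambda>v. projl (v 0) = inverse (t (\<lambda>i. v (Suc i))))"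
    by simp
qed (use assms kterm_K0 inverse_K0 in blast)

text \<open>Matrix entries need not lie in \<^term>\<open>K0\<close>, but their squares do, and squaring is injective.\<close>

definition sqterm :: "(nat \<Rightarrow> m_sort) \<Rightarrow> ((nat \<Rightarrow> 'k + ('k^4^4) set) \<Rightarrow> 'k^4^4) \<Rightarrow> bool" where
  "sqterm E A \<longleftrightarrow> (\<forall>i j. kterm E (\<lambda>v. (A v $ i $ j)\<^sup>2))"

lemma sqterm_one: "sqterm E (\<lambda>v. mat 1)"
  unfolding sqterm_def by (intro allI kterm_const) simp

text \<open>Squaring is additive, so the square of an entry of the product is a sum of products of
  squared entries. Each summand is itself a square and thus in \<open>K0\<close>, as
  \<open>kterm_times\<close> demands.\<close>

lemma sqterm_mult:
  assumes "sqterm E A" "sqterm E B"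
  shows "sqterm E (\<lambda>v. A v ** B v)"
  unfolding sqterm_def
proof (intro allI)
  fix i j :: 4
  have "kterm E (\<lambda>v. (A v $ i $ k)\<^sup>2 * (B v $ k $ j)\<^sup>2)" for k
    using assms by (intro kterm_times) (simp_all add: sqterm_def power_mult_distrib[symmetric])
  then have "kterm E (\<lambda>v. (A v $ i $ 1)\<^sup>2 * (B v $ 1 $ j)\<^sup>2 + (A v $ i $ 2)\<^sup>2 * (B v $ 2 $ j)\<^sup>2 +
     (A v $ i $ 3)\<^sup>2 * (B v $ 3 $ j)\<^sup>2 + (A v $ i $ 4)\<^sup>2 * (B v $ 4 $ j)\<^sup>2)"
    by (intro kterm_add)
  then show "kterm E (\<lambda>v. ((A v ** B v) $ i $ j)\<^sup>2)"
    by (simp add: matrix_matrix_mult_def sum_4 add_square power_mult_distrib)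
qed

lemma sqterm_root_mat:
  assumes "kterm E t"
  shows "sqterm E (\<lambda>v. root_mat \<gamma> (t v))"
  unfolding sqterm_def
proof (intro allI)
  fix i j :: 4
  have "kterm E (\<lambda>v. (mat 1 $ i $ j)\<^sup>2 + (t v)\<^sup>2 * (root_vector \<gamma> $ i $ j)\<^sup>2)"
    using assms by (intro kterm_add kterm_mu kterm_const) simp_all
  then show "kterm E (\<lambda>v. (root_mat \<gamma> (t v) $ i $ j)\<^sup>2)"
    by (simp add: root_mat_def add_square power_mult_distrib)
qed

lemma sqterm_word:
  "length ks = length \<gamma>s \<Longrightarrow> \<forall>k\<in>set ks. E k = Field_Sort \<Longrightarrow>
   sqterm E (\<lambda>v. word \<gamma>s (map (\<lambda>k. projl (v k)) ks))"
proof (induction ks \<gamma>s rule: list_induct2)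
  case (Cons k ks \<gamma> \<gamma>s)
  then have "sqterm E (\<lambda>v. root_mat \<gamma> (projl (v k)) ** word \<gamma>s (map (\<lambda>k. projl (v k)) ks))"
    by (intro sqterm_mult sqterm_root_mat kterm_var) auto
  then show ?case by simp
qed (simp add: sqterm_one)

section \<open>Torus matrices recovered from the two actions\<close>

definition tmat :: "'k + ('k^4^4) set \<Rightarrow> 'k^4^4" where
  "tmat x = (THE A. A \<in> T_mat \<and> x = Inr (theta A))"

lemma tmat_eq: "A \<in> T_mat \<Longrightarrow> tmat (Inr (theta A)) = A"
  unfolding tmat_def using theta_inject_GG TT_GG by (intro the_equality) auto

lemma torus_sort_cases:
  assumes "v \<in> envs MS E" "E i = Torus_Sort"
  obtains s t where "s \<noteq> 0" "t \<noteq> 0" "torus_mat s t \<in> T_mat" "v i = Inr (theta (torus_mat s t))"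
    "tmat (v i) = torus_mat s t"
proof -
  have "v i \<in> Sort MS (E i)" using assms(1) by (simp add: envs_def)
  then obtain x where x: "x \<in> T" "v i = Inr x" by (auto simp: assms(2) MS_profile)
  from x(1) obtain A where A: "A \<in> T_mat" "x = theta A" using T_theta by blast
  obtain s t where "A = torus_mat s t" "s \<noteq> 0" "t \<noteq> 0" using A(1) by (rule TT_torus_mat)
  then show thesis using A tmat_eq[OF A(1)] by (intro that[of s t]) (simp_all add: x(2))
qed

lemma torus_mat_nth:
  "torus_mat s t $ 1 $ 1 = (s :: 'k)" "torus_mat s t $ 2 $ 2 = (t :: 'k)"
  by (simp_all add: torus_mat_def)

text \<open>The action on \<open>xa\<close> sends parameter 1 to s / t, the value of the root
  \<alpha>; \<open>kterm_beta\<close> reads off the value of \<beta> in the same way.\<close>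

lemma kterm_alpha:
  assumes i: "E i = Torus_Sort"
  shows "kterm E (\<lambda>v. tmat (v i) $ 1 $ 1 / tmat (v i) $ 2 $ 2)"
proof (rule ktermI)
  show "tmat (v i) $ 1 $ 1 / tmat (v i) $ 2 $ 2 \<in> K0" if v: "v \<in> envs MS E" for v
  proof -
    obtain s t where "s \<noteq> 0" "t \<noteq> 0" "torus_mat s t \<in> T_mat" "tmat (v i) = torus_mat s t"
      using torus_sort_cases[OF v i] by metis
    then show ?thesis using TT_mult_U4[of s t 1 0 0 0] U4_S by (simp add: torus_mat_nth)
  qed
  have "definable_pred MS (case_nat Field_Sort E) (\<lambda>v. [v (Suc i), Inl 1, v 0] \<in> Interp MS Act_K0)"
  proof (rule MS.definable_pred_subst3[where P = "\<lambda>x y z. [x, y, z] \<in> Interp MS Act_K0"])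
    show "MS.definable_term (case_nat Field_Sort E) Torus_Sort (\<lambda>v. v (Suc i))"
      by (rule MS.definable_term_var) (simp add: i)
    show "MS.definable_term (case_nat Field_Sort E) Field_Sort (\<lambda>v. Inl 1)"
      by (rule MS.definable_term_const) (simp add: MS_profile)
    show "MS.definable_term (case_nat Field_Sort E) Field_Sort (\<lambda>v. v 0)"
      by (rule MS.definable_term_var) simp
  qed (use MS.definable_pred_rel[of _ "[2, 1, 0]"] in simp)
  then show "definable_pred MS (case_nat Field_Sort E)
      (\<lambda>v. projl (v 0) = tmat (v (Suc i)) $ 1 $ 1 / tmat (v (Suc i)) $ 2 $ 2)"
  proof (rule definable_pred_cong)
    fix v assume v: "v \<in> envs MS (case_nat Field_Sort E)"
    then obtain b where b: "b \<in> K0" "v 0 = Inl b" by (auto simp: MS_profile)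
    obtain s t where st: "s \<noteq> 0" "t \<noteq> 0" "torus_mat s t \<in> T_mat" "v (Suc i) = Inr (theta (torus_mat s t))"
      "tmat (v (Suc i)) = torus_mat s t"
      using torus_sort_cases[OF v, of "Suc i"] i by auto
    have "torus_mat s t ** xa 1 = xa b ** torus_mat s t \<longleftrightarrow> b = s / t"
      using st(1,2) by (auto simp: group_simps field_simps)
    then show "[v (Suc i), Inl 1, v 0] \<in> Interp MS Act_K0 \<longleftrightarrow>
        projl (v 0) = tmat (v (Suc i)) $ 1 $ 1 / tmat (v (Suc i)) $ 2 $ 2"
      using b(1) unfolding st(5) torus_mat_nth unfolding st(4) b(2) MS_act[OF st(3)] by simp
  qed
qed

lemma kterm_beta:
  assumes i: "E i = Torus_Sort"
  shows "kterm E (\<lambda>v. (tmat (v i) $ 2 $ 2)\<^sup>2)"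
proof (rule ktermI)
  have "definable_pred MS (case_nat Field_Sort E) (\<lambda>v. [v (Suc i), Inl 1, v 0] \<in> Interp MS Act_L0)"
  proof (rule MS.definable_pred_subst3[where P = "\<lambda>x y z. [x, y, z] \<in> Interp MS Act_L0"])
    show "MS.definable_term (case_nat Field_Sort E) Torus_Sort (\<lambda>v. v (Suc i))"
      by (rule MS.definable_term_var) (simp add: i)
    show "MS.definable_term (case_nat Field_Sort E) Field_Sort (\<lambda>v. Inl 1)"
      by (rule MS.definable_term_const) (simp add: MS_profile)
    show "MS.definable_term (case_nat Field_Sort E) Field_Sort (\<lambda>v. v 0)"
      by (rule MS.definable_term_var) simp
  qed (use MS.definable_pred_rel[of _ "[2, 1, 0]"] in simp)
  then show "definable_pred MS (case_nat Field_Sort E) (\<lambda>v. projl (v 0) = (tmat (v (Suc i)) $ 2 $ 2)\<^sup>2)"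
  proof (rule definable_pred_cong)
    fix v assume v: "v \<in> envs MS (case_nat Field_Sort E)"
    then obtain b where b: "b \<in> K0" "v 0 = Inl b" by (auto simp: MS_profile)
    obtain s t where st: "s \<noteq> 0" "t \<noteq> 0" "torus_mat s t \<in> T_mat" "v (Suc i) = Inr (theta (torus_mat s t))"
      "tmat (v (Suc i)) = torus_mat s t"
      using torus_sort_cases[OF v, of "Suc i"] i by auto
    have "torus_mat s t ** xb 1 = xb b ** torus_mat s t \<longleftrightarrow> b = t\<^sup>2"
      using st(1,2) by (auto simp: group_simps field_simps power2_eq_square)
    then show "[v (Suc i), Inl 1, v 0] \<in> Interp MS Act_L0 \<longleftrightarrow> projl (v 0) = (tmat (v (Suc i)) $ 2 $ 2)\<^sup>2"
      unfolding st(5) torus_mat_nth unfolding st(4) b(2) MS_act[OF st(3)] by auto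
  qed
qed simp

text \<open>The entries s and t need not lie in \<open>K0\<close>. The actions provide s / t and the
  square of t; the square of s is \<mu> applied to these two, and \<open>kterm_inverse\<close> gives
  the remaining diagonal entries.\<close>

lemma sqterm_tmat:
  assumes i: "E i = Torus_Sort"
  shows "sqterm E (\<lambda>v. tmat (v i))"
proof -
  let ?t2 = "\<lambda>v. (tmat (v i) $ 2 $ 2)\<^sup>2"
  let ?s2 = "\<lambda>v. (tmat (v i) $ 1 $ 1 / tmat (v i) $ 2 $ 2)\<^sup>2 * ?t2 v"
  have t2: "kterm E ?t2" using i by (rule kterm_beta)
  have s2: "kterm E ?s2" using i by (intro kterm_mu kterm_alpha t2)
  define u where "u k l v = (if k \<noteq> l then 0 else if k = 1 then ?s2 v else if k = 2 then ?t2 v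
      else if k = 3 then inverse (?t2 v) else inverse (?s2 v))" for k l :: 4 and v
  have ku: "kterm E (u k l)" for k l
    unfolding u_def by (intro kterm_if kterm_const K0_0 kterm_inverse s2 t2)
  have eq: "u k l v = (tmat (v i) $ k $ l)\<^sup>2" if v: "v \<in> envs MS E" for k l v
  proof -
    obtain s t where "s \<noteq> 0" "t \<noteq> 0" "tmat (v i) = torus_mat s t"
      using torus_sort_cases[OF v i] by metis
    then show ?thesis by (simp add: u_def torus_mat_nth power_divide) (simp add: torus_mat_def power_inverse)
  qed
  show ?thesis unfolding sqterm_def by (intro allI) (rule kterm_cong[OF ku eq])
qed

lemma definable_pred_sqterm_eq:
  assumes "sqterm E A" "sqterm E B"
  shows "definable_pred MS E (\<lambda>v. A v = B v)"
proof -
  have "definable_pred MS E (\<lambda>v. \<forall>i\<in>UNIV. \<forall>j\<in>UNIV. (A v $ i $ j)\<^sup>2 = (B v $ i $ j)\<^sup>2)"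
    using assms by (intro MS.definable_pred_ball_finite definable_pred_kterm_eq) (auto simp: sqterm_def)
  then show ?thesis by (simp add: square_inject vec_eq_iff)
qed

section \<open>Codes of group elements by a torus element and word parameters\<close>

definition code_sorts :: "m_sort list" where
  "code_sorts = Torus_Sort # replicate (length roots) Field_Sort"

definition code_mat :: "('k + ('k^4^4) set) list \<Rightarrow> 'k^4^4" where
  "code_mat xs = tmat (hd xs) ** word roots (map projl (tl xs))"

definition codes :: "('k + ('k^4^4) set) list set" where
  "codes = {Inr (theta A) # map Inl as | A as. A \<in> T_mat \<and> as \<in> params roots}"

lemma code_mat_codes: "code_mat ` codes = G_mat"
proof -
  have "code_mat (Inr (theta A) # map Inl as) = A ** word roots as" if "A \<in> T_mat" for A as
    using that by (simp add: code_mat_def tmat_eq comp_def)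
  then show ?thesis unfolding GG_word codes_def by (auto simp: image_iff) metis+
qed

lemma sqterm_code_mat:
  assumes "map E ks = code_sorts"
  shows "sqterm E (\<lambda>v. code_mat (map v ks))"
proof -
  obtain k ks' where ks: "ks = k # ks'" "E k = Torus_Sort" "map E ks' = replicate (length roots) Field_Sort"
    using assms unfolding code_sorts_def by (cases ks) auto
  have "length ks' = length roots" using arg_cong[OF ks(3), of length] by simp
  moreover have "\<forall>k\<in>set ks'. E k = Field_Sort"
    using arg_cong[OF ks(3), of set] by (auto split: if_splits)
  ultimately have "sqterm E (\<lambda>v. tmat (v k) ** word roots (map (\<lambda>k. projl (v k)) ks'))"
    using ks(2) by (intro sqterm_mult sqterm_tmat sqterm_word)
  then show ?thesis by (simp add: code_mat_def ks(1) comp_def)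
qed

text \<open>All word parameters have sort \<open>K0\<close>, so only the positions of long roots
  carry a further condition. The index \<open>Suc i\<close> skips the torus element at the
  head.\<close>

lemma codes_iff:
  "xs \<in> codes \<longleftrightarrow> xs \<in> tuples MS code_sorts \<and>
     (\<forall>i<length roots. roots ! i \<in> long_roots \<longrightarrow> [xs ! Suc i] \<in> Interp MS In_L0)"
proof
  assume "xs \<in> codes"
  then obtain A as where xs: "xs = Inr (theta A) # map Inl as" "A \<in> T_mat" "as \<in> params roots"
    by (auto simp: codes_def)
  have len: "length as = length roots" and as: "\<And>i. i < length roots \<Longrightarrow> as ! i \<in> param (roots ! i)"
    using xs(3) by (auto simp: params_def list_all2_conv_all_nth)
  have "as ! i \<in> K0" if "i < length roots" for i
    using as[OF that] L0_K0 by (auto simp: param_def split: if_splits)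
  then have "map Inl as \<in> tuples MS (replicate (length roots) Field_Sort)"
    using len by (auto simp: mem_tuples list_all2_conv_all_nth MS_profile)
  then have "xs \<in> tuples MS code_sorts"
    using xs(2) by (simp add: xs(1) code_sorts_def mem_tuples MS_profile T_mat_def)
  moreover have "[xs ! Suc i] \<in> Interp MS In_L0" if "i < length roots" "roots ! i \<in> long_roots" for i
    using as[OF that(1)] that by (simp add: xs(1) len MS_interp param_long)
  ultimately show "xs \<in> tuples MS code_sorts \<and>
     (\<forall>i<length roots. roots ! i \<in> long_roots \<longrightarrow> [xs ! Suc i] \<in> Interp MS In_L0)" by blast
next
  assume R: "xs \<in> tuples MS code_sorts \<and>
     (\<forall>i<length roots. roots ! i \<in> long_roots \<longrightarrow> [xs ! Suc i] \<in> Interp MS In_L0)"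
  then obtain x ys where xs: "xs = x # ys" "x \<in> Inr ` T" "ys \<in> tuples MS (replicate (length roots) Field_Sort)"
    by (auto simp: code_sorts_def mem_tuples list_all2_Cons2 MS_profile)
  obtain A where A: "A \<in> T_mat" "x = Inr (theta A)" using xs(2) T_theta by blast
  have len: "length ys = length roots" and ys: "\<And>i. i < length roots \<Longrightarrow> ys ! i \<in> Inl ` K0"
    using xs(3) by (auto simp: mem_tuples list_all2_conv_all_nth MS_profile)
  have "set ys \<subseteq> Inl ` K0" using ys len by (auto simp: in_set_conv_nth)
  then have "ys = map Inl (map projl ys)" by (auto simp: map_idI comp_def intro!: map_idI[symmetric])
  moreover have "map projl ys \<in> params roots"
    unfolding params_def
  proof (simp add: list_all2_conv_all_nth len, intro allI impI)
    fix i assume i: "i < length roots"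
    obtain a where a: "a \<in> K0" "ys ! i = Inl a" using ys[OF i] by blast
    show "projl (ys ! i) \<in> param (roots ! i)"
    proof (cases "roots ! i \<in> long_roots")
      case True
      then have "[ys ! i] \<in> Interp MS In_L0" using R i by (simp add: xs(1))
      then show ?thesis using True by (simp add: a(2) MS_interp param_long)
    qed (simp add: a param_def)
  qed
  ultimately show "xs \<in> codes" unfolding codes_def using A xs(1) by blast
qed

lemma definable_pred_codes:
  assumes "map E ks = code_sorts"
  shows "definable_pred MS E (\<lambda>v. map v ks \<in> codes)"
proof -
  have len: "length ks = Suc (length roots)"
    using arg_cong[OF assms, of length] by (simp add: code_sorts_def)
  have "definable_pred MS E (\<lambda>v. \<forall>i\<in>{i. i < length roots \<and> roots ! i \<in> long_roots}. map v [ks ! Suc i] \<in> Interp MS In_L0)"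
    by (intro MS.definable_pred_ball_finite MS.definable_pred_rel) simp
  then show ?thesis
    by (rule definable_pred_cong) (use envs_map[OF _ assms] len in \<open>auto simp: codes_iff\<close>)
qed

lemma definable_codes1: "definable MS code_sorts codes"
proof (rule MS.definableI)
  let ?E = "\<lambda>i. if i < length code_sorts then code_sorts ! i else Field_Sort"
  show E: "map ?E [0..<length code_sorts] = code_sorts" by (auto intro: nth_equalityI)
  show "definable_pred MS ?E (\<lambda>v. map v [0..<length code_sorts] \<in> codes)"
    by (rule definable_pred_codes[OF E])
  show "codes \<subseteq> tuples MS code_sorts" using codes_iff by blast
qed simp

lemma length_codes: "x \<in> codes \<Longrightarrow> length x = length code_sorts"
  using codes_iff by (auto simp: mem_tuples dest: list_all2_lengthD)

text \<open>A group element has many codes, as the unipotent pattern occurs twice in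
  \<open>roots\<close>. Equality of codes is therefore equality of the coded matrices, which is
  tested on squared entries.\<close>

lemma definable_codes2:
  "definable MS (code_sorts @ code_sorts)
     {x @ y | x y. x \<in> codes \<and> y \<in> codes \<and> theta (code_mat x) = theta (code_mat y)}" (is "definable MS ?\<sigma> ?X")
proof (rule MS.definableI)
  define n where "n = length code_sorts"
  let ?E = "\<lambda>i. if i < length ?\<sigma> then ?\<sigma> ! i else Field_Sort"
  show "map ?E [0..<length ?\<sigma>] = ?\<sigma>" by (auto intro: nth_equalityI)
  have E: "map ?E [0..<n] = code_sorts" "map ?E [n..<n + n] = code_sorts"
    by (auto simp: n_def nth_append intro!: nth_equalityI)
  show "?X \<subseteq> tuples MS ?\<sigma>"
    using codes_iff by (auto simp: mem_tuples intro!: list_all2_appendI)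
  let ?P = "\<lambda>v. map v [0..<n] \<in> codes \<and> map v [n..<n + n] \<in> codes \<and>
      code_mat (map v [0..<n]) = code_mat (map v [n..<n + n])"
  show "definable_pred MS ?E ?P"
    using E by (intro definable_pred_conj definable_pred_codes definable_pred_sqterm_eq sqterm_code_mat)
  show "map v [0..<length ?\<sigma>] \<in> ?X \<longleftrightarrow> ?P v" for v
  proof -
    have split: "map v [0..<length ?\<sigma>] = map v [0..<n] @ map v [n..<n + n]"
      using upt_add_eq_append[of 0 n n] by (simp add: n_def)
    have inj: "theta (code_mat x) = theta (code_mat y) \<longleftrightarrow> code_mat x = code_mat y" if "x \<in> codes" "y \<in> codes" for x y
      using that code_mat_codes theta_inject_GG by blast
    show ?thesis
    proof
      assume "map v [0..<length ?\<sigma>] \<in> ?X"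
      then obtain x y where xy: "map v [0..<n] @ map v [n..<n + n] = x @ y" "x \<in> codes" "y \<in> codes"
        "theta (code_mat x) = theta (code_mat y)" unfolding split by blast
      then have "map v [0..<n] = x" "map v [n..<n + n] = y" using length_codes[OF xy(2)] by (simp_all add: n_def)
      then show "?P v" using xy inj by simp
    next
      assume P: "?P v"
      then have "theta (code_mat (map v [0..<n])) = theta (code_mat (map v [n..<n + n]))" by simp
      with P show "map v [0..<length ?\<sigma>] \<in> ?X" unfolding split by blast
    qed
  qed
qed

lemma definable_codes3:
  "definable MS (code_sorts @ code_sorts @ code_sorts)
     {x @ y @ z | x y z. x \<in> codes \<and> y \<in> codes \<and> z \<in> codes \<and>
        theta (code_mat z) = theta (code_mat x) \<otimes>\<^bsub>PSp4\<^esub> theta (code_mat y)}" (is "definable MS ?\<sigma> ?X")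
proof (rule MS.definableI)
  define n where "n = length code_sorts"
  let ?E = "\<lambda>i. if i < length ?\<sigma> then ?\<sigma> ! i else Field_Sort"
  show "map ?E [0..<length ?\<sigma>] = ?\<sigma>" by (auto intro: nth_equalityI)
  have E: "map ?E [0..<n] = code_sorts" "map ?E [n..<n + n] = code_sorts" "map ?E [n + n..<n + n + n] = code_sorts"
    by (auto simp: n_def nth_append intro!: nth_equalityI)
  show "?X \<subseteq> tuples MS ?\<sigma>"
    using codes_iff by (auto simp: mem_tuples intro!: list_all2_appendI)
  let ?x = "\<lambda>v. map v [0..<n]" and ?y = "\<lambda>v. map v [n..<n + n]" and ?z = "\<lambda>v. map v [n + n..<n + n + n]"
  let ?P = "\<lambda>v. ?x v \<in> codes \<and> ?y v \<in> codes \<and> ?z v \<in> codes \<and>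
      code_mat (?z v) = code_mat (?x v) ** code_mat (?y v)"
  show "definable_pred MS ?E ?P"
    using E by (intro definable_pred_conj definable_pred_codes definable_pred_sqterm_eq sqterm_mult sqterm_code_mat)
  show "map v [0..<length ?\<sigma>] \<in> ?X \<longleftrightarrow> ?P v" for v
  proof -
    have split: "map v [0..<length ?\<sigma>] = ?x v @ ?y v @ ?z v"
      using upt_add_eq_append[of 0 n "n + n"] upt_add_eq_append[of n "n + n" n] by (simp add: n_def add.assoc)
    have mult: "theta (code_mat z) = theta (code_mat x) \<otimes>\<^bsub>PSp4\<^esub> theta (code_mat y) \<longleftrightarrow>
        code_mat z = code_mat x ** code_mat y" if "x \<in> codes" "y \<in> codes" "z \<in> codes" for x y z
    proof -
      have "code_mat x \<in> G_mat" "code_mat y \<in> G_mat" "code_mat z \<in> G_mat" using that code_mat_codes by blast+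
      then show ?thesis by (simp add: theta_mult_GG GG_mult)
    qed
    show ?thesis
    proof
      assume "map v [0..<length ?\<sigma>] \<in> ?X"
      then obtain x y z where xy: "?x v @ ?y v @ ?z v = x @ y @ z" "x \<in> codes" "y \<in> codes" "z \<in> codes"
        "theta (code_mat z) = theta (code_mat x) \<otimes>\<^bsub>PSp4\<^esub> theta (code_mat y)" unfolding split by blast
      then have "?x v = x" "?y v = y" "?z v = z"
        using length_codes[OF xy(2)] length_codes[OF xy(3)] by (simp_all add: n_def)
      then show "?P v" using xy mult by simp
    next
      assume P: "?P v"
      then have "theta (code_mat (?z v)) = theta (code_mat (?x v)) \<otimes>\<^bsub>PSp4\<^esub> theta (code_mat (?y v))"
        using mult by blast
      with P show "map v [0..<length ?\<sigma>] \<in> ?X" unfolding split by blast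
    qed
  qed
qed

lemma G_interpretable_in_M: "interpretable_in GS MS"
proof -
  let ?f = "\<lambda>_::unit. \<lambda>x. theta (code_mat x)"
  have "{concat xs | xs. xs \<in> listset (map (\<lambda>_. codes) [(), (), ()]) \<and> map2 ?f [(), (), ()] xs \<in> Interp GS r} =
     {x @ y @ z | x y z. x \<in> codes \<and> y \<in> codes \<and> z \<in> codes \<and>
        theta (code_mat z) = theta (code_mat x) \<otimes>\<^bsub>PSp4\<^esub> theta (code_mat y)}" (is "?L = ?R") for r
  proof (intro subset_antisym subsetI)
    fix l assume "l \<in> ?L"
    then obtain x y z where "x \<in> codes" "y \<in> codes" "z \<in> codes" "l = x @ y @ z"
      "[theta (code_mat x), theta (code_mat y), theta (code_mat z)] \<in> Interp GS r"
      by (auto simp: set_Cons_def)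
    then show "l \<in> ?R" by auto
  next
    fix l assume "l \<in> ?R"
    then obtain x y z where *: "x \<in> codes" "y \<in> codes" "z \<in> codes" "l = x @ y @ z"
      "theta (code_mat z) = theta (code_mat x) \<otimes>\<^bsub>PSp4\<^esub> theta (code_mat y)" by blast
    then have "theta (code_mat x) \<in> theta ` G_mat" "theta (code_mat y) \<in> theta ` G_mat"
      using code_mat_codes by blast+
    with * show "l \<in> ?L"
      by (intro CollectI exI[of _ "[x, y, z]"]) (simp add: set_Cons_def)
  qed
  then have rel: "definable MS (concat (map (\<lambda>_. code_sorts) (Profile GS r)))
      {concat xs | xs. xs \<in> listset (map (\<lambda>_. codes) (Profile GS r)) \<and> map2 ?f (Profile GS r) xs \<in> Interp GS r}" for r
    using definable_codes3 by simp
  have img: "(\<lambda>x. theta (code_mat x)) ` codes = theta ` G_mat"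
    unfolding code_mat_codes[symmetric] by (simp add: image_image)
  show ?thesis
    unfolding interpretable_in_def
  proof (rule exI[of _ "\<lambda>_. code_sorts"], rule exI[of _ "\<lambda>_. codes"], rule exI[of _ ?f], rule conjI)
    show "\<forall>s. definable MS code_sorts codes \<and> (\<lambda>x. theta (code_mat x)) ` codes = Sort GS s \<and>
        definable MS (code_sorts @ code_sorts)
         {x @ y | x y. x \<in> codes \<and> y \<in> codes \<and> theta (code_mat x) = theta (code_mat y)}"
      using definable_codes1 definable_codes2 img by simp
  qed (rule allI, rule rel)
qed

lemma interdefinable_and_stable:
  "interdefinable GS MS \<and> (stable GS \<longleftrightarrow> stable MS)"
proof -
  have GM: "interpretable_in GS MS" by (rule G_interpretable_in_M)
  have MG: "interpretable_in MS GS" by (rule M_interpretable_in_G)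
  have "stable GS" if "stable MS"
    using GM that
  proof (rule stable_interpretable)
    show "Sort MS s \<noteq> {}" for s by (rule MS.nonempty)
    show "Interp GS r \<subseteq> tuples GS (Profile GS r)" for r
      using theta_GG_closed by (auto simp: group_struct_def mem_tuples)
  qed simp
  moreover have "stable MS" if "stable GS"
    using MG that
  proof (rule stable_interpretable)
    show "Sort GS s \<noteq> {}" for s by (rule GS.nonempty)
    show "Sort MS s \<inter> Sort MS t = {}" if "s \<noteq> t" for s t
      using that by (cases s; cases t) (auto simp: MS_profile)
    have T: "x \<otimes>\<^bsub>PSp4\<^esub> y \<in> T" if "x \<in> T" "y \<in> T" for x y
      using subgroup.m_closed[OF subgroup_T that] .
    show "Interp MS r \<subseteq> tuples MS (Profile MS r)" for r
      by (cases r) (auto simp: M_struct_def mem_tuples L0_K0 K0_add square_K0_mult T)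
  qed
  ultimately show ?thesis using GM MG unfolding interdefinable_def by blast
qed

end

theorem theorem7p4:
  fixes K0 L0 :: "'k::field set"
    and g :: "('k^4^4) set"
    and T G :: "('k^4^4) set set"
  assumes "weak_indifferent_set K0 L0"
    and "g \<in> carrier PSp4"
    and "subgroup T PSp4"
    and "T \<subseteq> split_torus g"
    and "\<And>t. t \<in> T \<Longrightarrow> conj_by PSp4 t ` PSp4_mixed g L0 K0 = PSp4_mixed g L0 K0"
    and "split_torus g \<inter> PSp4_mixed g L0 K0 \<subseteq> T"
    and G_def: "G = T <#>\<^bsub>PSp4\<^esub> PSp4_mixed g L0 K0"
  shows "interdefinable (group_struct (PSp4\<lparr>carrier := G\<rparr>)) (M_struct g K0 L0 T) \<and>
         (stable (group_struct (PSp4\<lparr>carrier := G\<rparr>)) \<longleftrightarrow> stable (M_struct g K0 L0 T))"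
proof -
  interpret mixed_group K0 L0 g T
    by (intro mixed_group.intro indifferent.intro mixed_group_axioms.intro assms(1-6))
  show ?thesis
    unfolding G_def theta_GG by (rule interdefinable_and_stable)
qed

end
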